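(* Let $k, l \in \mathbb{N} \setminus \{0\}$. For every $i \in \{1, \dots, k\}$ and every $j \in \{1, \dots, l\}$, let $m_i, n_i, p_j, q_j$ be integers with $2 \leq |m_i| \leq n_i$ and $2 \leq |p_j| \leq q_j$. Then $$\mathrm{G}(m_1, n_1) \times \cdots \times \mathrm{G}(m_k, n_k) \cong \mathrm{G}(p_1, q_1) \times \cdots \times \mathrm{G}(p_l, q_l)$$ if and only if $k = l$ and there is a permutation $\sigma \in \mathrm{Sym}(k)$ such that for every $i \in \{1, \dots, k\}$ we have $\mathrm{G}(m_i, n_i) \cong \mathrm{G}(p_{\sigma(i)}, q_{\sigma(i)})$. In this case, for every $i \in \{1, \dots, k\}$: (1) if $|m_i| = n_i$, then $|m_i| = n_i = |p_{\sigma(i)}| = q_{\sigma(i)}$; (2) if $|m_i| \neq n_i$, then $m_i = p_{\sigma(i)}$ and $n_i = q_{\sigma(i)}$.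
   Context: For nonzero integers $m,n$, $\mathrm{BS}(m,n) = \langle a, t \mid t a^m t^{-1} = a^n \rangle$ is the Baumslag-Solitar group. The group $\mathrm{G}(m,n)$ is the relative profinite completion of $\mathrm{BS}(m,n)$ with respect to $\langle a \rangle$: the closure of the image of $\mathrm{BS}(m,n)$ in the Polish group $\mathrm{Sym}(\mathrm{BS}(m,n)/\langle a \rangle)$ (topology of pointwise convergence), where $\mathrm{BS}(m,n)$ acts by left multiplication on $\mathrm{BS}(m,n)/\langle a\rangle$. It is a totally disconnected locally compact group. For topological groups, $G \cong H$ means there is a group isomorphism $\pi : G \to H$ such that $\pi$ and $\pi^{-1}$ are continuous. Products carry the product topology. *)

theory Defs
  imports
    "HOL-Algebra.Bij"
    "HOL-Algebra.Left_Coset"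
    "HOL-Algebra.Product_Groups"
    "HOL-Analysis.Function_Topology"
    "HOL-Combinatorics.Permutations"
begin

section \<open>Group presentations\<close>

text \<open>
  A word is a list of letters; \<open>(x, True)\<close> stands for the generator \<open>x\<close> and \<open>(x, False)\<close> for
  its formal inverse.  A presentation is a set \<open>R\<close> of pairs of words, where \<open>(r, s) \<in> R\<close> is the
  relation \<open>r = s\<close>.  The presented group is the quotient of the monoid of words by the least
  congruence containing \<open>R\<close> and all free cancellations.
\<close>

type_synonym 'g word = "('g \<times> bool) list"

inductive_set pres_rel :: "('g word \<times> 'g word) set \<Rightarrow> ('g word \<times> 'g word) set"
  for R :: "('g word \<times> 'g word) set"
  where
    refl: "(u, u) \<in> pres_rel R"
  | sym: "(u, v) \<in> pres_rel R \<Longrightarrow> (v, u) \<in> pres_rel R"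
  | trans: "(u, v) \<in> pres_rel R \<Longrightarrow> (v, w) \<in> pres_rel R \<Longrightarrow> (u, w) \<in> pres_rel R"
  | cancel: "(u @ [(x, b), (x, \<not> b)] @ v, u @ v) \<in> pres_rel R"
  | relation: "(r, s) \<in> R \<Longrightarrow> (u @ r @ v, u @ s @ v) \<in> pres_rel R"

definition presented_group :: "('g word \<times> 'g word) set \<Rightarrow> 'g word set monoid"
  where "presented_group R =
    \<lparr>carrier = UNIV // pres_rel R,
     monoid.mult = (\<lambda>X Y. \<Union>x\<in>X. \<Union>y\<in>Y. pres_rel R `` {x @ y}),
     one = pres_rel R `` {[]}\<rparr>"

definition pres_class :: "('g word \<times> 'g word) set \<Rightarrow> 'g word \<Rightarrow> 'g word set"
  where "pres_class R w = pres_rel R `` {w}"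

definition letter_power :: "'g \<Rightarrow> int \<Rightarrow> 'g word"
  where "letter_power x e = replicate (nat \<bar>e\<bar>) (x, 0 \<le> e)"

lemma equiv_pres_rel: "equiv UNIV (pres_rel R)"
  by (intro equivI refl_onI symI transI) (auto intro: pres_rel.intros)

lemma pres_rel_append_left:
  assumes "(u, v) \<in> pres_rel R" shows "(w @ u, w @ v) \<in> pres_rel R"
  using assms
proof induction
  case (cancel u x b v)
  then show ?case using pres_rel.cancel[of "w @ u" x b v R] by simp
next
  case (relation r s u v)
  then show ?case using pres_rel.relation[of r s R "w @ u" v] by simp
qed (blast intro: pres_rel.intros)+

lemma pres_rel_append_right:
  assumes "(u, v) \<in> pres_rel R" shows "(u @ w, v @ w) \<in> pres_rel R"
  using assms
proof induction
  case (cancel u x b v)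
  then show ?case using pres_rel.cancel[of u x b "v @ w" R] by simp
next
  case (relation r s u v)
  then show ?case using pres_rel.relation[of r s R u "v @ w"] by simp
qed (blast intro: pres_rel.intros)+

lemma pres_class_eq_iff: "pres_class R u = pres_class R v \<longleftrightarrow> (u, v) \<in> pres_rel R"
  using eq_equiv_class_iff[OF equiv_pres_rel[of R], of u v] by (simp add: pres_class_def)

lemma carrier_presented_group: "carrier (presented_group R) = range (pres_class R)"
  by (auto simp: presented_group_def quotient_def pres_class_def)

lemma one_presented_group: "\<one>\<^bsub>presented_group R\<^esub> = pres_class R []"
  by (simp add: presented_group_def pres_class_def)

lemma mult_presented_group:
  "pres_class R u \<otimes>\<^bsub>presented_group R\<^esub> pres_class R v = pres_class R (u @ v)"
proof -
  have "congruent2 (pres_rel R) (pres_rel R) (\<lambda>x y. pres_rel R `` {x @ y})"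
  proof (rule congruent2I[OF equiv_pres_rel equiv_pres_rel])
    fix x y z :: "('a \<times> bool) list"
    assume "(x, y) \<in> pres_rel R"
    then show "pres_rel R `` {x @ z} = pres_rel R `` {y @ z}"
      by (intro equiv_class_eq[OF equiv_pres_rel] pres_rel_append_right)
  next
    fix x y z :: "('a \<times> bool) list"
    assume "(x, y) \<in> pres_rel R"
    then show "pres_rel R `` {z @ x} = pres_rel R `` {z @ y}"
      by (intro equiv_class_eq[OF equiv_pres_rel] pres_rel_append_left)
  qed
  from UN_equiv_class2[OF equiv_pres_rel equiv_pres_rel this, of u v]
  show ?thesis by (simp add: presented_group_def pres_class_def)
qed

lemma pres_rel_inverse_word:
  "(map (\<lambda>(x, b). (x, \<not> b)) (rev w) @ w, []) \<in> pres_rel R"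
proof (induction w)
  case (Cons l w)
  obtain x b where l: "l = (x, b)" by (cases l)
  have "(map (\<lambda>(x, b). (x, \<not> b)) (rev w) @ [(x, \<not> b), (x, \<not> \<not> b)] @ w,
         map (\<lambda>(x, b). (x, \<not> b)) (rev w) @ w) \<in> pres_rel R"
    by (rule pres_rel.cancel)
  with Cons.IH show ?case by (auto simp: l intro: pres_rel.trans)
qed (simp add: pres_rel.refl)

lemma group_presented_group: "group (presented_group R)"
proof (rule groupI)
  fix x assume "x \<in> carrier (presented_group R)"
  then obtain w where "x = pres_class R w" by (auto simp: carrier_presented_group)
  then show "\<exists>y\<in>carrier (presented_group R). y \<otimes>\<^bsub>presented_group R\<^esub> x = \<one>\<^bsub>presented_group R\<^esub>"
    using pres_rel_inverse_word[of w R]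
    by (auto simp: carrier_presented_group mult_presented_group one_presented_group pres_class_eq_iff)
qed (auto simp: carrier_presented_group mult_presented_group one_presented_group)

section \<open>Baumslag-Solitar groups\<close>

datatype BS_gen = GenA | GenT

definition BS_relations :: "int \<Rightarrow> int \<Rightarrow> (BS_gen word \<times> BS_gen word) set"
  where "BS_relations m n =
    {(letter_power GenT 1 @ letter_power GenA m @ letter_power GenT (- 1), letter_power GenA n)}"

definition BS :: "int \<Rightarrow> int \<Rightarrow> BS_gen word set monoid"
  where "BS m n = presented_group (BS_relations m n)"

definition BS_a :: "int \<Rightarrow> int \<Rightarrow> BS_gen word set"
  where "BS_a m n = pres_class (BS_relations m n) (letter_power GenA 1)"

section \<open>Topological groups\<close>

type_synonym 'a topgroup = "'a monoid \<times> 'a topology"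

definition topgroup_iso :: "'a topgroup \<Rightarrow> 'b topgroup \<Rightarrow> bool"  (infix \<open>\<cong>\<^sub>t\<close> 50)
  where "A \<cong>\<^sub>t B \<longleftrightarrow>
    (\<exists>\<pi> \<in> iso (fst A) (fst B).
       continuous_map (snd A) (snd B) \<pi> \<and>
       continuous_map (snd B) (snd A) (inv_into (carrier (fst A)) \<pi>))"

definition topgroup_prod :: "'i set \<Rightarrow> ('i \<Rightarrow> 'a topgroup) \<Rightarrow> ('i \<Rightarrow> 'a) topgroup"
  where "topgroup_prod I F =
    (product_group I (\<lambda>i. fst (F i)), product_topology (\<lambda>i. snd (F i)) I)"

section \<open>Relative profinite completions\<close>

text \<open>The group of all permutations of \<open>X\<close> is \<open>BijGroup X\<close>; for discrete \<open>X\<close>, the topology of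
  pointwise convergence is the one induced by the product topology on \<open>X \<rightarrow> X\<close>.\<close>

definition perm_topology :: "'a set \<Rightarrow> ('a \<Rightarrow> 'a) topology"
  where "perm_topology X = subtopology (product_topology (\<lambda>_. discrete_topology X) X) (Bij X)"

definition coset_action :: "'a monoid \<Rightarrow> 'a set \<Rightarrow> 'a \<Rightarrow> 'a set \<Rightarrow> 'a set"
  where "coset_action G H g = (\<lambda>C \<in> lcosets\<^bsub>G\<^esub> H. g <#\<^bsub>G\<^esub> C)"

definition rel_profinite_carrier :: "'a monoid \<Rightarrow> 'a set \<Rightarrow> ('a set \<Rightarrow> 'a set) set"
  where "rel_profinite_carrier G H =
    perm_topology (lcosets\<^bsub>G\<^esub> H) closure_of (coset_action G H ` carrier G)"

definition rel_profinite_completion :: "'a monoid \<Rightarrow> 'a set \<Rightarrow> ('a set \<Rightarrow> 'a set) topgroup"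
  where "rel_profinite_completion G H =
    ((BijGroup (lcosets\<^bsub>G\<^esub> H))\<lparr>carrier := rel_profinite_carrier G H\<rparr>,
     subtopology (perm_topology (lcosets\<^bsub>G\<^esub> H)) (rel_profinite_carrier G H))"

definition BS_completion :: "int \<Rightarrow> int \<Rightarrow> (BS_gen word set set \<Rightarrow> BS_gen word set set) topgroup"
  where "BS_completion m n = rel_profinite_completion (BS m n) (generate (BS m n) {BS_a m n})"

lemma topspace_perm_topology: "topspace (perm_topology X) = Bij X"
  by (auto simp: perm_topology_def Bij_def PiE_def dest: bij_betwE)

lemma topspace_rel_profinite_completion:
  "topspace (snd (rel_profinite_completion G H)) = carrier (fst (rel_profinite_completion G H))"
  by (auto simp: rel_profinite_completion_def rel_profinite_carrier_def
      dest: in_closure_of[THEN iffD1])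

section \<open>Basic facts\<close>

lemma pres_class_replicate:
  "pres_class R (replicate k l) = pres_class R [l] [^]\<^bsub>presented_group R\<^esub> k"
proof (induction k)
  case (Suc k)
  have "pres_class R (replicate (Suc k) l) = pres_class R (replicate k l @ [l])"
    by (simp add: replicate_append_same)
  with Suc show ?case by (simp add: mult_presented_group[symmetric])
qed (simp add: one_presented_group)

lemma pres_class_letter_power:
  "pres_class R (letter_power x e) = pres_class R [(x, True)] [^]\<^bsub>presented_group R\<^esub> e"
proof -
  interpret group "presented_group R" by (rule group_presented_group)
  let ?x = "pres_class R [(x, True)]"
  have x: "?x \<in> carrier (presented_group R)"
    unfolding carrier_presented_group by (rule rangeI)
  have "([(x, False), (x, True)], []) \<in> pres_rel R"
    using pres_rel.cancel[of "[]" x False "[]" R] by simp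
  then have "pres_class R [(x, False)] \<otimes>\<^bsub>presented_group R\<^esub> ?x = \<one>\<^bsub>presented_group R\<^esub>"
    unfolding mult_presented_group one_presented_group pres_class_eq_iff by simp
  then have inv: "inv\<^bsub>presented_group R\<^esub> ?x = pres_class R [(x, False)]"
    by (rule inv_equality) (use x in \<open>unfold carrier_presented_group, blast+\<close>)
  show ?thesis
  proof (cases "e < 0")
    case True
    then have w: "letter_power x e = replicate (nat (- e)) (x, False)"
      by (simp add: letter_power_def)
    from True show ?thesis
      unfolding w pres_class_replicate inv[symmetric] nat_pow_inv[OF x] int_pow_def2 by (simp only: if_True)
  next
    case False
    then have w: "letter_power x e = replicate (nat e) (x, True)"
      by (simp add: letter_power_def)
    from False show ?thesis
      unfolding w pres_class_replicate int_pow_def2 by (simp only: if_False)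
  qed
qed

lemma BS_relation:
  fixes m n
  defines "t \<equiv> pres_class (BS_relations m n) (letter_power GenT 1)"
  shows "t \<otimes>\<^bsub>BS m n\<^esub> BS_a m n [^]\<^bsub>BS m n\<^esub> m \<otimes>\<^bsub>BS m n\<^esub> inv\<^bsub>BS m n\<^esub> t = BS_a m n [^]\<^bsub>BS m n\<^esub> n"
proof -
  let ?R = "BS_relations m n"
  interpret group "presented_group ?R" by (rule group_presented_group)
  have gen: "pres_class ?R (letter_power x 1) = pres_class ?R [(x, True)]" for x
    by (simp add: letter_power_def)
  have a: "BS_a m n [^]\<^bsub>BS m n\<^esub> e = pres_class ?R (letter_power GenA e)" for e :: int
    unfolding BS_def BS_a_def gen pres_class_letter_power[of ?R GenA e] ..
  have carr: "pres_class ?R w \<in> carrier (presented_group ?R)" for w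
    unfolding carrier_presented_group by (rule rangeI)
  have t: "inv\<^bsub>BS m n\<^esub> t = pres_class ?R (letter_power GenT (- 1))"
    unfolding BS_def t_def gen pres_class_letter_power[of ?R GenT "- 1"]
      int_pow_neg[OF carr] int_pow_1[OF carr] ..
  have "(letter_power GenT 1 @ letter_power GenA m @ letter_power GenT (- 1),
      letter_power GenA n) \<in> pres_rel ?R"
    using pres_rel.relation[of "letter_power GenT 1 @ letter_power GenA m @ letter_power GenT (- 1)"
        "letter_power GenA n" ?R "[]" "[]"]
    by (simp only: BS_relations_def append_Nil append_Nil2 singletonI)
  then show ?thesis
    unfolding a t unfolding t_def BS_def mult_presented_group append_assoc pres_class_eq_iff .
qed

lemma coset_action_in_Bij:
  assumes "group G" "subgroup H G" "g \<in> carrier G"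
  shows "coset_action G H g \<in> Bij (lcosets\<^bsub>G\<^esub> H)"
proof -
  interpret group G by fact
  have H: "H \<subseteq> carrier G" using assms(2) by (rule subgroup.subset)
  have mem: "h <#\<^bsub>G\<^esub> C \<in> lcosets\<^bsub>G\<^esub> H" if h: "h \<in> carrier G" and C: "C \<in> lcosets\<^bsub>G\<^esub> H" for h C
  proof -
    obtain x where x: "x \<in> carrier G" "C = x <#\<^bsub>G\<^esub> H"
      using C unfolding LCOSETS_def by blast
    then have "h <#\<^bsub>G\<^esub> C = (h \<otimes>\<^bsub>G\<^esub> x) <#\<^bsub>G\<^esub> H"
      using lcos_m_assoc[OF H h x(1)] by simp
    moreover have "h \<otimes>\<^bsub>G\<^esub> x \<in> carrier G" using h x(1) by (rule m_closed)
    ultimately show ?thesis unfolding LCOSETS_def by blast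
  qed
  have undo: "h <#\<^bsub>G\<^esub> (h' <#\<^bsub>G\<^esub> C) = C"
    if "h \<in> carrier G" "h' \<in> carrier G" "h \<otimes>\<^bsub>G\<^esub> h' = \<one>\<^bsub>G\<^esub>" "C \<in> lcosets\<^bsub>G\<^esub> H" for h h' C
  proof -
    have "C \<subseteq> carrier G" using subgroup.lcosets_carrier[OF assms(2,1) that(4)] .
    then show ?thesis
      using lcos_m_assoc[of C h h'] lcos_mult_one[of C] that by simp
  qed
  have "bij_betw (\<lambda>C. g <#\<^bsub>G\<^esub> C) (lcosets\<^bsub>G\<^esub> H) (lcosets\<^bsub>G\<^esub> H)"
  proof (rule bij_betw_byWitness[where f' = "\<lambda>C. inv\<^bsub>G\<^esub> g <#\<^bsub>G\<^esub> C"])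
    show "\<forall>C\<in>lcosets\<^bsub>G\<^esub> H. inv\<^bsub>G\<^esub> g <#\<^bsub>G\<^esub> (g <#\<^bsub>G\<^esub> C) = C"
      using undo[OF inv_closed[OF assms(3)] assms(3) l_inv[OF assms(3)]] by blast
    show "\<forall>C\<in>lcosets\<^bsub>G\<^esub> H. g <#\<^bsub>G\<^esub> (inv\<^bsub>G\<^esub> g <#\<^bsub>G\<^esub> C) = C"
      using undo[OF assms(3) inv_closed[OF assms(3)] r_inv[OF assms(3)]] by blast
    show "(\<lambda>C. g <#\<^bsub>G\<^esub> C) ` (lcosets\<^bsub>G\<^esub> H) \<subseteq> lcosets\<^bsub>G\<^esub> H"
      using mem[OF assms(3)] by blast
    show "(\<lambda>C. inv\<^bsub>G\<^esub> g <#\<^bsub>G\<^esub> C) ` (lcosets\<^bsub>G\<^esub> H) \<subseteq> lcosets\<^bsub>G\<^esub> H"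
      using mem[OF inv_closed[OF assms(3)]] by blast
  qed
  then show ?thesis by (simp add: Bij_def coset_action_def)
qed

end

theory Submission
  imports Defs
begin

text \<open>
  The group \<open>BS m n\<close> acts on its Bass-Serre tree, whose vertices are the cosets of the subgroup generated
  by \<open>a\<close>.  The completion is the closure of \<open>BS m n\<close> in the permutations of these vertices, so it
  acts on the same tree, vertex-transitively and without inversions.  Let \<open>K\<close> be the stabiliser of the
  base vertex, that is, the closure of the powers of \<open>a\<close>.  Normal forms turn vertices into reduced
  lists of digits, and the parent of a vertex is \<open>butlast\<close> of its list; on such lists \<open>a\<close> acts as an
  odometer with carry.  Both halves of the theorem are read off this action.

  \<^bold>\<open>The parameters are invariants\<close> (\<open>parameters_determined\<close>).  Let \<open>\<phi>\<close> be an isomorphism of topological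
  groups.  The powers of \<open>a\<close> with factorial exponents tend to the identity, hence some positive power of \<open>\<phi> a\<close> fixes the
  base vertex; an element of a group acting on a tree without inversions that has such a power fixes a
  vertex itself (\<open>elliptic\<close>), and by continuity so does all of \<open>\<phi> ` K\<close>.  As \<open>a\<close> fixes only the base
  vertex, this used in both directions shows that \<open>\<phi>\<close> carries \<open>K\<close> to a conjugate of the corresponding
  subgroup, without loss of generality to that subgroup itself.  Now the sizes of the \<open>K\<close>-orbits of
  vertices are invariants.  The smallest size of an orbit other than the base vertex is \<open>\<bar>m\<bar>\<close>.  The
  quotient of the orbit sizes of \<open>g x\<close> and \<open>inv g x\<close> for the base vertex \<open>x\<close> (the modular function)
  is a power of \<open>n / \<bar>m\<bar>\<close>, with every exponent occurring, which gives \<open>n\<close>.  If \<open>\<bar>m\<bar> < n\<close>, then the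
  elements \<open>g\<close> at which the modular function equals \<open>n / \<bar>m\<bar>\<close> satisfy
  \<open>g c\<^sup>m\<^sup>N inv g = c\<^sup>n\<^sup>N\<close> for all \<open>c\<close> in \<open>K\<close> and some \<open>N \<noteq> 0\<close>; opposite signs of \<open>m\<close> would make a
  nontrivial power of \<open>a\<close> trivial.

  \<^bold>\<open>Products decompose uniquely\<close> (\<open>topgroup_prod_unique_factors\<close>).  A completion is not the product of two
  nontrivial elementwise commuting subgroups (\<open>factors_trivial\<close>).  Given an isomorphism between two
  finite products of groups with this property, the images of the factors of one product in a factor of
  the other commute and generate it, so exactly one of these images is nontrivial.  The same holds in
  the other direction, and the two resulting maps between the index sets are inverse bijections that
  match isomorphic factors.
\<close>

section \<open>Vertices as reduced digit lists\<close>

text \<open>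
  To define an action of a presented group it suffices to let the letters act so that inverse letters
  cancel and the relators hold.  The set \<open>S\<close> is there because cancellation for \<open>push\<close> below is only
  valid on reduced lists.
\<close>

lemma foldr_pres_rel:
  assumes "(u, v) \<in> pres_rel R" and "x \<in> S"
    and closed: "\<And>l x. x \<in> S \<Longrightarrow> f l x \<in> S"
    and cancel: "\<And>g b x. x \<in> S \<Longrightarrow> f (g, b) (f (g, \<not> b) x) = x"
    and relator: "\<And>r s x. (r, s) \<in> R \<Longrightarrow> x \<in> S \<Longrightarrow> foldr f r x = foldr f s x"
  shows "foldr f u x = foldr f v x"
proof -
  have mem: "foldr f w y \<in> S" if "y \<in> S" for w y
    using that by (induction w) (auto intro: closed)
  show ?thesis
    using assms(1,2)
  proof (induction arbitrary: x)
    case (cancel u g b v)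
    then show ?case using assms(4)[OF mem[OF cancel]] by simp
  next
    case (relation r s u v)
    then show ?case using relator[OF relation(1) mem[OF relation(2)]] by simp
  qed simp_all
qed

text \<open>
  A list \<open>[(e\<^sub>1, r\<^sub>1), (e\<^sub>2, r\<^sub>2), \<dots>]\<close> stands for the coset of \<open>a\<^bsup>r\<^sub>1\<^esup> t\<^bsup>e\<^sub>1\<^esup> a\<^bsup>r\<^sub>2\<^esup> t\<^bsup>e\<^sub>2\<^esup> \<dots>\<close>, with \<open>t\<close> for \<open>True\<close> and
  its inverse for \<open>False\<close>.  Since \<open>a\<^sup>n t = t a\<^sup>m\<close>, a digit in front of \<open>t\<close> matters modulo \<open>n\<close>, and one in
  front of the inverse of \<open>t\<close> modulo \<open>m\<close>.  Digits are residues in the sense of \<open>mod\<close>, hence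
  nonpositive if the modulus is negative.
\<close>

definition modulus :: "int \<Rightarrow> int \<Rightarrow> bool \<Rightarrow> int"
  where "modulus m n e = (if e then n else m)"

fun reduced :: "int \<Rightarrow> int \<Rightarrow> (bool \<times> int) list \<Rightarrow> bool" where
  "reduced m n [] \<longleftrightarrow> True"
| "reduced m n ((e, r) # x) \<longleftrightarrow>
     r mod modulus m n e = r \<and> reduced m n x \<and> (x = [] \<or> hd x \<noteq> (\<not> e, 0))"

definition vertices :: "int \<Rightarrow> int \<Rightarrow> (bool \<times> int) list set"
  where "vertices m n = Collect (reduced m n)"

text \<open>
  The action of \<open>a\<close> to the power \<open>j\<close>: the carry \<open>c\<close> out of the first digit passes the letter \<open>t\<^sup>e\<close> by
  \<open>a\<^sup>M\<^sup>c t\<^sup>e = t\<^sup>e a\<^bsup>M'c\<^esup>\<close>, where \<open>M\<close> and \<open>M'\<close> are the moduli of \<open>e\<close> and of its negation.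
\<close>

fun shift :: "int \<Rightarrow> int \<Rightarrow> int \<Rightarrow> (bool \<times> int) list \<Rightarrow> (bool \<times> int) list" where
  "shift m n j [] = []"
| "shift m n j ((e, r) # x) =
     (e, (j + r) mod modulus m n e) #
     shift m n (((j + r) div modulus m n e) * modulus m n (\<not> e)) x"

text \<open>
  The action of \<open>t\<close> or of its inverse, with free cancellation.
\<close>

definition push :: "bool \<Rightarrow> (bool \<times> int) list \<Rightarrow> (bool \<times> int) list"
  where "push b x = (if x \<noteq> [] \<and> hd x = (\<not> b, 0) then tl x else (b, 0) # x)"

fun height :: "(bool \<times> int) list \<Rightarrow> int" where
  "height [] = 0"
| "height ((e, r) # x) = (if e then 1 else - 1) + height x"

fun letter_act :: "int \<Rightarrow> int \<Rightarrow> BS_gen \<times> bool \<Rightarrow> (bool \<times> int) list \<Rightarrow> (bool \<times> int) list" where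
  "letter_act m n (GenA, b) x = shift m n (if b then 1 else - 1) x"
| "letter_act m n (GenT, b) x = push b x"

text \<open>
  The action on the real line by \<open>a x = x + 1\<close> and \<open>t x = (n / m) x\<close>.  Its linear part detects how
  conjugation rescales the exponents of powers of \<open>a\<close>.
\<close>

fun affine_act :: "int \<Rightarrow> int \<Rightarrow> BS_gen \<times> bool \<Rightarrow> real \<Rightarrow> real" where
  "affine_act m n (GenA, b) x = x + (if b then 1 else - 1)"
| "affine_act m n (GenT, b) x = (n / m) powi (if b then 1 else - 1) * x"

lemma Nil_in_vertices [simp]: "[] \<in> vertices m n"
  by (simp add: vertices_def)

lemma length_shift [simp]: "length (shift m n j x) = length x"
  by (induction m n j x rule: shift.induct) auto

lemma shift_eq_Nil_iff [simp]: "shift m n j x = [] \<longleftrightarrow> x = []"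
  by (cases x) auto

lemma height_shift [simp]: "height (shift m n j x) = height x"
  by (induction m n j x rule: shift.induct) auto

lemma butlast_shift: "butlast (shift m n j x) = shift m n j (butlast x)"
  by (induction m n j x rule: shift.induct) auto

lemma height_push: "height (push b x) = height x + (if b then 1 else - 1)"
  by (cases x) (auto simp: push_def)

locale bs_tree =
  fixes m n :: int
  assumes m_ge: "2 \<le> \<bar>m\<bar>" and m_le_n: "\<bar>m\<bar> \<le> n"
begin

abbreviation "M \<equiv> modulus m n"
abbreviation "V \<equiv> vertices m n"
abbreviation "sh \<equiv> shift m n"

lemma M_nonzero [simp]: "M e \<noteq> 0"
  using m_ge m_le_n by (auto simp: modulus_def)

lemma abs_M_ge: "\<bar>m\<bar> \<le> \<bar>M e\<bar>"
  using m_le_n by (auto simp: modulus_def)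

lemma abs_M_ge2: "2 \<le> \<bar>M e\<bar>"
  using abs_M_ge[of e] m_ge by linarith

text \<open>
  The first digit \<open>r\<close> of a reduced list satisfies \<open>r div M e = 0\<close>, so nothing is carried.  On other
  lists \<open>shift\<close> by zero normalises the digits.
\<close>

lemma shift_0: "x \<in> V \<Longrightarrow> sh 0 x = x"
proof (induction x)
  case (Cons p x)
  obtain e r where p: "p = (e, r)" by force
  have r: "r mod M e = r" and x: "x \<in> V" using Cons.prems by (auto simp: p vertices_def)
  have "r div M e = 0" using r M_nonzero by (metis mod_div_trivial)
  then show ?case using r Cons.IH[OF x] by (simp add: p)
qed simp

lemma shift_shift: "sh i (sh j x) = sh (i + j) x"
proof (induction x arbitrary: i j)
  case (Cons p x)
  obtain e r where p: "p = (e, r)" by force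
  have carry: "(i + (j + r) mod M e) div M e + (j + r) div M e = (i + j + r) div M e"
  proof -
    have "i + j + r = i + (j + r) mod M e + ((j + r) div M e) * M e"
      by simp
    then show ?thesis
      using div_mult_self1[OF M_nonzero, of "i + (j + r) mod M e" "(j + r) div M e" e]
      by (simp add: ac_simps)
  qed
  then show ?case
    by (simp add: p Cons.IH mod_add_right_eq add.assoc flip: distrib_right)
qed simp

lemma carry_mod: "r mod M e = r \<Longrightarrow> (c * M e + r) mod M e = r"
  by simp

lemma shift_in_vertices [intro]: "x \<in> V \<Longrightarrow> sh j x \<in> V"
proof (induction x arbitrary: j)
  case (Cons p x)
  obtain e r where p: "p = (e, r)" by force
  have r: "r mod M e = r" and x: "x \<in> V" and hd: "x = [] \<or> hd x \<noteq> (\<not> e, 0)"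
    using Cons.prems by (auto simp: p vertices_def)
  have "sh (c * M (\<not> e)) x = [] \<or> hd (sh (c * M (\<not> e)) x) \<noteq> (\<not> e, 0)" for c
  proof (cases x)
    case (Cons p' y)
    then obtain e' r' where x': "x = (e', r') # y" by (cases p') auto
    with x have "r' mod M e' = r'" by (auto simp: vertices_def)
    then show ?thesis using hd carry_mod[of r' "\<not> e" c] by (cases "e' = (\<not> e)") (auto simp: x')
  qed simp
  with Cons.IH[OF x] show ?case by (auto simp: p vertices_def)
qed simp

lemma push_in_vertices [intro]: "x \<in> V \<Longrightarrow> push b x \<in> V"
  by (cases x) (auto simp: push_def vertices_def neq_Nil_conv)

lemma push_push_inverse: "x \<in> V \<Longrightarrow> push b (push (\<not> b) x) = x"
  by (cases x) (auto simp: push_def vertices_def)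

text \<open>
  The defining relation of \<open>BS m n\<close>, in the form that treats \<open>t\<close> and its inverse alike.
\<close>

lemma push_shift:
  assumes "x \<in> V"
  shows "push e (sh (c * M (\<not> e)) x) = sh (c * M e) (push e x)"
proof (cases x)
  case (Cons p y)
  then obtain e' r' where x': "x = (e', r') # y" by (cases p) auto
  with assms have "r' mod M e' = r'" by (auto simp: vertices_def)
  then show ?thesis using carry_mod[of r' "\<not> e" c] by (cases "e' = (\<not> e)") (auto simp: x' push_def)
qed (simp add: push_def)

lemma letter_act_in_vertices: "x \<in> V \<Longrightarrow> letter_act m n l x \<in> V"
  by (cases l; cases "fst l") auto

abbreviation "word_act \<equiv> foldr (letter_act m n)"

lemma word_act_in_vertices: "x \<in> V \<Longrightarrow> word_act w x \<in> V"
  by (induction w) (auto intro: letter_act_in_vertices)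

lemma word_act_letter_power:
  assumes "x \<in> V"
  shows "word_act (letter_power GenA j) x = sh j x"
proof -
  have "foldr (letter_act m n) (replicate k (GenA, b)) x = sh (if b then int k else - int k) x" for k b
    using assms
    by (induction k) (auto simp: shift_0 shift_shift)
  then show ?thesis by (auto simp: letter_power_def)
qed

lemma word_act_cong:
  assumes "(u, v) \<in> pres_rel (BS_relations m n)" and "x \<in> V"
  shows "word_act u x = word_act v x"
proof (rule foldr_pres_rel[OF assms])
  show "letter_act m n (g, b) (letter_act m n (g, \<not> b) x) = x" if "x \<in> V" for g b x
    using that push_push_inverse[of x b] by (cases g) (auto simp: shift_shift shift_0)
next
  fix r s x assume rs: "(r, s) \<in> BS_relations m n" and x: "x \<in> V"
  have "push True (sh m (push False x)) = sh n x"
    using push_shift[OF push_in_vertices[OF x, of False], of True 1] push_push_inverse[OF x, of True]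
    by (simp add: modulus_def)
  moreover have "letter_power GenT 1 = [(GenT, True)]" "letter_power GenT (- 1) = [(GenT, False)]"
    by (simp_all add: letter_power_def)
  ultimately show "word_act r x = word_act s x"
    using rs x by (auto simp: BS_relations_def word_act_letter_power push_in_vertices)
qed (rule letter_act_in_vertices)

lemma n_pos: "n > 0" using m_ge m_le_n by linarith

lemma m_nonzero: "m \<noteq> 0" using m_ge by auto

lemma affine_letter_power: "foldr (affine_act m n) (letter_power GenA j) x = x + j"
proof -
  have "foldr (affine_act m n) (replicate k (GenA, b)) x = x + (if b then int k else - int k)" for k b
    by (induction k) auto
  then show ?thesis by (auto simp: letter_power_def)
qed

lemma affine_cong:
  assumes "(u, v) \<in> pres_rel (BS_relations m n)"
  shows "foldr (affine_act m n) u x = foldr (affine_act m n) v x"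
proof (rule foldr_pres_rel[OF assms, of x UNIV])
  show "affine_act m n (g, b) (affine_act m n (g, \<not> b) x) = x" for g b x
    using n_pos m_nonzero by (cases g; cases b) (auto simp: field_simps)
next
  have t: "letter_power GenT 1 = [(GenT, True)]" "letter_power GenT (- 1) = [(GenT, False)]"
    by (simp_all add: letter_power_def)
  fix r s x assume "(r, s) \<in> BS_relations m n"
  then show "foldr (affine_act m n) r x = foldr (affine_act m n) s x"
    using n_pos m_nonzero by (auto simp: BS_relations_def affine_letter_power t field_simps)
qed auto

lemma height_letter_act:
  assumes "x \<in> V"
  shows "height (letter_act m n l x) = height x +
    (case l of (GenA, b) \<Rightarrow> 0 | (GenT, b) \<Rightarrow> if b then 1 else - 1)"
  by (cases l; cases "fst l") (auto simp: height_push)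

text \<open>
  Heights make the tree an oriented one.  Since the orientation is preserved, edges are never inverted.
\<close>

lemma height_word_act:
  assumes "x \<in> V" "y \<in> V"
  shows "height (word_act w x) - height x = height (word_act w y) - height y"
  using assms
  by (induction w) (auto simp: height_letter_act word_act_in_vertices)

lemma affine_word:
  "\<exists>\<beta>. \<forall>x. foldr (affine_act m n) w x = (n / m) powi height (word_act w []) * x + \<beta>"
proof (induction w)
  case (Cons l w)
  then obtain \<beta> where \<beta>: "\<And>x. foldr (affine_act m n) w x = (n / m) powi height (word_act w []) * x + \<beta>"
    by blast
  have h: "height (word_act (l # w) []) = height (word_act w []) +
    (case l of (GenA, b) \<Rightarrow> 0 | (GenT, b) \<Rightarrow> if b then 1 else - 1)"
    by (simp add: height_letter_act word_act_in_vertices)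
  have nz: "real_of_int n / real_of_int m \<noteq> 0" using n_pos m_nonzero by simp
  obtain g b where l: "l = (g, b)" by (cases l)
  show ?case
  proof (cases g)
    case GenA
    then show ?thesis using h by (auto simp: \<beta> l algebra_simps)
  next
    case GenT
    let ?k = "if b then 1 else - 1 :: int"
    have "foldr (affine_act m n) (l # w) x = (n / m) powi height (word_act (l # w) []) * x + (n / m) powi ?k * \<beta>" for x
      using GenT h power_int_add[of "real_of_int n / real_of_int m" "height (word_act w [])" ?k] nz
      by (simp add: \<beta> l algebra_simps)
    then show ?thesis by blast
  qed
qed auto

end

section \<open>Action, stabilisers and periods of the Baumslag-Solitar group\<close>

lemma (in group) int_pow_conj:
  assumes "x \<in> carrier G" "y \<in> carrier G"
  shows "(x \<otimes> y \<otimes> inv x) [^] (k::int) = x \<otimes> y [^] k \<otimes> inv x"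
proof -
  have "(\<lambda>z. x \<otimes> z \<otimes> inv x) \<in> hom G G"
    using assms(1) by (auto simp: hom_def m_assoc) (simp add: m_assoc[symmetric])
  then interpret group_hom G G "\<lambda>z. x \<otimes> z \<otimes> inv x"
    by unfold_locales
  show ?thesis using hom_int_pow[of y k] assms by simp
qed

lemma int_subgroup_generator:
  fixes S :: "int set"
  assumes zero: "0 \<in> S" and diff: "\<And>i j. i \<in> S \<Longrightarrow> j \<in> S \<Longrightarrow> i - j \<in> S"
    and nonzero: "N \<in> S" "N \<noteq> 0"
  obtains s where "s > 0" and "\<And>j. j \<in> S \<longleftrightarrow> s dvd j"
proof -
  have neg: "- i \<in> S" if "i \<in> S" for i using diff[OF zero that] by simp
  have add: "i + j \<in> S" if "i \<in> S" "j \<in> S" for i j using diff[OF that(1) neg[OF that(2)]] by simp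
  have mult: "k * i \<in> S" if "i \<in> S" for k i
  proof (induction k rule: int_induct[of _ 0])
    case (step1 k) then show ?case using add[OF that, of "k * i"] by (simp add: algebra_simps)
  next
    case (step2 k) then show ?case using diff[OF _ that] by (simp add: algebra_simps)
  qed (use zero in simp)
  define s where "s = int (LEAST k. k > 0 \<and> int k \<in> S)"
  have "nat \<bar>N\<bar> > 0 \<and> int (nat \<bar>N\<bar>) \<in> S" using nonzero neg by (auto simp: abs_if)
  then have s: "s > 0" "s \<in> S"
    using LeastI[of "\<lambda>k. k > 0 \<and> int k \<in> S" "nat \<bar>N\<bar>"] unfolding s_def by auto
  have "s dvd j" if "j \<in> S" for j
  proof (rule ccontr)
    assume nd: "\<not> s dvd j"
    have "j - (j div s) * s \<in> S" by (rule diff[OF that mult[OF s(2)]])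
    then have "j mod s \<in> S" by (simp add: minus_div_mult_eq_mod)
    moreover have "j mod s > 0" "j mod s < s"
      using nd s(1) pos_mod_bound[of s j] pos_mod_sign[of s j] by (auto simp: dvd_eq_mod_eq_0 less_le)
    ultimately have "nat (j mod s) > 0 \<and> int (nat (j mod s)) \<in> S" by simp
    then have "(LEAST k. k > 0 \<and> int k \<in> S) \<le> nat (j mod s)" by (rule Least_le)
    then show False using \<open>j mod s < s\<close> \<open>j mod s > 0\<close> unfolding s_def by linarith
  qed
  then show ?thesis using that[of s] s mult by (metis dvd_def mult.commute)
qed

lemma card_range_periodic:
  fixes f :: "int \<Rightarrow> 'a"
  assumes "s > 0" and per: "\<And>i j. f i = f j \<longleftrightarrow> s dvd (i - j)"
  shows "finite (range f)" and "card (range f) = nat s"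
proof -
  have "f i = f (i mod s)" for i
    using per[of i "i mod s"] by (simp add: minus_mod_eq_div_mult)
  moreover have "i mod s \<in> {0..<s}" for i using assms(1) by simp
  ultimately have eq: "range f = f ` {0..<s}" by blast
  have "inj_on f {0..<s}"
  proof (rule inj_onI)
    fix i j assume "i \<in> {0..<s}" "j \<in> {0..<s}" "f i = f j"
    then have "s dvd (i - j)" "\<bar>i - j\<bar> < s" using per by auto
    then show "i = j" using zdvd_imp_le[of s "\<bar>i - j\<bar>"] by force
  qed
  then show "finite (range f)" "card (range f) = nat s"
    by (simp_all add: eq card_image)
qed

text \<open>
  By the orbit formula this is the index of the stabiliser of \<open>x\<close> in the group generated by \<open>a\<close>.
\<close>

definition period :: "int \<Rightarrow> int \<Rightarrow> (bool \<times> int) list \<Rightarrow> nat"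
  where "period m n x = card (range (\<lambda>j. shift m n j x))"

context bs_tree
begin

abbreviation "cls \<equiv> pres_class (BS_relations m n)"
abbreviation "B \<equiv> BS m n"
abbreviation "a \<equiv> BS_a m n"

definition t where "t = cls (letter_power GenT 1)"

sublocale BS: group B
  unfolding BS_def by (rule group_presented_group)

lemma carrier_B: "carrier B = range cls"
  by (simp add: BS_def carrier_presented_group)

lemma cls_in_B [simp]: "cls w \<in> carrier B"
  by (simp add: carrier_B)

lemma a_in_B [simp]: "a \<in> carrier B"
  by (simp add: BS_a_def)

lemma t_in_B [simp]: "t \<in> carrier B"
  by (simp add: t_def)

lemma cls_append: "cls (u @ v) = cls u \<otimes>\<^bsub>B\<^esub> cls v"
  by (simp add: BS_def mult_presented_group)

lemma cls_Nil: "cls [] = \<one>\<^bsub>B\<^esub>"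
  by (simp add: BS_def one_presented_group)

lemma cls_letter_power_a: "cls (letter_power GenA j) = a [^]\<^bsub>B\<^esub> j"
  unfolding BS_def BS_a_def
  by (subst (1 2) pres_class_letter_power) (simp add: group.int_pow_1[OF group_presented_group] carrier_presented_group)

lemma cls_letter_power_t: "cls (letter_power GenT j) = t [^]\<^bsub>B\<^esub> j"
  unfolding BS_def t_def
  by (subst (1 2) pres_class_letter_power) (simp add: group.int_pow_1[OF group_presented_group] carrier_presented_group)

text \<open>
  The choice of a representing word is harmless by \<open>word_act_cong\<close>.
\<close>

definition bs_act :: "BS_gen word set \<Rightarrow> (bool \<times> int) list \<Rightarrow> (bool \<times> int) list"
  where "bs_act g = word_act (SOME w. g = cls w)"

lemma bs_act_cls: "x \<in> V \<Longrightarrow> bs_act (cls w) x = word_act w x"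
  using someI[of "\<lambda>u. cls w = cls u" w] unfolding bs_act_def
  by (metis (mono_tags, lifting) pres_class_eq_iff word_act_cong)

lemma bs_act_in_vertices [intro]: "x \<in> V \<Longrightarrow> bs_act g x \<in> V"
  by (simp add: bs_act_def word_act_in_vertices)

lemma bs_act_mult:
  assumes "g \<in> carrier B" "h \<in> carrier B" "x \<in> V"
  shows "bs_act (g \<otimes>\<^bsub>B\<^esub> h) x = bs_act g (bs_act h x)"
proof -
  obtain u v where "g = cls u" "h = cls v" using assms carrier_B by auto
  then show ?thesis using assms(3)
    by (simp add: cls_append[symmetric] bs_act_cls word_act_in_vertices)
qed

lemma bs_act_one: "x \<in> V \<Longrightarrow> bs_act \<one>\<^bsub>B\<^esub> x = x"
  by (simp add: cls_Nil[symmetric] bs_act_cls)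

lemma bs_act_a_power: "x \<in> V \<Longrightarrow> bs_act (a [^]\<^bsub>B\<^esub> (j::int)) x = sh j x"
  by (simp add: cls_letter_power_a[symmetric] bs_act_cls word_act_letter_power)

definition stable where "stable e = t [^]\<^bsub>B\<^esub> (if e then 1 else - 1 :: int)"

lemma stable_in_B [simp]: "stable e \<in> carrier B"
  by (simp add: stable_def)

lemma stable_cls: "stable e = cls [(GenT, e)]"
  by (simp add: stable_def cls_letter_power_t[symmetric]) (simp add: letter_power_def)

lemma bs_act_stable: "x \<in> V \<Longrightarrow> bs_act (stable e) x = push e x"
  by (simp add: stable_cls bs_act_cls)

lemma stable_cancel: "stable (\<not> e) \<otimes>\<^bsub>B\<^esub> stable e = \<one>\<^bsub>B\<^esub>"
  by (cases e) (auto simp: stable_def BS.int_pow_neg BS.int_pow_1)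

lemma stable_carry:
  "a [^]\<^bsub>B\<^esub> (c * M e) \<otimes>\<^bsub>B\<^esub> stable e = stable e \<otimes>\<^bsub>B\<^esub> a [^]\<^bsub>B\<^esub> (c * M (\<not> e))"
proof -
  have "t \<otimes>\<^bsub>B\<^esub> a [^]\<^bsub>B\<^esub> m \<otimes>\<^bsub>B\<^esub> inv\<^bsub>B\<^esub> t = a [^]\<^bsub>B\<^esub> n"
    using BS_relation[of m n] by (simp add: t_def)
  then have "(t \<otimes>\<^bsub>B\<^esub> a [^]\<^bsub>B\<^esub> m \<otimes>\<^bsub>B\<^esub> inv\<^bsub>B\<^esub> t) [^]\<^bsub>B\<^esub> c = a [^]\<^bsub>B\<^esub> (n * c)"
    by (simp add: BS.int_pow_pow)
  then have conj: "t \<otimes>\<^bsub>B\<^esub> a [^]\<^bsub>B\<^esub> (m * c) \<otimes>\<^bsub>B\<^esub> inv\<^bsub>B\<^esub> t = a [^]\<^bsub>B\<^esub> (n * c)"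
    by (simp add: BS.int_pow_conj BS.int_pow_pow)
  then have 1: "t \<otimes>\<^bsub>B\<^esub> a [^]\<^bsub>B\<^esub> (m * c) = a [^]\<^bsub>B\<^esub> (n * c) \<otimes>\<^bsub>B\<^esub> t"
    using BS.inv_solve_right'[of "a [^]\<^bsub>B\<^esub> (n * c)" "t \<otimes>\<^bsub>B\<^esub> a [^]\<^bsub>B\<^esub> (m * c)" t] by simp
  have 2: "a [^]\<^bsub>B\<^esub> (m * c) \<otimes>\<^bsub>B\<^esub> inv\<^bsub>B\<^esub> t = inv\<^bsub>B\<^esub> t \<otimes>\<^bsub>B\<^esub> a [^]\<^bsub>B\<^esub> (n * c)"
    using conj BS.inv_solve_left[of "a [^]\<^bsub>B\<^esub> (m * c) \<otimes>\<^bsub>B\<^esub> inv\<^bsub>B\<^esub> t" t "a [^]\<^bsub>B\<^esub> (n * c)"]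
    by (simp add: BS.m_assoc)
  show ?thesis
    using 1 2 by (cases e) (auto simp: stable_def modulus_def BS.int_pow_neg BS.int_pow_1 mult.commute)
qed

text \<open>
  Reading a digit list as a product in \<open>BS m n\<close>.  The next lemmas show that \<open>rep\<close> turns the action on
  lists into left multiplication up to powers of \<open>a\<close> on the right.  This is the normal form theorem in
  the strength needed to identify the stabiliser of the empty list.
\<close>

fun rep :: "(bool \<times> int) list \<Rightarrow> BS_gen word set" where
  "rep [] = \<one>\<^bsub>B\<^esub>"
| "rep ((e, r) # x) = a [^]\<^bsub>B\<^esub> r \<otimes>\<^bsub>B\<^esub> (stable e \<otimes>\<^bsub>B\<^esub> rep x)"

lemma rep_in_B [simp]: "rep x \<in> carrier B"
  by (induction x rule: rep.induct) auto

lemma rep_shift: "\<exists>k::int. a [^]\<^bsub>B\<^esub> (j::int) \<otimes>\<^bsub>B\<^esub> rep x = rep (sh j x) \<otimes>\<^bsub>B\<^esub> a [^]\<^bsub>B\<^esub> k"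
proof (induction x arbitrary: j)
  case Nil
  show ?case by (rule exI[of _ j]) simp
next
  case (Cons p x)
  obtain e r where p: "p = (e, r)" by force
  define c where "c = (j + r) div M e"
  obtain k :: int where k: "a [^]\<^bsub>B\<^esub> (c * M (\<not> e)) \<otimes>\<^bsub>B\<^esub> rep x = rep (sh (c * M (\<not> e)) x) \<otimes>\<^bsub>B\<^esub> a [^]\<^bsub>B\<^esub> k"
    using Cons.IH by blast
  have "a [^]\<^bsub>B\<^esub> j \<otimes>\<^bsub>B\<^esub> rep (p # x) = a [^]\<^bsub>B\<^esub> ((j + r) mod M e + c * M e) \<otimes>\<^bsub>B\<^esub> (stable e \<otimes>\<^bsub>B\<^esub> rep x)"
    by (simp add: p c_def BS.int_pow_mult[symmetric] BS.m_assoc[symmetric])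
  also have "\<dots> = a [^]\<^bsub>B\<^esub> ((j + r) mod M e) \<otimes>\<^bsub>B\<^esub> ((a [^]\<^bsub>B\<^esub> (c * M e) \<otimes>\<^bsub>B\<^esub> stable e) \<otimes>\<^bsub>B\<^esub> rep x)"
    by (simp add: BS.int_pow_mult BS.m_assoc)
  also have "\<dots> = a [^]\<^bsub>B\<^esub> ((j + r) mod M e) \<otimes>\<^bsub>B\<^esub> (stable e \<otimes>\<^bsub>B\<^esub> (a [^]\<^bsub>B\<^esub> (c * M (\<not> e)) \<otimes>\<^bsub>B\<^esub> rep x))"
    unfolding stable_carry by (simp add: BS.m_assoc)
  also have "\<dots> = rep (sh j (p # x)) \<otimes>\<^bsub>B\<^esub> a [^]\<^bsub>B\<^esub> k"
    unfolding k by (simp add: p c_def BS.m_assoc)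
  finally show ?case by blast
qed

lemma rep_push: "stable e \<otimes>\<^bsub>B\<^esub> rep x = rep (push e x)"
proof (cases "x \<noteq> [] \<and> hd x = (\<not> e, 0)")
  case True
  then obtain y where "x = (\<not> e, 0) # y" by (cases x) auto
  then show ?thesis
    using stable_cancel[of "\<not> e"] by (simp add: push_def BS.m_assoc[symmetric])
next
  case False
  then have "push e x = (e, 0) # x" unfolding push_def by (rule if_not_P)
  then show ?thesis by simp
qed

lemma shift_push_Cons:
  assumes "(e, r) # x \<in> V"
  shows "sh r (push e x) = (e, r) # x"
proof -
  have x: "x \<in> V" and r: "r mod M e = r" and hd: "x = [] \<or> hd x \<noteq> (\<not> e, 0)"
    using assms by (auto simp: vertices_def)
  have "r div M e = 0" using r M_nonzero by (metis mod_div_trivial)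
  moreover have "push e x = (e, 0) # x" using hd by (auto simp: push_def)
  ultimately show ?thesis using r x by (simp add: shift_0)
qed

lemma vertices_ConsD: "p # x \<in> V \<Longrightarrow> x \<in> V"
  by (cases p) (auto simp: vertices_def)

lemma bs_act_rep: "x \<in> V \<Longrightarrow> bs_act (rep x) [] = x"
proof (induction x)
  case (Cons p x)
  obtain e r where p: "p = (e, r)" by force
  have x: "x \<in> V" using Cons.prems by (rule vertices_ConsD)
  then show ?case
    using Cons.IH shift_push_Cons[OF Cons.prems[unfolded p]] push_in_vertices[OF x, of e]
    by (simp add: p bs_act_mult bs_act_in_vertices bs_act_a_power bs_act_stable)
qed (simp add: bs_act_one)

lemma cls_normal_form: "\<exists>k::int. cls w = rep (word_act w []) \<otimes>\<^bsub>B\<^esub> a [^]\<^bsub>B\<^esub> k"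
proof (induction w)
  case Nil
  show ?case by (rule exI[of _ 0]) (simp add: cls_Nil)
next
  case (Cons l w)
  then obtain k :: int where k: "cls w = rep (word_act w []) \<otimes>\<^bsub>B\<^esub> a [^]\<^bsub>B\<^esub> k" by blast
  obtain g b where l: "l = (g, b)" by force
  have lw: "cls (l # w) = cls [l] \<otimes>\<^bsub>B\<^esub> rep (word_act w []) \<otimes>\<^bsub>B\<^esub> a [^]\<^bsub>B\<^esub> k"
    using cls_append[of "[l]" w] by (simp add: k BS.m_assoc)
  show ?case
  proof (cases g)
    case GenA
    let ?j = "if b then 1 else - 1 :: int"
    have "cls [l] = a [^]\<^bsub>B\<^esub> ?j"
      using cls_letter_power_a[of ?j] by (simp add: l GenA letter_power_def split: if_splits)
    moreover obtain k' :: int where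
      "a [^]\<^bsub>B\<^esub> ?j \<otimes>\<^bsub>B\<^esub> rep (word_act w []) = rep (sh ?j (word_act w [])) \<otimes>\<^bsub>B\<^esub> a [^]\<^bsub>B\<^esub> k'"
      using rep_shift by blast
    ultimately have "cls (l # w) = rep (word_act (l # w) []) \<otimes>\<^bsub>B\<^esub> a [^]\<^bsub>B\<^esub> (k' + k)"
      by (simp add: lw BS.m_assoc BS.int_pow_mult) (simp add: l GenA)
    then show ?thesis by blast
  next
    case GenT
    then have "cls (l # w) = rep (word_act (l # w) []) \<otimes>\<^bsub>B\<^esub> a [^]\<^bsub>B\<^esub> k"
      unfolding lw by (simp add: l stable_cls[symmetric] rep_push)
    then show ?thesis by blast
  qed
qed

lemma stabilizer_root:
  assumes "g \<in> carrier B" "bs_act g [] = []"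
  obtains k :: int where "g = a [^]\<^bsub>B\<^esub> k"
proof -
  obtain w where w: "g = cls w" using assms carrier_B by auto
  then obtain k :: int where "cls w = rep (word_act w []) \<otimes>\<^bsub>B\<^esub> a [^]\<^bsub>B\<^esub> k"
    using cls_normal_form by blast
  moreover have "word_act w [] = []" using assms(2) by (simp add: w bs_act_cls)
  ultimately show ?thesis using that[of k] w by simp
qed

lemma bs_act_inv:
  assumes "g \<in> carrier B" "x \<in> V"
  shows "bs_act (inv\<^bsub>B\<^esub> g) (bs_act g x) = x" "bs_act g (bs_act (inv\<^bsub>B\<^esub> g) x) = x"
  using assms by (simp_all add: bs_act_mult[symmetric] bs_act_one)

lemma height_bs_act:
  assumes "g \<in> carrier B" "x \<in> V" "y \<in> V"
  shows "height (bs_act g x) - height x = height (bs_act g y) - height y"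
proof -
  obtain w where "g = cls w" using assms carrier_B by auto
  then show ?thesis using height_word_act[OF assms(2,3)] assms by (simp add: bs_act_cls)
qed

text \<open>
  Compare the constant terms of the two sides in the affine action.  The argument takes place in the
  group \<open>BS m n\<close>; in the action on vertices the exponents are not determined when \<open>\<bar>m\<bar> = n\<close>, because
  then some power of \<open>a\<close> fixes all vertices.
\<close>

lemma conjugation_multiplier:
  assumes g: "g \<in> carrier B" and eq: "a [^]\<^bsub>B\<^esub> (j::int) \<otimes>\<^bsub>B\<^esub> g = g \<otimes>\<^bsub>B\<^esub> a [^]\<^bsub>B\<^esub> (i::int)"
  shows "real_of_int j = (n / m) powi height (bs_act g []) * real_of_int i"
proof -
  obtain w where w: "g = cls w" using g carrier_B by auto
  obtain \<beta> where \<beta>: "\<And>x. foldr (affine_act m n) w x = (n / m) powi height (word_act w []) * x + \<beta>"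
    using affine_word by blast
  have power: "foldr (affine_act m n) (letter_power GenA j) x = x + j" for j :: int and x
    by (rule affine_letter_power)
  have "cls (letter_power GenA j @ w) = cls (w @ letter_power GenA i)"
    using eq by (simp add: cls_append cls_letter_power_a w)
  then have "foldr (affine_act m n) (letter_power GenA j @ w) 0 = foldr (affine_act m n) (w @ letter_power GenA i) 0"
    by (intro affine_cong) (simp add: pres_class_eq_iff)
  then show ?thesis by (simp add: power \<beta> w bs_act_cls)
qed

text \<open>
  By induction from the tail: if \<open>N\<close> works for the tail, then \<open>N * M e\<close> produces no change in the first
  digit and the carry \<open>N * M (\<not> e)\<close>.
\<close>

lemma ex_shift_fixes: "x \<in> V \<Longrightarrow> \<exists>N. N \<noteq> 0 \<and> sh N x = x"
proof (induction x)
  case (Cons p x)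
  obtain e r where p: "p = (e, r)" by force
  have x: "x \<in> V" and r: "r mod M e = r" using Cons.prems by (auto simp: p vertices_def)
  have "r div M e = 0" using r M_nonzero by (metis mod_div_trivial)
  then have dv: "(c * M e + r) div M e = c" for c
    by (metis M_nonzero add.commute add.right_neutral div_mult_self3 mult.commute)
  obtain N where N: "N \<noteq> 0" "sh N x = x" using Cons.IH[OF x] by blast
  have mult: "sh (k * N) x = x" for k
  proof (induction k rule: int_induct[of _ 0])
    case (step1 k)
    then show ?case using shift_shift[of N "k * N" x] N by (simp add: algebra_simps)
  next
    case (step2 k)
    have "sh (- N) x = x" using shift_shift[of "- N" N x] N x by (simp add: shift_0)
    then show ?case using shift_shift[of "- N" "k * N" x] step2 by (simp add: algebra_simps)
  qed (use x in \<open>simp add: shift_0\<close>)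
  have "sh (N * M e) (p # x) = p # x"
    using r dv[of N] mult[of "M (\<not> e)"] by (simp add: p mult.commute)
  then show ?case using N M_nonzero by (metis mult_eq_0_iff)
qed (rule exI[of _ 1], simp)

lemma period_pos_and_iff:
  assumes "x \<in> V"
  shows "period m n x > 0" and "sh j x = x \<longleftrightarrow> int (period m n x) dvd j"
proof -
  have diff: "sh (i - j) x = x \<longleftrightarrow> sh i x = sh j x" for i j
    using shift_shift[of "- j" i x] shift_shift[of "- j" j x] shift_shift[of j "i - j" x] shift_0[OF assms]
    by (metis add.commute diff_add_cancel left_minus uminus_add_conv_diff)
  obtain N where N: "N \<noteq> 0" "sh N x = x" using ex_shift_fixes[OF assms] by blast
  obtain s where s: "s > 0" "\<And>j. j \<in> {j. sh j x = x} \<longleftrightarrow> s dvd j"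
    by (rule int_subgroup_generator[of "{j. sh j x = x}" N])
      (use N diff in \<open>auto simp: shift_0[OF assms]\<close>)
  then have "period m n x = nat s"
    unfolding period_def by (intro card_range_periodic) (auto simp: diff[symmetric])
  then show "period m n x > 0" and "sh j x = x \<longleftrightarrow> int (period m n x) dvd j"
    using s by auto
qed

text \<open>
  The first digit runs through all residues modulo its modulus, which bounds every period other than that
  of the base vertex from below by \<open>\<bar>m\<bar>\<close>.
\<close>

lemma shift_fixes_head:
  assumes "x \<in> V" "x \<noteq> []" "sh j x = x"
  shows "M (fst (hd x)) dvd j"
proof -
  obtain e r y where x: "x = (e, r) # y" using assms(2) by (cases x) auto
  then have "(j + r) mod M e = r mod M e" using assms by (auto simp: vertices_def)
  then show ?thesis by (simp add: x mod_eq_dvd_iff)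
qed

lemma shift_1_fixes_only_root: "x \<in> V \<Longrightarrow> sh 1 x = x \<Longrightarrow> x = []"
  using shift_fixes_head[of x 1] abs_M_ge2[of "fst (hd x)"] by (auto simp: zdvd1_eq)

lemma period_ge: "x \<in> V \<Longrightarrow> x \<noteq> [] \<Longrightarrow> nat \<bar>m\<bar> \<le> period m n x"
  using shift_fixes_head[of x "int (period m n x)"] period_pos_and_iff[of x] abs_M_ge[of "fst (hd x)"]
    dvd_imp_le_int[of "int (period m n x)" "M (fst (hd x))"]
  by (smt (verit) dvd_refl nat_le_iff of_nat_0_less_iff)

lemma down_in_vertices [simp]: "[(b, 0)] \<in> V"
  by (simp add: vertices_def)

lemma period_down: "period m n [(False, 0)] = nat \<bar>m\<bar>"
proof -
  have "sh j [(False, 0)] = [(False, 0)] \<longleftrightarrow> m dvd j" for j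
    by (auto simp: modulus_def)
  then have "int (period m n [(False, 0)]) dvd j \<longleftrightarrow> m dvd j" for j
    using period_pos_and_iff(2)[of "[(False, 0)]" j] by simp
  then have "\<bar>int (period m n [(False, 0)])\<bar> = \<bar>m\<bar>"
    by (meson dvd_refl zdvd_antisym_abs)
  then show ?thesis by linarith
qed

lemma shift_fixes_iff_conj:
  assumes "g \<in> carrier B"
  shows "sh j (bs_act g []) = bs_act g [] \<longleftrightarrow>
    (\<exists>i::int. a [^]\<^bsub>B\<^esub> (j::int) \<otimes>\<^bsub>B\<^esub> g = g \<otimes>\<^bsub>B\<^esub> a [^]\<^bsub>B\<^esub> i)"
proof
  assume L: "sh j (bs_act g []) = bs_act g []"
  let ?h = "inv\<^bsub>B\<^esub> g \<otimes>\<^bsub>B\<^esub> (a [^]\<^bsub>B\<^esub> j \<otimes>\<^bsub>B\<^esub> g)"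
  have "bs_act ?h [] = []"
    using L assms by (simp add: bs_act_mult bs_act_a_power bs_act_in_vertices bs_act_inv)
  then obtain i :: int where "?h = a [^]\<^bsub>B\<^esub> i"
    using stabilizer_root[of ?h] assms by auto
  then have "a [^]\<^bsub>B\<^esub> j \<otimes>\<^bsub>B\<^esub> g = g \<otimes>\<^bsub>B\<^esub> a [^]\<^bsub>B\<^esub> i"
    using assms BS.inv_solve_left'[of "a [^]\<^bsub>B\<^esub> i" g "a [^]\<^bsub>B\<^esub> j \<otimes>\<^bsub>B\<^esub> g"] by simp
  then show "\<exists>i::int. a [^]\<^bsub>B\<^esub> j \<otimes>\<^bsub>B\<^esub> g = g \<otimes>\<^bsub>B\<^esub> a [^]\<^bsub>B\<^esub> i" by blast
next
  assume "\<exists>i::int. a [^]\<^bsub>B\<^esub> j \<otimes>\<^bsub>B\<^esub> g = g \<otimes>\<^bsub>B\<^esub> a [^]\<^bsub>B\<^esub> i"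
  then obtain i :: int where "a [^]\<^bsub>B\<^esub> j \<otimes>\<^bsub>B\<^esub> g = g \<otimes>\<^bsub>B\<^esub> a [^]\<^bsub>B\<^esub> i" by blast
  then have "bs_act (a [^]\<^bsub>B\<^esub> j \<otimes>\<^bsub>B\<^esub> g) [] = bs_act (g \<otimes>\<^bsub>B\<^esub> a [^]\<^bsub>B\<^esub> i) []" by simp
  then show "sh j (bs_act g []) = bs_act g []"
    using assms by (simp add: bs_act_mult bs_act_a_power bs_act_in_vertices)
qed

lemma abs_n_over_m: "\<bar>real_of_int n / real_of_int m\<bar> = n / \<bar>m\<bar>"
  using n_pos by simp

text \<open>
  The relation \<open>P j i\<close> in the proof pairs the exponents \<open>j\<close> that stabilise \<open>g\<close> applied to the base vertex
  with the exponents \<open>i\<close> that stabilise the inverse of \<open>g\<close> applied to it.  These exponents are the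
  multiples of the two periods, and the pairing is multiplication by \<open>(n / m)\<close> to the height.
\<close>

lemma period_ratio:
  assumes g: "g \<in> carrier B"
  shows "real (period m n (bs_act g [])) =
    (n / \<bar>m\<bar>) powi height (bs_act g []) * real (period m n (bs_act (inv\<^bsub>B\<^esub> g) []))"
proof -
  let ?x = "bs_act g []" and ?y = "bs_act (inv\<^bsub>B\<^esub> g) []"
  define \<rho> where "\<rho> = (real_of_int n / real_of_int m) powi height ?x"
  have rho: "\<rho> \<noteq> 0" using n_pos m_nonzero by (simp add: \<rho>_def)
  have V: "?x \<in> V" "?y \<in> V" by auto
  define P where "P j i \<longleftrightarrow> a [^]\<^bsub>B\<^esub> (j::int) \<otimes>\<^bsub>B\<^esub> g = g \<otimes>\<^bsub>B\<^esub> a [^]\<^bsub>B\<^esub> (i::int)" for j i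
  have mult: "\<bar>real_of_int j\<bar> = \<bar>\<rho>\<bar> * \<bar>real_of_int i\<bar>" if "P j i" for j i
    using conjugation_multiplier[OF g, of j i] that by (simp add: P_def \<rho>_def abs_mult)
  have dom: "int (period m n ?x) dvd j \<longleftrightarrow> (\<exists>i. P j i)" for j
    using period_pos_and_iff(2)[OF V(1)] shift_fixes_iff_conj[OF g] by (simp add: P_def)
  have conv: "a [^]\<^bsub>B\<^esub> i \<otimes>\<^bsub>B\<^esub> inv\<^bsub>B\<^esub> g = inv\<^bsub>B\<^esub> g \<otimes>\<^bsub>B\<^esub> a [^]\<^bsub>B\<^esub> j \<longleftrightarrow> P j i"
    for i j :: int
  proof -
    have "(a [^]\<^bsub>B\<^esub> i \<otimes>\<^bsub>B\<^esub> inv\<^bsub>B\<^esub> g = inv\<^bsub>B\<^esub> g \<otimes>\<^bsub>B\<^esub> a [^]\<^bsub>B\<^esub> j) \<longleftrightarrow>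
        a [^]\<^bsub>B\<^esub> j = g \<otimes>\<^bsub>B\<^esub> (a [^]\<^bsub>B\<^esub> i \<otimes>\<^bsub>B\<^esub> inv\<^bsub>B\<^esub> g)"
      using g by (intro BS.inv_solve_left) auto
    also have "g \<otimes>\<^bsub>B\<^esub> (a [^]\<^bsub>B\<^esub> i \<otimes>\<^bsub>B\<^esub> inv\<^bsub>B\<^esub> g) = g \<otimes>\<^bsub>B\<^esub> a [^]\<^bsub>B\<^esub> i \<otimes>\<^bsub>B\<^esub> inv\<^bsub>B\<^esub> g"
      using g by (simp add: BS.m_assoc)
    also have "a [^]\<^bsub>B\<^esub> j = g \<otimes>\<^bsub>B\<^esub> a [^]\<^bsub>B\<^esub> i \<otimes>\<^bsub>B\<^esub> inv\<^bsub>B\<^esub> g \<longleftrightarrow> g \<otimes>\<^bsub>B\<^esub> a [^]\<^bsub>B\<^esub> i = a [^]\<^bsub>B\<^esub> j \<otimes>\<^bsub>B\<^esub> g"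
      using g by (intro BS.inv_solve_right) auto
    finally show ?thesis unfolding P_def by auto
  qed
  have ran: "int (period m n ?y) dvd i \<longleftrightarrow> (\<exists>j. P j i)" for i
    unfolding period_pos_and_iff(2)[OF V(2), symmetric] shift_fixes_iff_conj[OF BS.inv_closed[OF g]] conv ..
  obtain i where i: "P (int (period m n ?x)) i" using iffD1[OF dom dvd_refl] by blast
  obtain j where j: "P j (int (period m n ?y))" using iffD1[OF ran dvd_refl] by blast
  have "i \<noteq> 0" using mult[OF i] period_pos_and_iff(1)[OF V(1)] by auto
  then have "int (period m n ?y) \<le> \<bar>i\<bar>" using dvd_imp_le_int[of i "int (period m n ?y)"] iffD2[OF ran exI[of "\<lambda>j. P j i", OF i]] by simp
  then have 1: "\<bar>\<rho>\<bar> * period m n ?y \<le> period m n ?x"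
    using mult[OF i] by (simp add: mult_left_mono)
  have "j \<noteq> 0" using mult[OF j] period_pos_and_iff(1)[OF V(2)] rho by auto
  then have "int (period m n ?x) \<le> \<bar>j\<bar>" using dvd_imp_le_int[of j "int (period m n ?x)"] iffD2[OF dom exI[of "P j", OF j]] by simp
  then have 2: "period m n ?x \<le> \<bar>\<rho>\<bar> * period m n ?y"
    using mult[OF j] by simp
  have "\<bar>\<rho>\<bar> = (n / \<bar>m\<bar>) powi height ?x"
    unfolding \<rho>_def power_int_abs abs_n_over_m ..
  then show ?thesis using 1 2 by simp
qed

text \<open>
  At height one the multiplier is \<open>n / m\<close>, so \<open>a\<^sup>s g = g a\<^sup>i\<close> forces \<open>s m = n i\<close>.  Raising the conjugation
  to the power \<open>m\<close> makes both exponents explicit.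
\<close>

lemma conjugation_at_height_1:
  assumes g: "g \<in> carrier B" and "height (bs_act g []) = 1"
  obtains N where "N \<noteq> 0" and
    "a [^]\<^bsub>B\<^esub> (n * N) \<otimes>\<^bsub>B\<^esub> g = g \<otimes>\<^bsub>B\<^esub> a [^]\<^bsub>B\<^esub> (m * N)"
proof -
  obtain s where s: "s \<noteq> 0" "sh s (bs_act g []) = bs_act g []"
    using ex_shift_fixes[OF bs_act_in_vertices[OF Nil_in_vertices]] by blast
  then obtain i :: int where i: "a [^]\<^bsub>B\<^esub> s \<otimes>\<^bsub>B\<^esub> g = g \<otimes>\<^bsub>B\<^esub> a [^]\<^bsub>B\<^esub> i"
    using iffD1[OF shift_fixes_iff_conj[OF g] s(2)] by blast
  then have "real_of_int s = n / m * real_of_int i"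
    using conjugation_multiplier[OF g, of s i] assms(2) by simp
  then have "real_of_int (s * m) = real_of_int (n * i)" using m_nonzero by (simp add: field_simps)
  then have sm: "s * m = n * i" by linarith
  have "i \<noteq> 0" using sm s m_nonzero by auto
  have "a [^]\<^bsub>B\<^esub> s = g \<otimes>\<^bsub>B\<^esub> a [^]\<^bsub>B\<^esub> i \<otimes>\<^bsub>B\<^esub> inv\<^bsub>B\<^esub> g"
    using i g BS.inv_solve_right[of "a [^]\<^bsub>B\<^esub> s" "g \<otimes>\<^bsub>B\<^esub> a [^]\<^bsub>B\<^esub> i" g] by simp
  then have "(a [^]\<^bsub>B\<^esub> s) [^]\<^bsub>B\<^esub> m = g \<otimes>\<^bsub>B\<^esub> (a [^]\<^bsub>B\<^esub> i) [^]\<^bsub>B\<^esub> m \<otimes>\<^bsub>B\<^esub> inv\<^bsub>B\<^esub> g"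
    using g by (simp only: BS.int_pow_conj BS.int_pow_closed a_in_B)
  then have "a [^]\<^bsub>B\<^esub> (s * m) = g \<otimes>\<^bsub>B\<^esub> a [^]\<^bsub>B\<^esub> (i * m) \<otimes>\<^bsub>B\<^esub> inv\<^bsub>B\<^esub> g"
    by (simp only: BS.int_pow_pow a_in_B)
  then have "a [^]\<^bsub>B\<^esub> (s * m) \<otimes>\<^bsub>B\<^esub> g = g \<otimes>\<^bsub>B\<^esub> a [^]\<^bsub>B\<^esub> (i * m)"
    using g by (simp add: BS.m_assoc)
  then have "a [^]\<^bsub>B\<^esub> (n * i) \<otimes>\<^bsub>B\<^esub> g = g \<otimes>\<^bsub>B\<^esub> a [^]\<^bsub>B\<^esub> (m * i)"
    unfolding sm mult.commute[of i m] .
  then show ?thesis using that \<open>i \<noteq> 0\<close> by blast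
qed

lemma ray_in_vertices [simp]: "replicate k (b, 0) \<in> V"
  by (induction k) (auto simp: vertices_def hd_replicate)

text \<open>
  Along the ray \<open>t, t\<^sup>2, t\<^sup>3, \<dots>\<close> each step replaces an exponent \<open>n c\<close> by the smaller \<open>m c\<close>; sooner or
  later it is not divisible by \<open>n\<close>.
\<close>

lemma shift_faithful:
  assumes "\<bar>m\<bar> < n" and "N \<noteq> 0"
  shows "\<exists>x\<in>V. sh N x \<noteq> x"
proof -
  have "\<exists>k. sh N (replicate k (True, 0)) \<noteq> replicate k (True, 0)"
    using assms(2)
  proof (induction "nat \<bar>N\<bar>" arbitrary: N rule: less_induct)
    case less
    show ?case
    proof (cases "n dvd N")
      case False
      then have "sh N (replicate 1 (True, 0)) \<noteq> replicate 1 (True, 0)"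
        by (auto simp: modulus_def)
      then show ?thesis by blast
    next
      case True
      then obtain c where c: "N = n * c" by blast
      have "c \<noteq> 0" using less.prems c by auto
      have "\<bar>c * m\<bar> < \<bar>N\<bar>" using assms(1) \<open>c \<noteq> 0\<close> n_pos by (simp add: c abs_mult)
      then have "nat \<bar>c * m\<bar> < nat \<bar>N\<bar>" by linarith
      then obtain k where "sh (c * m) (replicate k (True, 0)) \<noteq> replicate k (True, 0)"
        using less.hyps[of "c * m"] \<open>c \<noteq> 0\<close> m_nonzero by (meson mult_eq_0_iff)
      then have "sh N (replicate (Suc k) (True, 0)) \<noteq> replicate (Suc k) (True, 0)"
        using n_pos by (simp add: c modulus_def)
      then show ?thesis by blast
    qed
  qed
  then show ?thesis using ray_in_vertices by blast
qed

end

section \<open>Groups in which the Baumslag-Solitar group is dense\<close>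

definition adjacent :: "'a list \<Rightarrow> 'a list \<Rightarrow> bool"
  where "adjacent x y \<longleftrightarrow> x \<noteq> [] \<and> y = butlast x \<or> y \<noteq> [] \<and> x = butlast y"

lemma adjacent_sym: "adjacent x y \<longleftrightarrow> adjacent y x"
  by (auto simp: adjacent_def)

lemma adjacent_push:
  assumes "adjacent x y"
  shows "adjacent (push b x) (push b y)"
proof -
  have "adjacent (push b z) (push b (butlast z))" if "z \<noteq> []" for z
    using that by (cases z; cases "tl z") (auto simp: push_def adjacent_def)
  then show ?thesis using assms adjacent_sym[of "push b x"] unfolding adjacent_def[of x] by blast
qed

lemma height_butlast:
  "x \<noteq> [] \<Longrightarrow> height x = height (butlast x) + (if fst (last x) then 1 else - 1)"
  by (induction x rule: height.induct) auto

lemma adjacent_height: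
  assumes "adjacent x y" shows "height x \<noteq> height y"
proof -
  have "height z \<noteq> height (butlast z)" if "z \<noteq> []" for z
    using height_butlast[OF that] by simp
  then show ?thesis using assms unfolding adjacent_def by metis
qed

context bs_tree
begin

lemma butlast_in_vertices: "x \<in> V \<Longrightarrow> butlast x \<in> V"
proof (induction x)
  case (Cons p x)
  then have "butlast x \<in> V" by (blast dest: vertices_ConsD)
  moreover have "hd (butlast x) = hd x" if "butlast x \<noteq> []"
    using that by (cases x) auto
  ultimately show ?case using Cons.prems by (cases p) (auto simp: vertices_def)
qed simp

lemma adjacent_bs_act:
  assumes g: "g \<in> carrier B" and "x \<in> V" "y \<in> V" and xy: "adjacent x y"
  shows "adjacent (bs_act g x) (bs_act g y)"
proof -
  obtain w where w: "g = cls w" using g carrier_B by auto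
  have shift: "adjacent (sh j u) (sh j v)" if "adjacent u v" for j u v
    using that by (auto simp: adjacent_def butlast_shift)
  have "adjacent (letter_act m n l u) (letter_act m n l v)" if "adjacent u v" for l u v
    using that shift adjacent_push by (cases l; cases "fst l") auto
  then have "adjacent (word_act w x) (word_act w y)"
    by (induction w) (use xy in auto)
  then show ?thesis using assms by (simp add: w bs_act_cls)
qed

end

text \<open>
  What the completion inherits from \<open>BS m n\<close>: a faithful action on the vertices in which every element
  agrees with an element of \<open>BS m n\<close> on any given finite set of vertices, and the topology of pointwise
  convergence.  The two directions of the latter are split into \<open>open_eval\<close> and \<open>nbhd\<close>.
\<close>

locale bs_completion = bs_tree m n + group G
  for m n :: int and G :: "'g monoid" (structure) +
  fixes T :: "'g topology"
    and act :: "'g \<Rightarrow> (bool \<times> int) list \<Rightarrow> (bool \<times> int) list"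
    and emb :: "BS_gen word set \<Rightarrow> 'g"
  assumes emb_closed [simp]: "b \<in> carrier (BS m n) \<Longrightarrow> emb b \<in> carrier G"
    and act_in_vertices [simp]: "g \<in> carrier G \<Longrightarrow> x \<in> vertices m n \<Longrightarrow> act g x \<in> vertices m n"
    and act_mult: "g \<in> carrier G \<Longrightarrow> h \<in> carrier G \<Longrightarrow> x \<in> vertices m n \<Longrightarrow> act (g \<otimes> h) x = act g (act h x)"
    and act_emb: "b \<in> carrier (BS m n) \<Longrightarrow> x \<in> vertices m n \<Longrightarrow> act (emb b) x = bs_tree.bs_act m n b x"
    and faithful: "g \<in> carrier G \<Longrightarrow> h \<in> carrier G \<Longrightarrow>
      (\<And>x. x \<in> vertices m n \<Longrightarrow> act g x = act h x) \<Longrightarrow> g = h"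
    and dense: "g \<in> carrier G \<Longrightarrow> finite F \<Longrightarrow> F \<subseteq> vertices m n \<Longrightarrow>
      \<exists>b\<in>carrier (BS m n). \<forall>x\<in>F. act g x = bs_tree.bs_act m n b x"
    and topspace_T: "topspace T = carrier G"
    and open_eval: "x \<in> vertices m n \<Longrightarrow> y \<in> vertices m n \<Longrightarrow> openin T {g \<in> carrier G. act g x = y}"
    and nbhd: "openin T U \<Longrightarrow> g \<in> U \<Longrightarrow>
      \<exists>F. finite F \<and> F \<subseteq> vertices m n \<and> (\<forall>h\<in>carrier G. (\<forall>x\<in>F. act h x = act g x) \<longrightarrow> h \<in> U)"
begin

lemma emb_mult:
  assumes "b \<in> carrier B" "c \<in> carrier B"
  shows "emb (b \<otimes>\<^bsub>B\<^esub> c) = emb b \<otimes> emb c"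
  using assms by (intro faithful) (auto simp: act_mult act_emb bs_act_mult bs_act_in_vertices)

lemma act_one [simp]:
  assumes "x \<in> V" shows "act \<one> x = x"
proof -
  have "emb \<one>\<^bsub>B\<^esub> = \<one>" using emb_mult[of "\<one>\<^bsub>B\<^esub>" "\<one>\<^bsub>B\<^esub>"] by (metis BS.one_closed BS.r_one emb_closed l_cancel_one')
  then show ?thesis using act_emb[of "\<one>\<^bsub>B\<^esub>" x] assms by (simp add: bs_act_one)
qed

lemma emb_hom: "emb \<in> hom B G"
  by (intro homI) (auto simp: emb_mult)

lemma act_inv [simp]:
  assumes "g \<in> carrier G" "x \<in> V"
  shows "act (inv g) (act g x) = x" and "act g (act (inv g) x) = x"
  using assms act_mult[of "inv g" g x] act_mult[of g "inv g" x] by auto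

lemma act_inj: "g \<in> carrier G \<Longrightarrow> x \<in> V \<Longrightarrow> y \<in> V \<Longrightarrow> act g x = act g y \<longleftrightarrow> x = y"
  by (metis act_inv(1))

definition \<alpha> where "\<alpha> j = emb (a [^]\<^bsub>B\<^esub> (j::int))"

lemma \<alpha>_closed [simp]: "\<alpha> j \<in> carrier G"
  by (simp add: \<alpha>_def)

lemma act_\<alpha>: "x \<in> V \<Longrightarrow> act (\<alpha> j) x = sh j x"
  by (simp add: \<alpha>_def act_emb bs_act_a_power)

lemma \<alpha>_int_pow: "\<alpha> 1 [^] (j::int) = \<alpha> j"
  using hom_int_pow[OF emb_hom, of a j] group_axioms BS.group_axioms by (simp add: \<alpha>_def)

definition K where "K = {g \<in> carrier G. act g [] = []}"

lemma K_closed: "k \<in> K \<Longrightarrow> k \<in> carrier G" and K_root: "k \<in> K \<Longrightarrow> act k [] = []"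
  by (auto simp: K_def)

lemma \<alpha>_in_K: "\<alpha> j \<in> K"
  by (simp add: K_def act_\<alpha>)

text \<open>
  Include the base vertex in the finite set: the approximating element then fixes it, and hence is a
  power of \<open>a\<close>.
\<close>

lemma K_approx:
  assumes "k \<in> K" "finite F" "F \<subseteq> V"
  obtains j where "\<And>x. x \<in> F \<Longrightarrow> act k x = sh j x"
proof -
  obtain b where b: "b \<in> carrier B" "\<And>x. x \<in> insert [] F \<Longrightarrow> act k x = bs_act b x"
    using dense[of k "insert [] F"] assms K_closed by auto
  then have "bs_act b [] = []" using K_root[OF assms(1)] by auto
  then obtain j :: int where "b = a [^]\<^bsub>B\<^esub> j" using stabilizer_root b by blast
  then show ?thesis using that[of j] b assms bs_act_a_power by auto
qed

lemma length_act_K: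
  assumes "k \<in> K" "x \<in> V"
  shows "length (act k x) = length x"
proof -
  obtain j where "\<And>y. y \<in> {x} \<Longrightarrow> act k y = sh j y"
    by (rule K_approx[of k "{x}"]) (use assms in auto)
  then show ?thesis by simp
qed

lemma act_K_butlast:
  assumes "k \<in> K" "x \<in> V"
  shows "act k (butlast x) = butlast (act k x)"
proof -
  obtain j where "\<And>y. y \<in> {x, butlast x} \<Longrightarrow> act k y = sh j y"
    by (rule K_approx[of k "{x, butlast x}"]) (use assms butlast_in_vertices in auto)
  then show ?thesis by (simp add: butlast_shift)
qed

lemma adjacent_act:
  assumes "g \<in> carrier G" "x \<in> V" "y \<in> V" "adjacent x y"
  shows "adjacent (act g x) (act g y)"
proof -
  obtain b where b: "b \<in> carrier B" "\<forall>z\<in>{x, y}. act g z = bs_act b z"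
    using dense[of g "{x, y}"] assms by auto
  then show ?thesis using adjacent_bs_act[OF b(1) assms(2-4)] by simp
qed

lemma height_act:
  assumes "g \<in> carrier G" "x \<in> V" "y \<in> V"
  shows "height (act g x) - height x = height (act g y) - height y"
proof -
  obtain b where b: "b \<in> carrier B" "\<forall>z\<in>{x, y}. act g z = bs_act b z"
    using dense[of g "{x, y}"] assms by auto
  then show ?thesis using height_bs_act[OF b(1) assms(2,3)] by simp
qed

lemma transitive:
  assumes "x \<in> V"
  obtains b where "b \<in> carrier B" "act (emb b) [] = x"
  using that[of "rep x"] bs_act_rep assms by (simp add: act_emb)

text \<open>
  The product of the periods is a positive exponent for which \<open>a\<close> is close to the identity; this is how
  the topology enters.
\<close>

lemma ex_common_shift:
  assumes "finite F" "F \<subseteq> V"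
  shows "\<exists>N>0. \<forall>x\<in>F. sh N x = x"
proof (intro exI conjI ballI)
  show "int (\<Prod>x\<in>F. period m n x) > 0"
    using period_pos_and_iff(1) assms by (simp add: prod_pos subset_iff)
  fix x assume "x \<in> F"
  then show "sh (int (\<Prod>x\<in>F. period m n x)) x = x"
    using assms period_pos_and_iff(2)[of x] dvd_prodI[of F x "period m n"] by auto
qed

definition E where "E = {(x, y). x \<in> V \<and> y \<in> V \<and> adjacent x y}"

lemma connected:
  assumes "x \<in> V" "y \<in> V"
  shows "\<exists>d. (x, y) \<in> E ^^ d"
proof -
  have sym: "E\<inverse> = E" by (auto simp: E_def adjacent_sym)
  have root: "(z, []) \<in> E\<^sup>*" if "z \<in> V" for z
    using that
  proof (induction z rule: length_induct)
    case (1 z)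
    show ?case
    proof (cases "z = []")
      case False
      then have "(z, butlast z) \<in> E" using 1 butlast_in_vertices by (auto simp: E_def adjacent_def)
      moreover have "(butlast z, []) \<in> E\<^sup>*" using 1 False butlast_in_vertices by auto
      ultimately show ?thesis by (rule converse_rtrancl_into_rtrancl)
    qed simp
  qed
  have "([], y) \<in> E\<^sup>*" using root[OF assms(2)] rtrancl_converseI[of y "[]" E] sym by (metis rtrancl_converseI)
  then have "(x, y) \<in> E\<^sup>*" using root[OF assms(1)] by (meson rtrancl_trans)
  then show ?thesis by (rule rtrancl_imp_relpow)
qed

section \<open>Elements with a power fixing the root\<close>

text \<open>
  Choose a vertex \<open>y\<close> and a walk from \<open>y\<close> to \<open>c y\<close> of minimal length \<open>d\<close>.  If \<open>d > 0\<close>, then the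
  translates of this walk by the powers of \<open>c\<close> form an infinite walk \<open>u\<close>.  It never backtracks: for
  \<open>d = 1\<close> that would invert an edge, and for larger \<open>d\<close> it would allow a shorter walk.  A walk without
  backtracking in a rooted tree moves away from the root for ever once it has made one step away.  But the
  distance from the root is periodic along \<open>u\<close>, since \<open>c [^] N\<close> fixes the root.
\<close>

lemma elliptic:
  fixes N :: nat
  assumes c: "c \<in> carrier G" and N: "N > 0" and cN: "act (c [^] N) [] = []"
  obtains y where "y \<in> V" "act c y = y"
proof -
  let ?c = "act c"
  define P where "P d \<longleftrightarrow> (\<exists>y\<in>V. (y, ?c y) \<in> E ^^ d)" for d
  have "\<exists>d. P d" unfolding P_def using connected[of "[]" "?c []"] c Nil_in_vertices act_in_vertices by blast
  then have d: "P (LEAST d. P d)" by (rule LeastI_ex)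
  define d where "d = (LEAST d. P d)"
  have least: "d \<le> d'" if "P d'" for d' unfolding d_def using that by (rule Least_le)
  note d = d[folded d_def]
  then obtain y where y: "y \<in> V" "(y, ?c y) \<in> E ^^ d" by (auto simp: P_def)
  show ?thesis
  proof (cases "d = 0")
    case True
    then show ?thesis using that y by simp
  next
    case False
    then have d_pos: "d > 0" by simp
    have E_c: "((?c ^^ q) x, (?c ^^ q) z) \<in> E" if "(x, z) \<in> E" for q x z
      using that by (induction q) (auto simp: E_def c intro: adjacent_act)
    obtain f where f: "f 0 = y" "f d = ?c y" "\<And>i. i < d \<Longrightarrow> (f i, f (Suc i)) \<in> E"
      using y(2) unfolding relpow_fun_conv by blast
    define u where "u k = (?c ^^ (k div d)) (f (k mod d))" for k
    have u_d: "u (k + d) = ?c (u k)" for k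
      using d_pos by (simp add: u_def)
    have u_E: "(u k, u (Suc k)) \<in> E" for k
    proof -
      have "u (Suc k) = (?c ^^ (k div d)) (f (Suc (k mod d)))"
      proof (cases "Suc (k mod d) = d")
        case True
        then show ?thesis
          by (simp add: u_def mod_Suc div_Suc f(1,2) funpow_swap1)
      qed (simp add: u_def mod_Suc div_Suc)
      then show ?thesis using E_c f(3)[of "k mod d"] d_pos by (simp add: u_def)
    qed
    then have u_V: "u k \<in> V" for k by (auto simp: E_def)
    have walk: "(u k, u (k + l)) \<in> E ^^ l" for k l
      by (induction l) (use u_E in \<open>auto intro: relpow_Suc_I\<close>)
    have reduced: "u (k + 2) \<noteq> u k" for k
    proof
      assume eq: "u (k + 2) = u k"
      show False
      proof (cases "d = 1")
        case True
        then have "u (k + 1) = ?c (u k)" "u (k + 2) = ?c (u (k + 1))"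
          using u_d[of k] u_d[of "k + 1"] by simp_all
        then have "height (u (k + 1)) - height (u k) = height (u k) - height (u (k + 1))"
          using height_act[OF c u_V u_V, of "k + 1" k] eq by simp
        then show False using u_E[of k] adjacent_height[of "u k" "u (k + 1)"] by (simp add: E_def)
      next
        case False
        then have "k + 2 + (d - 2) = k + d" using d_pos by simp
        then have "u (k + 2 + (d - 2)) = ?c (u (k + 2))"
          by (simp only: u_d eq)
        then have "(u (k + 2), ?c (u (k + 2))) \<in> E ^^ (d - 2)"
          using walk[of "k + 2" "d - 2"] by (simp only:)
        then have "P (d - 2)" unfolding P_def using u_V by blast
        then show False using least[of "d - 2"] d_pos by simp
      qed
    qed
    have step: "length (u (Suc k)) = Suc (length (u k)) \<and> u k = butlast (u (Suc k)) \<or>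
        length (u k) = Suc (length (u (Suc k))) \<and> u (Suc k) = butlast (u k)" for k
      using u_E[of k] by (auto simp: E_def adjacent_def)
    \<comment> \<open>A step back towards the root leads to the unique parent, from which the walk has just come.\<close>
    have up: "length (u (Suc (Suc k))) = Suc (length (u (Suc k)))"
      if "length (u (Suc k)) = Suc (length (u k))" for k
    proof (rule ccontr)
      assume down: "\<not> ?thesis"
      have "u k = butlast (u (Suc k))"
        using step[of k] that by (elim disjE conjE) (assumption | linarith)+
      moreover have "u (Suc (Suc k)) = butlast (u (Suc k))"
        using step[of "Suc k"] down by (elim disjE conjE) (assumption | linarith)+
      ultimately show False using reduced[of k] by simp
    qed
    \<comment> \<open>The walk cannot approach the root for ever.\<close>
    have "\<exists>k. length (u (Suc k)) = Suc (length (u k))"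
    proof (rule ccontr)
      assume "\<not> ?thesis"
      then have down: "length (u k) = Suc (length (u (Suc k)))" for k using step[of k] by blast
      have "length (u 0) = length (u k) + k" for k
      proof (induction k)
        case (Suc k)
        then show ?case using down[of k] by linarith
      qed simp
      from this[of "Suc (length (u 0))"] show False by simp
    qed
    then obtain k0 where k0: "length (u (Suc k0)) = Suc (length (u k0))" by blast
    have "length (u (Suc (k0 + i))) = Suc (length (u (k0 + i)))" for i
      by (induction i) (use k0 up in auto)
    then have rise: "length (u (k0 + i)) = length (u k0) + i" for i by (induction i) auto
    have per: "length (u (k + d * N)) = length (u k)" for k
    proof -
      have "u (k + d * i) = (?c ^^ i) (u k)" for i
      proof (induction i)
        case (Suc i)
        have "k + d * Suc i = (k + d * i) + d" by simp
        then show ?case using Suc u_d[of "k + d * i"] by (simp only: funpow.simps comp_apply)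
      qed simp
      moreover have "(?c ^^ i) x = act (c [^] i) x" if "x \<in> V" for i :: nat and x
        by (induction i) (use that c in \<open>simp_all only: funpow.simps comp_apply id_apply nat_pow_0 act_one
          nat_pow_Suc2 act_mult nat_pow_closed\<close>)
      moreover have "c [^] N \<in> K" using cN c by (simp add: K_def)
      ultimately show ?thesis using length_act_K u_V by simp
    qed
    have "length (u k0) + d * N = length (u k0)"
      using per[of k0] rise[of "d * N"] by simp
    then show ?thesis using d_pos N by simp
  qed
qed

section \<open>Factorisations into commuting subgroups\<close>

text \<open>
  In this section \<open>P\<close> and \<open>Q\<close> are elementwise commuting subgroups whose product is the whole group.
  Each of them is then normal, and the aim is that one of them is trivial.
\<close>

definition factors :: "'g set \<Rightarrow> 'g set \<Rightarrow> bool"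
  where "factors P Q \<longleftrightarrow> subgroup P G \<and> subgroup Q G \<and>
    (\<forall>p\<in>P. \<forall>q\<in>Q. p \<otimes> q = q \<otimes> p) \<and> (\<forall>g\<in>carrier G. \<exists>p\<in>P. \<exists>q\<in>Q. g = p \<otimes> q)"

lemma factors_sym: "factors P Q \<Longrightarrow> factors Q P"
  unfolding factors_def by metis

lemma factors_closed:
  assumes "factors P Q"
  shows "p \<in> P \<Longrightarrow> p \<in> carrier G" and "q \<in> Q \<Longrightarrow> q \<in> carrier G"
  using assms by (auto simp: factors_def subgroup.mem_carrier)

lemma factors_act_commute:
  assumes "factors P Q" "p \<in> P" "q \<in> Q" "x \<in> V"
  shows "act p (act q x) = act q (act p x)"
proof -
  have "p \<otimes> q = q \<otimes> p" using assms unfolding factors_def by blast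
  then have "act (p \<otimes> q) x = act (q \<otimes> p) x" by simp
  then show ?thesis using assms factors_closed[OF assms(1)] by (simp add: act_mult)
qed

lemma factor_normal:
  assumes F: "factors P Q" and g: "g \<in> carrier G" and x: "x \<in> P"
  shows "g \<otimes> x \<otimes> inv g \<in> P"
proof -
  obtain p q where pq: "p \<in> P" "q \<in> Q" "g = p \<otimes> q" using F g by (auto simp: factors_def)
  note c = factors_closed[OF F]
  have "q \<otimes> x = x \<otimes> q" using F pq x unfolding factors_def by fastforce
  then have "q \<otimes> x \<otimes> inv q = x"
    using c(1)[OF x] c(2)[OF pq(2)] by (simp add: inv_solve_right')
  then have conj_q: "q \<otimes> (x \<otimes> inv q) = x" using c(1)[OF x] c(2)[OF pq(2)] by (simp add: m_assoc)
  have "g \<otimes> x \<otimes> inv g = p \<otimes> (q \<otimes> (x \<otimes> inv q)) \<otimes> inv p"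
    using c(1)[OF x] c(1)[OF pq(1)] c(2)[OF pq(2)] by (simp add: pq(3) inv_mult_group m_assoc)
  also have "\<dots> = p \<otimes> x \<otimes> inv p" by (simp only: conj_q)
  finally have "g \<otimes> x \<otimes> inv g = p \<otimes> x \<otimes> inv p" .
  moreover have "p \<otimes> x \<otimes> inv p \<in> P"
    using F pq(1) x by (auto simp: factors_def subgroup_def)
  ultimately show ?thesis by simp
qed

text \<open>
  By normality such a factor fixes not only the base vertex but its whole orbit, which is everything.
\<close>

lemma factor_in_K_trivial:
  assumes F: "factors P Q" and PK: "P \<subseteq> K"
  shows "P = {\<one>}"
proof -
  have "p = \<one>" if p: "p \<in> P" for p
  proof (rule faithful)
    show pc: "p \<in> carrier G" using factors_closed[OF F] p by blast
    fix x assume x: "x \<in> V"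
    obtain b where b: "b \<in> carrier B" "act (emb b) [] = x" using transitive[OF x] .
    let ?g = "emb b"
    have "inv ?g \<otimes> p \<otimes> inv (inv ?g) \<in> P" using factor_normal[OF F _ p, of "inv ?g"] b by simp
    then have "act (inv ?g \<otimes> p \<otimes> ?g) [] = []" using PK K_root b by auto
    then have "act (inv ?g) (act p x) = []" using b pc x by (simp add: act_mult)
    then have "act ?g [] = act p x" using b pc x by (metis act_in_vertices act_inv(2) emb_closed)
    then show "act p x = act \<one> x" using b x by simp
  qed auto
  moreover have "\<one> \<in> P" using F by (simp add: factors_def subgroup.one_closed)
  ultimately show ?thesis by blast
qed

lemma commutes_with_\<alpha>_in_K:
  assumes g: "g \<in> carrier G" and "g \<otimes> \<alpha> 1 = \<alpha> 1 \<otimes> g"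
  shows "g \<in> K"
proof -
  have "act (g \<otimes> \<alpha> 1) [] = act (\<alpha> 1 \<otimes> g) []" using assms by simp
  then have "sh 1 (act g []) = act g []" using g by (simp add: act_mult act_\<alpha>)
  then show ?thesis using shift_1_fixes_only_root g by (simp add: K_def)
qed

lemma act_stable_root: "act (emb (stable e)) [] = [(e, 0)]"
  by (simp add: act_emb bs_act_stable push_def)

text \<open>
  Write \<open>a\<close> as \<open>x y\<close> with \<open>x\<close> in \<open>P\<close> and \<open>y\<close> in \<open>Q\<close>.  Both commute with \<open>a\<close> and therefore lie in \<open>K\<close>, and
  they have no common fixed vertex but the base vertex.  The \<open>P\<close>-orbit of the base vertex consists of
  fixed points of \<open>y\<close> and its \<open>Q\<close>-orbit of fixed points of \<open>x\<close>.
\<close>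

context
  fixes P Q x y
  assumes F: "factors P Q" and x: "x \<in> P" and y: "y \<in> Q" and xy: "\<alpha> 1 = x \<otimes> y"
begin

lemma closed: "p \<in> P \<Longrightarrow> p \<in> carrier G" "q \<in> Q \<Longrightarrow> q \<in> carrier G"
  using factors_closed[OF F] by auto

lemma x_y_in_K: "x \<in> K" "y \<in> K"
proof -
  have "x \<otimes> y = y \<otimes> x" using F x y unfolding factors_def by blast
  then have "x \<otimes> \<alpha> 1 = \<alpha> 1 \<otimes> x" "y \<otimes> \<alpha> 1 = \<alpha> 1 \<otimes> y"
    unfolding xy using closed x y by (simp_all add: m_assoc) (simp add: m_assoc[symmetric])
  then show "x \<in> K" "y \<in> K" using commutes_with_\<alpha>_in_K closed x y by auto
qed

lemma common_fixed_point:
  assumes "v \<in> V" "act x v = v" "act y v = v"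
  shows "v = []"
proof -
  have "act (\<alpha> 1) v = v" unfolding xy using assms closed x y by (simp add: act_mult)
  then show ?thesis using assms shift_1_fixes_only_root by (simp add: act_\<alpha>)
qed

text \<open>
  If \<open>x\<close> is trivial, then \<open>P\<close> commutes with \<open>a\<close>, which confines it to \<open>K\<close>.
\<close>

lemma trivial_if_x_trivial:
  assumes "x = \<one>" shows "P = {\<one>}"
proof (rule factor_in_K_trivial[OF F], rule subsetI)
  fix p assume p: "p \<in> P"
  have "\<alpha> 1 = y" using xy assms closed y by simp
  moreover have "p \<otimes> y = y \<otimes> p" using F p y unfolding factors_def by blast
  ultimately show "p \<in> K" using p closed commutes_with_\<alpha>_in_K by simp
qed

lemma orbit_fixed:
  shows "p \<in> P \<Longrightarrow> act y (act p []) = act p []" and "q \<in> Q \<Longrightarrow> act x (act q []) = act q []"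
  using factors_act_commute[OF F _ y, of p "[]"] factors_act_commute[OF F x, of q "[]"]
    K_root[OF x_y_in_K(1)] K_root[OF x_y_in_K(2)] by simp_all

text \<open>
  Let \<open>g = p q\<close>.  The vertices \<open>u\<close> (\<open>q\<close> applied to the root) and \<open>v\<close> (the inverse of \<open>p\<close> applied to the
  root) are adjacent, so one is the parent of the other.  Elements of \<open>K\<close> that fix a vertex fix its parent;
  thus the parent is fixed by both \<open>x\<close> and \<open>y\<close>, and is the root.
\<close>

lemma neighbour_in_orbit:
  assumes g: "g \<in> carrier G" and adj: "adjacent (act g []) []"
  shows "(\<exists>p\<in>P. act g [] = act p []) \<or> (\<exists>q\<in>Q. act g [] = act q [])"
proof -
  obtain p q where pq: "p \<in> P" "q \<in> Q" "g = p \<otimes> q" using F g by (auto simp: factors_def)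
  note c = closed(1)[OF pq(1)] closed(2)[OF pq(2)]
  have ip: "inv p \<in> P" using F pq by (simp add: factors_def subgroup.m_inv_closed)
  let ?u = "act q []" and ?v = "act (inv p) []"
  have uV: "?u \<in> V" "?v \<in> V" using c by auto
  have "adjacent (act (inv p) (act g [])) ?v"
    using adjacent_act[of "inv p" "act g []" "[]"] adj c g by simp
  then have uv: "adjacent ?u ?v" using c by (simp add: pq act_mult)
  have fu: "act x ?u = ?u" and fv: "act y ?v = ?v"
    using orbit_fixed pq ip by auto
  have "?u = [] \<or> ?v = []"
  proof -
    consider "?v = butlast ?u" | "?u = butlast ?v" using uv by (auto simp: adjacent_def)
    then show ?thesis
    proof cases
      case 1
      then have "act x ?v = ?v" using act_K_butlast[OF x_y_in_K(1) uV(1)] fu by simp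
      then show ?thesis using common_fixed_point[OF uV(2)] fv by simp
    next
      case 2
      then have "act y ?u = ?u" using act_K_butlast[OF x_y_in_K(2) uV(2)] fv by simp
      then show ?thesis using common_fixed_point[OF uV(1)] fu by simp
    qed
  qed
  then show ?thesis
  proof
    assume "?u = []"
    then have "act g [] = act p []" using c by (simp add: pq act_mult)
    then show ?thesis using pq by blast
  next
    assume "?v = []"
    then have "act p [] = []" using c act_inv(2)[of p "[]"] by simp
    then have "act g [] = ?u" using c factors_act_commute[OF F pq(1,2), of "[]"] by (simp add: pq act_mult)
    then show ?thesis using pq by blast
  qed
qed

text \<open>
  As \<open>P\<close> is normal, an element that moves the root within the \<open>P\<close>-orbit preserves this orbit.  If this
  applies to \<open>t\<close> and its inverse, then it applies to all of \<open>BS m n\<close>.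
\<close>

lemma orbit_everything:
  assumes s: "\<And>e. \<exists>p\<in>P. act (emb (stable e)) [] = act p []" and v: "v \<in> V"
  shows "\<exists>p\<in>P. v = act p []"
proof -
  have invariant: "\<exists>p\<in>P. act g u = act p []"
    if g: "g \<in> carrier G" and root: "\<exists>p\<in>P. act g [] = act p []" and u: "\<exists>p\<in>P. u = act p []" for g u
  proof -
    obtain p p' where p: "p \<in> P" "u = act p []" "p' \<in> P" "act g [] = act p' []" using root u by blast
    have "act g u = act (g \<otimes> p \<otimes> inv g) (act g [])"
      using p(1) g closed(1)[OF p(1)] by (simp add: p(2) act_mult)
    also have "\<dots> = act ((g \<otimes> p \<otimes> inv g) \<otimes> p') []"
      using g closed(1)[OF p(1)] closed(1)[OF p(3)] by (simp add: p(4) act_mult)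
    finally show ?thesis
      using factor_normal[OF F g p(1)] p(3) F by (auto simp: factors_def intro!: bexI subgroup.m_closed)
  qed
  have one: "\<one> \<in> P" using F by (simp add: factors_def subgroup.one_closed)
  show ?thesis using v
  proof (induction v)
    case Nil
    then show ?case using one by force
  next
    case (Cons l v)
    obtain e r where l: "l = (e, r)" by force
    have v: "v \<in> V" using Cons.prems by (rule vertices_ConsD)
    have "\<exists>p\<in>P. act (emb (stable e)) v = act p []"
      using invariant[OF _ s Cons.IH[OF v]] by simp
    then have push: "\<exists>p\<in>P. push e v = act p []" using v by (simp add: act_emb bs_act_stable)
    have "\<exists>p\<in>P. act (\<alpha> r) [] = act p []" using one by (force simp: act_\<alpha>)
    then have "\<exists>p\<in>P. act (\<alpha> r) (push e v) = act p []"
      using invariant[OF _ _ push] by simp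
    then show ?case using v shift_push_Cons[OF Cons.prems[unfolded l]] by (simp add: l act_\<alpha> push_in_vertices)
  qed
qed

lemma y_trivial:
  assumes s: "\<And>e. \<exists>p\<in>P. act (emb (stable e)) [] = act p []"
  shows "y = \<one>"
proof (rule faithful)
  fix v assume "v \<in> V"
  then show "act y v = act \<one> v" using orbit_everything[OF s] orbit_fixed(1) by force
qed (use closed y in auto)

text \<open>
  Suppose that one neighbour of the root lies in the \<open>P\<close>-orbit and the opposite one in the \<open>Q\<close>-orbit.
  Cancelling \<open>t\<close> against its inverse shows that a vertex in the \<open>Q\<close>-orbit, namely the opposite neighbour,
  also lies in the \<open>P\<close>-orbit; then \<open>x\<close> and \<open>y\<close> both fix it, although it is not the root.
\<close>

lemma mixed_neighbours_impossible:
  assumes p: "p \<in> P" "act (emb (stable e)) [] = act p []"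
    and q: "q \<in> Q" "act (emb (stable (\<not> e))) [] = act q []"
  shows False
proof -
  let ?s = "emb (stable e)"
  note c = closed(1)[OF p(1)] closed(2)[OF q(1)]
  define k where "k = inv p \<otimes> ?s"
  have k: "k \<in> carrier G" "act k [] = []" using c p by (auto simp: k_def act_mult)
  have ik: "act (inv k) [] = []" using act_inv(1)[of k "[]"] k by simp
  have "act ?s (act q []) = []"
    unfolding q(2)[symmetric] by (simp add: act_emb bs_act_stable push_def)
  then have "act k (act q []) = act (inv p) []" using c by (simp add: k_def act_mult)
  then have "act q [] = act (inv k) (act (inv p) [])" using c k act_inv(1)[of k "act q []"] by simp
  also have "\<dots> = act (inv k \<otimes> inv p \<otimes> inv (inv k)) []" using c k by (simp add: act_mult)
  finally have eq: "act q [] = act (inv k \<otimes> inv p \<otimes> inv (inv k)) []" .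
  have "inv k \<otimes> inv p \<otimes> inv (inv k) \<in> P"
    using F p k by (intro factor_normal[OF F]) (auto simp: factors_def subgroup.m_inv_closed)
  then have "act y (act q []) = act q []" unfolding eq by (rule orbit_fixed(1))
  moreover have "act x (act q []) = act q []" using q by (intro orbit_fixed(2))
  ultimately have "act q [] = []" using c by (intro common_fixed_point) auto
  then show False using q(2) act_stable_root by simp
qed

end

text \<open>
  Stronger than the absence of a direct product decomposition: the two subgroups may intersect
  nontrivially.  A nontrivial abelian group is therefore never indecomposable in this sense, because it is
  the product of itself with itself.
\<close>

definition (in -) indecomposable :: "('a, 'b) monoid_scheme \<Rightarrow> bool"
  where "indecomposable G \<longleftrightarrow> carrier G \<noteq> {\<one>\<^bsub>G\<^esub>} \<and>
    (\<forall>P Q. subgroup P G \<longrightarrow> subgroup Q G \<longrightarrow> (\<forall>p\<in>P. \<forall>q\<in>Q. p \<otimes>\<^bsub>G\<^esub> q = q \<otimes>\<^bsub>G\<^esub> p) \<longrightarrow>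
      (\<forall>g\<in>carrier G. \<exists>p\<in>P. \<exists>q\<in>Q. g = p \<otimes>\<^bsub>G\<^esub> q) \<longrightarrow> P = {\<one>\<^bsub>G\<^esub>} \<or> Q = {\<one>\<^bsub>G\<^esub>})"

text \<open>
  The neighbours of the root given by \<open>t\<close> and by its inverse lie either both in the \<open>P\<close>-orbit, or both in the
  \<open>Q\<close>-orbit.  That orbit is then everything, and the component of \<open>a\<close> in the other factor is trivial.
\<close>

lemma factors_trivial:
  assumes F: "factors P Q"
  shows "P = {\<one>} \<or> Q = {\<one>}"
proof -
  note F' = factors_sym[OF F]
  obtain x y where xy: "x \<in> P" "y \<in> Q" "\<alpha> 1 = x \<otimes> y"
    using F \<alpha>_closed[of 1] unfolding factors_def by blast
  have "x \<otimes> y = y \<otimes> x" using F xy unfolding factors_def by blast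
  then have yx: "\<alpha> 1 = y \<otimes> x" using xy by simp
  note 1 = F xy and 2 = F' xy(2,1) yx
  have "x = \<one> \<or> y = \<one>"
  proof -
    have nb: "(\<exists>p\<in>P. act (emb (stable e)) [] = act p []) \<or> (\<exists>q\<in>Q. act (emb (stable e)) [] = act q [])" for e
      using neighbour_in_orbit[OF 1, of "emb (stable e)"] act_stable_root[of e] by (simp add: adjacent_def)
    show ?thesis
    proof (cases "\<forall>e. \<exists>p\<in>P. act (emb (stable e)) [] = act p []")
      case True
      then show ?thesis using y_trivial[OF 1] by blast
    next
      case False
      then obtain e where e: "\<not> (\<exists>p\<in>P. act (emb (stable e)) [] = act p [])" by blast
      then obtain q where q: "q \<in> Q" "act (emb (stable e)) [] = act q []" using nb by blast
      have "\<not> (\<exists>p\<in>P. act (emb (stable (\<not> e))) [] = act p [])"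
        using mixed_neighbours_impossible[OF 2 q] by blast
      then have not_e: "\<exists>q\<in>Q. act (emb (stable (\<not> e))) [] = act q []" using nb by blast
      have "\<exists>q\<in>Q. act (emb (stable e')) [] = act q []" for e'
        using q not_e by (cases "e' = e") auto
      then show ?thesis using y_trivial[OF 2] by blast
    qed
  qed
  then show ?thesis using trivial_if_x_trivial[OF 1] trivial_if_x_trivial[OF 2] by blast
qed

lemma \<alpha>_1_nontrivial: "\<alpha> 1 \<noteq> \<one>"
proof
  assume "\<alpha> 1 = \<one>"
  then have "sh 1 [(True, 0)] = [(True, 0)]" using act_\<alpha>[of "[(True, 0)]" 1] by simp
  then show False using shift_1_fixes_only_root[of "[(True, 0)]"] by simp
qed

lemma indecomposable: "indecomposable G"
  unfolding indecomposable_def using factors_trivial \<alpha>_1_nontrivial \<alpha>_closed[of 1]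
  unfolding factors_def by blast

end

section \<open>Recovering the parameters from the topological group\<close>

lemma card_image_eq_if_same_kernel:
  assumes "\<And>s t. s \<in> S \<Longrightarrow> t \<in> S \<Longrightarrow> f s = f t \<longleftrightarrow> g s = g t"
  shows "card (f ` S) = card (g ` S)"
proof (rule bij_betw_same_card)
  show "bij_betw (\<lambda>y. g (inv_into S f y)) (f ` S) (g ` S)"
  proof (rule bij_betw_imageI)
    have inv: "inv_into S f (f s) \<in> S" "f (inv_into S f (f s)) = f s" if "s \<in> S" for s
      using that by (auto simp: inv_into_into f_inv_into_f)
    show "inj_on (\<lambda>y. g (inv_into S f y)) (f ` S)"
    proof (rule inj_onI)
      fix y z assume "y \<in> f ` S" "z \<in> f ` S" and eq: "g (inv_into S f y) = g (inv_into S f z)"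
      then obtain s t where st: "s \<in> S" "y = f s" "t \<in> S" "z = f t" by blast
      then have "f (inv_into S f y) = f (inv_into S f z)"
        using assms[OF inv(1)[OF st(1)] inv(1)[OF st(3)]] eq by simp
      then show "y = z" using inv(2) st by simp
    qed
    have "g (inv_into S f (f s)) = g s" if "s \<in> S" for s
      using assms[OF inv(1)[OF that] that] inv(2)[OF that] by simp
    then show "(\<lambda>y. g (inv_into S f y)) ` f ` S = g ` S" by (auto simp: image_image)
  qed
qed

context bs_tree
begin

lemma period_shift: "period m n (sh j x) = period m n x"
proof -
  have "range (\<lambda>i. sh i (sh j x)) = range (\<lambda>i. sh i x)"
  proof
    show "range (\<lambda>i. sh i (sh j x)) \<subseteq> range (\<lambda>i. sh i x)" by (auto simp: shift_shift)
    show "range (\<lambda>i. sh i x) \<subseteq> range (\<lambda>i. sh i (sh j x))"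
    proof
      fix y assume "y \<in> range (\<lambda>i. sh i x)"
      then obtain i where "y = sh i x" by blast
      then have "y = sh (i - j) (sh j x)" by (simp add: shift_shift)
      then show "y \<in> range (\<lambda>i. sh i (sh j x))" by blast
    qed
  qed
  then show ?thesis by (simp add: period_def)
qed

lemma ratio_ge_1: "real_of_int n / \<bar>m\<bar> \<ge> 1"
proof -
  have "real_of_int \<bar>m\<bar> \<le> real_of_int n" using m_le_n by (simp only: of_int_le_iff)
  then show ?thesis using m_nonzero by (simp add: le_divide_eq)
qed

lemma ratio_gt_1:
  assumes "\<bar>m\<bar> < n" shows "real_of_int n / \<bar>m\<bar> > 1"
proof -
  have "real_of_int \<bar>m\<bar> < real_of_int n" using assms by (simp only: of_int_less_iff)
  then show ?thesis using m_nonzero by (simp add: less_divide_eq)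
qed

lemma finite_ball: "finite {x \<in> V. length x \<le> l}"
proof (rule finite_subset)
  have digit: "r \<in> {- n..n}" if "r mod M e = r" for e r
    using that abs_mod_less[OF M_nonzero, of r e] m_le_n n_pos by (auto simp: modulus_def split: if_splits)
  have "set x \<subseteq> UNIV \<times> {- n..n}" if "reduced m n x" for x
    using that
  proof (induction x)
    case (Cons p x)
    obtain e r where p: "p = (e, r)" by force
    have "r \<in> {- n..n}" using Cons.prems by (intro digit[of r e]) (simp add: p)
    then show ?case using Cons by (simp add: p)
  qed simp
  then show "{x \<in> V. length x \<le> l} \<subseteq> {x. set x \<subseteq> UNIV \<times> {- n..n} \<and> length x \<le> l}"
    by (auto simp: vertices_def)
  show "finite {x. set x \<subseteq> (UNIV :: bool set) \<times> {- n..n} \<and> length x \<le> l}"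
    by (intro finite_lists_length_le) simp
qed

end

context bs_completion
begin

lemma K_orbit:
  assumes "x \<in> V"
  shows "(\<lambda>k. act k x) ` K = range (\<lambda>j. sh j x)"
proof
  show "(\<lambda>k. act k x) ` K \<subseteq> range (\<lambda>j. sh j x)"
  proof
    fix y assume "y \<in> (\<lambda>k. act k x) ` K"
    then obtain k where k: "k \<in> K" "y = act k x" by blast
    obtain j where "\<And>z. z \<in> {x} \<Longrightarrow> act k z = sh j z"
      by (rule K_approx[of k "{x}"]) (use assms k in auto)
    then show "y \<in> range (\<lambda>j. sh j x)" using k by simp
  qed
  show "range (\<lambda>j. sh j x) \<subseteq> (\<lambda>k. act k x) ` K"
    using \<alpha>_in_K act_\<alpha>[OF assms] by (auto intro: image_eqI[OF _ \<alpha>_in_K])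
qed

lemma subgroup_stabilizer:
  assumes x: "x \<in> V"
  shows "subgroup {g \<in> carrier G. act g x = x} G"
proof (rule subgroupI)
  fix g assume g: "g \<in> {g \<in> carrier G. act g x = x}"
  then show "inv g \<in> {g \<in> carrier G. act g x = x}" using act_inv(1)[of g x] x by simp
  fix h assume "h \<in> {g \<in> carrier G. act g x = x}"
  then show "g \<otimes> h \<in> {g \<in> carrier G. act g x = x}" using g x by (simp add: act_mult)
qed (use x act_one in auto)

lemma subgroup_K: "subgroup K G"
  unfolding K_def by (rule subgroup_stabilizer) simp

lemma decompose:
  assumes g: "g \<in> carrier G"
  obtains b k where "b \<in> carrier B" "k \<in> K" "g = emb b \<otimes> k"
proof -
  obtain b where b: "b \<in> carrier B" "act (emb b) [] = act g []"
    using transitive[of "act g []"] g by auto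
  have "act (inv (emb b) \<otimes> g) [] = []"
    using b g act_inv(1)[of "emb b" "[]"] by (simp add: act_mult)
  then have "inv (emb b) \<otimes> g \<in> K" using b g by (simp add: K_def)
  moreover have "g = emb b \<otimes> (inv (emb b) \<otimes> g)" using b g by (simp add: m_assoc[symmetric])
  ultimately show ?thesis using that b by blast
qed

lemma emb_inv: "b \<in> carrier B \<Longrightarrow> inv (emb b) = emb (inv\<^bsub>B\<^esub> b)"
  using group_hom.hom_inv[of B G emb b] emb_hom group_axioms BS.group_axioms
  by (simp add: group_hom_def group_hom_axioms_def)

text \<open>
  The values of \<open>(n / \<bar>m\<bar>)\<close> to the height are those of the modular function of the completion: the two
  periods are the indices of \<open>K \<inter> g K inv g\<close> in \<open>K\<close> and in \<open>g K inv g\<close>.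
\<close>

lemma period_ratio_act:
  assumes g: "g \<in> carrier G"
  shows "real (period m n (act g [])) =
    (n / \<bar>m\<bar>) powi height (act g []) * real (period m n (act (inv g) []))"
proof -
  obtain b k where bk: "b \<in> carrier B" "k \<in> K" "g = emb b \<otimes> k" using decompose[OF g] .
  have kc: "k \<in> carrier G" and ik: "inv k \<in> K"
    using bk subgroup.m_inv_closed[OF subgroup_K] K_closed by auto
  have "act g [] = bs_act b []" using bk kc K_root by (simp add: act_mult act_emb)
  moreover have "act (inv g) [] = act (inv k) (bs_act (inv\<^bsub>B\<^esub> b) [])"
    using bk kc by (simp add: inv_mult_group act_mult emb_inv act_emb)
  moreover obtain j where "\<And>z. z \<in> {bs_act (inv\<^bsub>B\<^esub> b) []} \<Longrightarrow> act (inv k) z = sh j z"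
    by (rule K_approx[OF ik, of "{bs_act (inv\<^bsub>B\<^esub> b) []}"]) auto
  ultimately show ?thesis using period_ratio[OF bk(1)] by (simp add: period_shift)
qed

text \<open>
  Balls around the root are finite and invariant under \<open>K\<close>, so on a ball one exponent \<open>j\<close> serves for all
  powers of \<open>k\<close> at once.
\<close>

lemma K_power_approx:
  assumes k: "k \<in> K"
  obtains j where "\<And>(e :: int) x. x \<in> V \<Longrightarrow> length x \<le> l \<Longrightarrow> act (k [^] e) x = sh (e * j) x"
proof -
  have kc: "k \<in> carrier G" using k by (rule K_closed)
  obtain j where j: "\<And>x. x \<in> {x \<in> V. length x \<le> l} \<Longrightarrow> act k x = sh j x"
    by (rule K_approx[OF k finite_ball[of l]]) auto
  have inv: "act (inv k) x = sh (- j) x" if "x \<in> V" "length x \<le> l" for x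
  proof -
    have "act k (sh (- j) x) = x" using j[of "sh (- j) x"] that by (simp add: shift_in_vertices shift_shift shift_0)
    then show ?thesis using act_inv(1)[OF kc, of "sh (- j) x"] that by (simp add: shift_in_vertices)
  qed
  have "act (k [^] e) x = sh (e * j) x" if "x \<in> V" "length x \<le> l" for e :: int and x
    using that
  proof (induction e arbitrary: x rule: int_induct[of _ 0])
    case base
    then show ?case by (simp add: shift_0)
  next
    case (step1 e)
    have "act (k [^] (e + 1)) x = act (k [^] e) (act k x)"
      using kc step1 by (simp add: int_pow_mult act_mult)
    also have "\<dots> = sh (e * j) (sh j x)"
      using step1 j[of x] by (simp add: shift_in_vertices)
    finally show ?case by (simp add: shift_shift algebra_simps)
  next
    case (step2 e)
    have "act (k [^] (e - 1)) x = act (k [^] e) (act (inv k) x)"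
      using kc step2 by (simp add: int_pow_diff act_mult)
    also have "\<dots> = sh (e * j) (sh (- j) x)"
      using step2 inv[of x] by (simp add: shift_in_vertices)
    finally show ?case by (simp add: shift_shift algebra_simps)
  qed
  then show ?thesis using that by blast
qed

lemma K_commute:
  assumes k: "k \<in> K" and c: "c \<in> K"
  shows "k \<otimes> c = c \<otimes> k"
proof (rule faithful)
  note closed = K_closed[OF k] K_closed[OF c]
  show "k \<otimes> c \<in> carrier G" "c \<otimes> k \<in> carrier G" using closed by auto
  fix x assume x: "x \<in> V"
  obtain i where i: "\<And>y. y \<in> {y \<in> V. length y \<le> length x} \<Longrightarrow> act k y = sh i y"
    by (rule K_approx[OF k finite_ball[of "length x"]]) auto
  obtain j where j: "\<And>y. y \<in> {y \<in> V. length y \<le> length x} \<Longrightarrow> act c y = sh j y"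
    by (rule K_approx[OF c finite_ball[of "length x"]]) auto
  show "act (k \<otimes> c) x = act (c \<otimes> k) x"
    using closed x i[of x] j[of x] i[of "sh j x"] j[of "sh i x"]
    by (simp add: act_mult shift_in_vertices shift_shift add.commute)
qed

text \<open>
  For powers of \<open>a\<close> this is \<open>conjugation_at_height_1\<close>.  It extends to \<open>K\<close> because both sides agree
  vertex by vertex with powers of \<open>a\<close>, and from \<open>BS m n\<close> to the completion because \<open>K\<close> is abelian.
\<close>

lemma conjugation_of_K_at_height_1:
  assumes g: "g \<in> carrier G" and ht: "height (act g []) = 1"
  obtains N where "N \<noteq> 0" and "\<And>c. c \<in> K \<Longrightarrow> c [^] (n * N) \<otimes> g = g \<otimes> c [^] (m * N)"
proof -
  obtain b k where bk: "b \<in> carrier B" "k \<in> K" "g = emb b \<otimes> k" using decompose[OF g] .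
  have kc: "k \<in> carrier G" using bk K_closed by auto
  have "act g [] = bs_act b []" using bk kc K_root by (simp add: act_mult act_emb)
  then obtain N where N: "N \<noteq> 0" "a [^]\<^bsub>B\<^esub> (n * N) \<otimes>\<^bsub>B\<^esub> b = b \<otimes>\<^bsub>B\<^esub> a [^]\<^bsub>B\<^esub> (m * N)"
    using conjugation_at_height_1[OF bk(1)] ht by metis
  have "a [^]\<^bsub>B\<^esub> (n * N) = b \<otimes>\<^bsub>B\<^esub> a [^]\<^bsub>B\<^esub> (m * N) \<otimes>\<^bsub>B\<^esub> inv\<^bsub>B\<^esub> b"
    using N(2) bk(1) BS.inv_solve_right[of "a [^]\<^bsub>B\<^esub> (n * N)" "b \<otimes>\<^bsub>B\<^esub> a [^]\<^bsub>B\<^esub> (m * N)" b] by simp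
  then have "(a [^]\<^bsub>B\<^esub> (n * N)) [^]\<^bsub>B\<^esub> j = b \<otimes>\<^bsub>B\<^esub> (a [^]\<^bsub>B\<^esub> (m * N)) [^]\<^bsub>B\<^esub> j \<otimes>\<^bsub>B\<^esub> inv\<^bsub>B\<^esub> b" for j :: int
    using bk(1) by (simp only: BS.int_pow_conj BS.int_pow_closed a_in_B)
  then have pow: "a [^]\<^bsub>B\<^esub> (n * N * j) = b \<otimes>\<^bsub>B\<^esub> a [^]\<^bsub>B\<^esub> (m * N * j) \<otimes>\<^bsub>B\<^esub> inv\<^bsub>B\<^esub> b" for j
    by (simp only: BS.int_pow_pow a_in_B)
  have conj: "sh (n * N * j) (bs_act b x) = bs_act b (sh (m * N * j) x)" if "x \<in> V" for j x
  proof -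
    have "a [^]\<^bsub>B\<^esub> (n * N * j) \<otimes>\<^bsub>B\<^esub> b = b \<otimes>\<^bsub>B\<^esub> a [^]\<^bsub>B\<^esub> (m * N * j)"
      using bk(1) by (simp add: pow BS.m_assoc)
    then have "bs_act (a [^]\<^bsub>B\<^esub> (n * N * j) \<otimes>\<^bsub>B\<^esub> b) x = bs_act (b \<otimes>\<^bsub>B\<^esub> a [^]\<^bsub>B\<^esub> (m * N * j)) x" by simp
    then show ?thesis using bk(1) that by (simp add: bs_act_mult bs_act_a_power bs_act_in_vertices)
  qed
  have "c [^] (n * N) \<otimes> g = g \<otimes> c [^] (m * N)" if c: "c \<in> K" for c
  proof -
    have cc: "c \<in> carrier G" using c by (rule K_closed)
    have emb: "c [^] (n * N) \<otimes> emb b = emb b \<otimes> c [^] (m * N)"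
    proof (rule faithful)
      fix x assume x: "x \<in> V"
      obtain j where j: "\<And>(e :: int) y. y \<in> V \<Longrightarrow> length y \<le> max (length x) (length (bs_act b x)) \<Longrightarrow>
          act (c [^] e) y = sh (e * j) y"
        using K_power_approx[OF c] by blast
      show "act (c [^] (n * N) \<otimes> emb b) x = act (emb b \<otimes> c [^] (m * N)) x"
        using j[of x "m * N"] j[of "bs_act b x" "n * N"] conj[OF x, of j] x bk(1) cc
        by (simp add: act_mult act_emb bs_act_in_vertices shift_in_vertices)
    qed (use bk(1) cc in auto)
    have "c [^] (m * N) \<in> K"
      using group.int_pow_closed[OF subgroup.subgroup_is_group[OF subgroup_K group_axioms]] c
      by (simp add: int_pow_consistent[OF subgroup_K])
    then have "c [^] (m * N) \<otimes> k = k \<otimes> c [^] (m * N)" using K_commute bk(2) by blast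
    then have "emb b \<otimes> (c [^] (m * N) \<otimes> k) = g \<otimes> c [^] (m * N)"
      using bk kc cc by (simp add: m_assoc)
    moreover have "c [^] (n * N) \<otimes> g = emb b \<otimes> (c [^] (m * N) \<otimes> k)"
      using bk(1) kc cc emb unfolding bk(3) by (metis emb_closed int_pow_closed m_assoc)
    ultimately show ?thesis by simp
  qed
  then show ?thesis using that N(1) by blast
qed

end

locale bs_pair = G: bs_completion m n G T act emb + H: bs_completion p q H T' act' emb'
  for m n :: int and G :: "'g monoid" and T act emb
    and p q :: int and H :: "'h monoid" and T' act' emb' +
  fixes \<phi> :: "'g \<Rightarrow> 'h"
  assumes hom: "\<phi> \<in> hom G H" and continuous: "continuous_map T T' \<phi>"
begin

lemma \<phi>_closed [simp]: "g \<in> carrier G \<Longrightarrow> \<phi> g \<in> carrier H"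
  using hom by (auto simp: hom_def)

lemma group_hom: "group_hom G H \<phi>"
  using hom G.group_axioms H.group_axioms by (simp add: group_hom_def group_hom_axioms_def)

lemma open_eval_image:
  assumes "x \<in> H.V" "y \<in> H.V"
  shows "openin T {g \<in> carrier G. act' (\<phi> g) x = y}"
proof -
  have "openin T {g \<in> topspace T. \<phi> g \<in> {h \<in> carrier H. act' h x = y}}"
    using openin_continuous_map_preimage[OF continuous H.open_eval[OF assms]] .
  moreover have "{g \<in> topspace T. \<phi> g \<in> {h \<in> carrier H. act' h x = y}} = {g \<in> carrier G. act' (\<phi> g) x = y}"
    using G.topspace_T by auto
  ultimately show ?thesis by simp
qed

text \<open>
  By continuity, \<open>\<phi>\<close> maps some positive power of \<open>a\<close> into the stabiliser of the root, and \<open>elliptic\<close> applies.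
\<close>

lemma image_of_a_fixes: "\<exists>y\<in>H.V. act' (\<phi> (G.\<alpha> 1)) y = y"
proof -
  let ?U = "{g \<in> carrier G. act' (\<phi> g) [] = []}"
  have "openin T ?U" by (rule open_eval_image) auto
  moreover have "\<one>\<^bsub>G\<^esub> \<in> ?U" using group_hom.hom_one[OF group_hom] by simp
  ultimately obtain F where F: "finite F" "F \<subseteq> G.V"
    "\<And>h. h \<in> carrier G \<Longrightarrow> (\<forall>x\<in>F. act h x = act \<one>\<^bsub>G\<^esub> x) \<Longrightarrow> h \<in> ?U"
    using G.nbhd[of ?U "\<one>\<^bsub>G\<^esub>"] by blast
  obtain N where N: "N > 0" "\<And>x. x \<in> F \<Longrightarrow> G.sh N x = x" using G.ex_common_shift[OF F(1,2)] by blast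
  have "G.\<alpha> N \<in> ?U"
    using F(2) N by (intro F(3)) (auto simp: G.act_\<alpha> subset_iff)
  then have "act' (\<phi> (G.\<alpha> N)) [] = []" by simp
  moreover have "\<phi> (G.\<alpha> N) = \<phi> (G.\<alpha> 1) [^]\<^bsub>H\<^esub> nat N"
  proof -
    have "G.\<alpha> N = G.\<alpha> 1 [^]\<^bsub>G\<^esub> nat N"
      using G.\<alpha>_int_pow[of N] N(1) int_pow_int[of G "G.\<alpha> 1" "nat N"] by simp
    then show ?thesis using group_hom.hom_nat_pow[OF group_hom] by simp
  qed
  ultimately have "act' (\<phi> (G.\<alpha> 1) [^]\<^bsub>H\<^esub> nat N) [] = []" by simp
  then show ?thesis using H.elliptic[of "\<phi> (G.\<alpha> 1)" "nat N"] N(1) by auto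
qed

text \<open>
  For each \<open>k\<close> in \<open>K\<close> the elements of the group whose image moves \<open>y\<close> to the same vertex as \<open>\<phi> k\<close> form an open
  set, which contains a power of \<open>a\<close>.
\<close>

lemma image_of_K_fixes: "\<exists>y\<in>H.V. \<forall>k\<in>G.K. act' (\<phi> k) y = y"
proof -
  obtain y where y: "y \<in> H.V" "act' (\<phi> (G.\<alpha> 1)) y = y" using image_of_a_fixes by blast
  have powers: "act' (\<phi> (G.\<alpha> j)) y = y" for j
  proof -
    define S where "S = {h \<in> carrier H. act' h y = y}"
    have "subgroup S H" unfolding S_def by (rule H.subgroup_stabilizer[OF y(1)])
    moreover have "\<phi> (G.\<alpha> 1) \<in> S" using y by (simp add: S_def)
    ultimately have "\<phi> (G.\<alpha> 1) [^]\<^bsub>H\<^esub> j \<in> S"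
      using group.int_pow_closed[OF subgroup.subgroup_is_group[OF _ H.group_axioms], of S "\<phi> (G.\<alpha> 1)" j]
      by (simp add: H.int_pow_consistent)
    then show ?thesis
      using group_hom.hom_int_pow[OF group_hom, of "G.\<alpha> 1" j] by (simp add: S_def G.\<alpha>_int_pow)
  qed
  have "act' (\<phi> k) y = y" if k: "k \<in> G.K" for k
  proof -
    have kc: "k \<in> carrier G" using k by (rule G.K_closed)
    let ?U = "{g \<in> carrier G. act' (\<phi> g) y = act' (\<phi> k) y}"
    have "openin T ?U" using y kc by (intro open_eval_image) auto
    moreover have "k \<in> ?U" using kc by simp
    ultimately obtain F where F: "finite F" "F \<subseteq> G.V" "\<And>h. h \<in> carrier G \<Longrightarrow>
        (\<forall>x\<in>F. act h x = act k x) \<Longrightarrow> h \<in> ?U"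
      using G.nbhd[of ?U k] by blast
    obtain j where j: "\<And>x. x \<in> F \<Longrightarrow> act k x = G.sh j x" by (rule G.K_approx[OF k F(1,2)]) blast
    have "G.\<alpha> j \<in> ?U" using j F(2) by (intro F(3)) (auto simp: G.act_\<alpha> subset_iff)
    then show ?thesis using powers by simp
  qed
  then show ?thesis using y(1) by blast
qed

end

text \<open>
  An isomorphism \<open>\<phi>\<close> that matches the two root stabilisers induces an equivariant bijection between the
  vertices.  The invariants of the action are therefore computed from the abstract groups with their root
  stabilisers.
\<close>

locale bs_iso = G: bs_completion m n G T act emb + H: bs_completion p q H T' act' emb'
  for m n :: int and G :: "'g monoid" and T act emb
    and p q :: int and H :: "'h monoid" and T' act' emb' +
  fixes \<phi> :: "'g \<Rightarrow> 'h"
  assumes iso: "\<phi> \<in> iso G H" and K_iff: "\<And>g. g \<in> carrier G \<Longrightarrow> \<phi> g \<in> H.K \<longleftrightarrow> g \<in> G.K"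
begin

lemma group_hom: "group_hom G H \<phi>"
  using iso G.group_axioms H.group_axioms by (simp add: group_hom_def group_hom_axioms_def iso_def)

lemma \<phi>_closed [simp]: "g \<in> carrier G \<Longrightarrow> \<phi> g \<in> carrier H"
  using group_hom.hom_closed[OF group_hom] .

lemma same_vertex_iff:
  assumes "g \<in> carrier G" "h \<in> carrier G"
  shows "act g [] = act h [] \<longleftrightarrow> act' (\<phi> g) [] = act' (\<phi> h) []"
proof -
  have "act g [] = act h [] \<longleftrightarrow> inv\<^bsub>G\<^esub> h \<otimes>\<^bsub>G\<^esub> g \<in> G.K"
    using assms G.act_inv(1)[of h "[]"] G.act_inj[of "inv\<^bsub>G\<^esub> h" "act g []" "act h []"]
    by (simp add: G.K_def G.act_mult)
  moreover have "act' (\<phi> g) [] = act' (\<phi> h) [] \<longleftrightarrow> inv\<^bsub>H\<^esub> (\<phi> h) \<otimes>\<^bsub>H\<^esub> \<phi> g \<in> H.K"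
    using assms H.act_inv(1)[of "\<phi> h" "[]"] H.act_inj[of "inv\<^bsub>H\<^esub> (\<phi> h)" "act' (\<phi> g) []" "act' (\<phi> h) []"]
    by (simp add: H.K_def H.act_mult)
  moreover have "inv\<^bsub>H\<^esub> (\<phi> h) \<otimes>\<^bsub>H\<^esub> \<phi> g = \<phi> (inv\<^bsub>G\<^esub> h \<otimes>\<^bsub>G\<^esub> g)"
    using assms group_hom.hom_inv[OF group_hom] group_hom.hom_mult[OF group_hom] by simp
  ultimately show ?thesis using K_iff[of "inv\<^bsub>G\<^esub> h \<otimes>\<^bsub>G\<^esub> g"] assms by simp
qed

lemma image_K: "\<phi> ` G.K = H.K"
proof
  show "\<phi> ` G.K \<subseteq> H.K" using K_iff G.K_closed by blast
  show "H.K \<subseteq> \<phi> ` G.K"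
  proof
    fix k assume k: "k \<in> H.K"
    then have "k \<in> \<phi> ` carrier G" using iso H.K_closed by (auto simp: iso_def bij_betw_def)
    then show "k \<in> \<phi> ` G.K" using K_iff k by blast
  qed
qed

lemma period_eq:
  assumes g: "g \<in> carrier G"
  shows "period m n (act g []) = period p q (act' (\<phi> g) [])"
proof -
  have "period m n (act g []) = card ((\<lambda>k. act (k \<otimes>\<^bsub>G\<^esub> g) []) ` G.K)"
    unfolding period_def G.K_orbit[OF G.act_in_vertices[OF g Nil_in_vertices], symmetric]
    using g G.K_closed by (intro arg_cong[of _ _ card] image_cong) (simp_all add: G.act_mult)
  also have "\<dots> = card ((\<lambda>k. act' (\<phi> (k \<otimes>\<^bsub>G\<^esub> g)) []) ` G.K)"
    using g G.K_closed by (intro card_image_eq_if_same_kernel same_vertex_iff) auto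
  also have "(\<lambda>k. act' (\<phi> (k \<otimes>\<^bsub>G\<^esub> g)) []) ` G.K = (\<lambda>k. act' k (act' (\<phi> g) [])) ` H.K"
    unfolding image_K[symmetric] image_image using g G.K_closed
    by (intro image_cong) (simp_all add: H.act_mult group_hom.hom_mult[OF group_hom])
  also have "card \<dots> = period p q (act' (\<phi> g) [])"
    unfolding period_def using g by (simp add: H.K_orbit)
  finally show ?thesis .
qed

text \<open>
  The neighbour of the root given by the inverse of \<open>t\<close> has period \<open>\<bar>m\<bar>\<close>; its image is not the root and has
  period at least \<open>\<bar>p\<bar>\<close>.
\<close>

lemma abs_p_le_abs_m: "\<bar>p\<bar> \<le> \<bar>m\<bar>"
proof -
  let ?g = "emb (G.stable False)"
  have "act ?g [] \<noteq> []" by (simp add: G.act_stable_root)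
  then have "?g \<notin> G.K" by (simp add: G.K_def)
  then have "act' (\<phi> ?g) [] \<noteq> []" using K_iff[of ?g] by (simp add: H.K_def)
  then have "nat \<bar>p\<bar> \<le> period p q (act' (\<phi> ?g) [])" by (intro H.period_ge) auto
  also have "\<dots> = nat \<bar>m\<bar>"
    using period_eq[of ?g] by (simp add: G.act_stable_root G.period_down)
  finally show ?thesis by simp
qed

lemma modulus_eq:
  assumes "g \<in> carrier G"
  shows "(n / \<bar>m\<bar>) powi height (act g []) = (q / \<bar>p\<bar>) powi height (act' (\<phi> g) [])"
proof -
  have "inv\<^bsub>H\<^esub> (\<phi> g) = \<phi> (inv\<^bsub>G\<^esub> g)" using assms group_hom.hom_inv[OF group_hom] by simp
  then have "real (period p q (act' (\<phi> g) [])) =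
      (q / \<bar>p\<bar>) powi height (act' (\<phi> g) []) * real (period m n (act (inv\<^bsub>G\<^esub> g) []))"
    using H.period_ratio_act[of "\<phi> g"] period_eq[of "inv\<^bsub>G\<^esub> g"] assms by simp
  moreover have "real (period m n (act g [])) =
      (n / \<bar>m\<bar>) powi height (act g []) * real (period m n (act (inv\<^bsub>G\<^esub> g) []))"
    using assms by (rule G.period_ratio_act)
  moreover have "period m n (act (inv\<^bsub>G\<^esub> g) []) > 0"
    using assms by (intro G.period_pos_and_iff) auto
  ultimately show ?thesis using period_eq[OF assms] by simp
qed

lemma ratio_is_power: "\<exists>i. n / \<bar>m\<bar> = (q / \<bar>p\<bar>) powi i"
  using modulus_eq[of "emb (G.stable True)"] by (auto simp: G.act_stable_root)

end

lemma eq_if_powers_of_each_other: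
  fixes r s :: real
  assumes r: "r \<ge> 1" "r = s powi i" and s: "s \<ge> 1" "s = r powi j"
  shows "r = s"
proof -
  have le: "u \<le> v" if "u \<ge> 1" "u = v powi i" "v \<ge> 1" "v = u powi j" for u v :: real and i j :: int
  proof (cases "j \<ge> 1")
    case True
    have "u powi 1 \<le> u powi j" by (rule power_int_increasing[OF True that(1)])
    then show ?thesis using that(4) by simp
  next
    case False
    have "u powi j \<le> u powi 0" by (rule power_int_increasing[OF _ that(1)]) (use False in simp)
    then have "v = 1" using that(3,4) by simp
    then show ?thesis using that(2) by simp
  qed
  show ?thesis using le[OF r s] le[OF s r] by simp
qed

context bs_iso
begin

lemma bs_iso_inverse: "bs_iso p q H T' act' emb' m n G T act emb (inv_into (carrier G) \<phi>)"
proof -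
  have "inv_into (carrier G) \<phi> h \<in> G.K \<longleftrightarrow> h \<in> H.K" if h: "h \<in> carrier H" for h
  proof -
    have im: "h \<in> \<phi> ` carrier G" using iso h by (auto simp: iso_def bij_betw_def)
    then show ?thesis
      using K_iff[of "inv_into (carrier G) \<phi> h"] by (simp add: inv_into_into f_inv_into_f)
  qed
  then show ?thesis
    using G.bs_completion_axioms H.bs_completion_axioms G.iso_set_sym[OF iso]
    by (simp add: bs_iso_def bs_iso_axioms_def)
qed

lemma same_abs_m: "\<bar>m\<bar> = \<bar>p\<bar>"
  using abs_p_le_abs_m bs_iso.abs_p_le_abs_m[OF bs_iso_inverse] by simp

lemma same_n: "n = q"
proof -
  obtain i where i: "n / \<bar>m\<bar> = (q / \<bar>p\<bar>) powi i" using ratio_is_power by blast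
  obtain j where j: "q / \<bar>p\<bar> = (n / \<bar>m\<bar>) powi j"
    using bs_iso.ratio_is_power[OF bs_iso_inverse] by blast
  have "real_of_int n / \<bar>m\<bar> = q / \<bar>p\<bar>"
    by (rule eq_if_powers_of_each_other[OF G.ratio_ge_1 i H.ratio_ge_1 j])
  then show ?thesis unfolding same_abs_m using H.m_nonzero by simp
qed

text \<open>
  The element \<open>t\<close> has height one, and so has its image because \<open>n / \<bar>m\<bar> > 1\<close>.  If \<open>p = - m\<close>, then conjugation
  by this image sends some power of \<open>\<phi> a\<close> both to the power with exponent \<open>n N\<close> and to the one with
  exponent \<open>- n N\<close>, so that \<open>a\<close> to the power \<open>2 n N\<close> is trivial.
\<close>

lemma same_sign:
  assumes lt: "\<bar>m\<bar> < n"
  shows "m = p"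
proof (rule ccontr)
  assume "m \<noteq> p"
  then have mp: "p = - m" using same_abs_m by linarith
  let ?g = "emb (G.stable True)"
  have gc: "?g \<in> carrier G" by simp
  let ?r = "real_of_int q / \<bar>p\<bar>"
  have r: "?r > 1" using lt by (intro H.ratio_gt_1) (simp add: same_n[symmetric] same_abs_m[symmetric])
  have "?r powi 1 = ?r powi height (act' (\<phi> ?g) [])"
    using modulus_eq[OF gc] unfolding G.act_stable_root same_n[symmetric] same_abs_m[symmetric] by simp
  then have "height (act' (\<phi> ?g) []) = 1"
    using r power_int_strict_increasing[of 1 "height (act' (\<phi> ?g) [])" ?r]
      power_int_strict_increasing[of "height (act' (\<phi> ?g) [])" 1 ?r] by force
  then obtain N where N: "N \<noteq> 0" "\<And>c. c \<in> H.K \<Longrightarrow> c [^]\<^bsub>H\<^esub> (q * N) \<otimes>\<^bsub>H\<^esub> \<phi> ?g = \<phi> ?g \<otimes>\<^bsub>H\<^esub> c [^]\<^bsub>H\<^esub> (p * N)"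
    using H.conjugation_of_K_at_height_1[of "\<phi> ?g"] by auto
  let ?c = "\<phi> (G.\<alpha> 1)"
  have pow: "\<phi> (G.\<alpha> j) = ?c [^]\<^bsub>H\<^esub> j" for j
    using group_hom.hom_int_pow[OF group_hom, of "G.\<alpha> 1" j] by (simp add: G.\<alpha>_int_pow)
  have cK: "?c \<in> H.K" using K_iff G.\<alpha>_in_K by simp
  have cc: "?c \<in> carrier H" by simp
  have "G.\<alpha> (- N * n) \<otimes>\<^bsub>G\<^esub> ?g = ?g \<otimes>\<^bsub>G\<^esub> G.\<alpha> (- N * m)"
    using G.stable_carry[of "- N" True]
    by (simp add: G.\<alpha>_def G.emb_mult[symmetric] modulus_def)
  then have "\<phi> (G.\<alpha> (- N * n) \<otimes>\<^bsub>G\<^esub> ?g) = \<phi> (?g \<otimes>\<^bsub>G\<^esub> G.\<alpha> (- N * m))" by simp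
  then have "?c [^]\<^bsub>H\<^esub> (- N * n) \<otimes>\<^bsub>H\<^esub> \<phi> ?g = \<phi> ?g \<otimes>\<^bsub>H\<^esub> ?c [^]\<^bsub>H\<^esub> (- N * m)"
    by (simp only: group_hom.hom_mult[OF group_hom] G.\<alpha>_closed gc pow[of "- N * n"] pow[of "- N * m"])
  also have "- N * m = p * N" by (simp add: mp)
  also have "\<phi> ?g \<otimes>\<^bsub>H\<^esub> ?c [^]\<^bsub>H\<^esub> (p * N) = ?c [^]\<^bsub>H\<^esub> (q * N) \<otimes>\<^bsub>H\<^esub> \<phi> ?g"
    using N(2)[OF cK] by simp
  finally have "?c [^]\<^bsub>H\<^esub> (- N * n) = ?c [^]\<^bsub>H\<^esub> (q * N)"
    using cc gc by (simp only: H.right_cancel H.int_pow_closed \<phi>_closed)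
  then have "\<phi> (G.\<alpha> (- N * n)) = \<phi> (G.\<alpha> (q * N))" unfolding pow[of "- N * n"] pow[of "q * N"] .
  then have "G.\<alpha> (- N * n) = G.\<alpha> (q * N)"
    using iso by (auto simp: iso_def bij_betw_def dest: inj_onD)
  then have eq: "G.\<alpha> (- N * n) = G.\<alpha> (n * N)" unfolding same_n[symmetric] .
  have "G.sh (2 * n * N) x = x" if x: "x \<in> G.V" for x
  proof -
    have "G.sh (2 * n * N) x = G.sh (n * N) (G.sh (n * N) x)" by (simp add: G.shift_shift algebra_simps)
    also have "G.sh (n * N) x = G.sh (- N * n) x" using x eq G.act_\<alpha>[of x] by metis
    also have "G.sh (n * N) (G.sh (- N * n) x) = x" using x by (simp add: G.shift_shift G.shift_0)
    finally show ?thesis .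
  qed
  then show False using G.shift_faithful[OF lt, of "2 * n * N"] N(1) G.n_pos by auto
qed

end

text \<open>
  Let \<open>\<phi> ` K\<close> fix the vertex \<open>y\<close>, and let \<open>h\<close> move the root to \<open>y\<close>.  Composing \<open>\<phi>\<close> with the conjugation by
  \<open>h\<close> gives an isomorphism \<open>\<phi>'\<close> that maps \<open>K\<close> into the root stabiliser on the other side.  The preimage of
  that stabiliser under \<open>\<phi>'\<close> also fixes a vertex \<open>z\<close> and contains \<open>a\<close>.  Hence \<open>z\<close> is the root and the
  preimage is exactly \<open>K\<close>.
\<close>

lemma parameters_determined:
  assumes "bs_completion m n G T act emb" and "bs_completion p q H T' act' emb'"
    and iso: "\<phi> \<in> iso G H" and cont: "continuous_map T T' \<phi>"
    and cont': "continuous_map T' T (inv_into (carrier G) \<phi>)"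
  shows "\<bar>m\<bar> = \<bar>p\<bar> \<and> n = q \<and> (\<bar>m\<bar> < n \<longrightarrow> m = p)"
proof -
  let ?\<psi> = "inv_into (carrier G) \<phi>"
  interpret G: bs_completion m n G T act emb by fact
  interpret H: bs_completion p q H T' act' emb' by fact
  have psi: "?\<psi> \<in> iso H G" using G.iso_set_sym[OF iso] .
  interpret fwd: bs_pair m n G T act emb p q H T' act' emb' \<phi>
    by unfold_locales (use iso cont in \<open>auto simp: iso_def\<close>)
  interpret bwd: bs_pair p q H T' act' emb' m n G T act emb ?\<psi>
    by unfold_locales (use psi cont' in \<open>auto simp: iso_def\<close>)
  have phi_psi: "\<phi> (?\<psi> h) = h" if "h \<in> carrier H" for h
    using that iso by (intro f_inv_into_f) (auto simp: iso_def bij_betw_def)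
  have psi_phi: "?\<psi> (\<phi> g) = g" if "g \<in> carrier G" for g
    using that iso by (intro inv_into_f_f) (auto simp: iso_def bij_betw_def)
  obtain y where y: "y \<in> H.V" "\<And>k. k \<in> G.K \<Longrightarrow> act' (\<phi> k) y = y" using fwd.image_of_K_fixes by blast
  obtain x where x: "x \<in> G.V" "\<And>k. k \<in> H.K \<Longrightarrow> act (?\<psi> k) x = x" using bwd.image_of_K_fixes by blast
  obtain b where b: "b \<in> carrier H.B" "act' (emb' b) [] = y" using H.transitive[OF y(1)] .
  define h where "h = emb' b"
  have h: "h \<in> carrier H" "act' h [] = y" using b by (auto simp: h_def)
  define \<phi>' where "\<phi>' g = inv\<^bsub>H\<^esub> h \<otimes>\<^bsub>H\<^esub> \<phi> g \<otimes>\<^bsub>H\<^esub> h" for g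
  have phi'_closed: "\<phi>' g \<in> carrier H" if "g \<in> carrier G" for g using that h by (simp add: \<phi>'_def)
  have cancel: "h \<otimes>\<^bsub>H\<^esub> (inv\<^bsub>H\<^esub> h \<otimes>\<^bsub>H\<^esub> z) = z" "inv\<^bsub>H\<^esub> h \<otimes>\<^bsub>H\<^esub> (h \<otimes>\<^bsub>H\<^esub> z) = z" if "z \<in> carrier H" for z
    using that h by (simp_all add: H.m_assoc[symmetric])
  have undo: "\<phi> g = h \<otimes>\<^bsub>H\<^esub> \<phi>' g \<otimes>\<^bsub>H\<^esub> inv\<^bsub>H\<^esub> h" if "g \<in> carrier G" for g
    using that h cancel by (simp add: \<phi>'_def H.m_assoc)
  have iso': "\<phi>' \<in> iso G H"
  proof (rule isoI)
    show "\<phi>' \<in> hom G H"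
    proof (rule homI)
      fix g g' assume g: "g \<in> carrier G" "g' \<in> carrier G"
      show "\<phi>' (g \<otimes>\<^bsub>G\<^esub> g') = \<phi>' g \<otimes>\<^bsub>H\<^esub> \<phi>' g'"
        using g h cancel by (simp add: \<phi>'_def H.m_assoc group_hom.hom_mult[OF fwd.group_hom])
    qed (rule phi'_closed)
    show "bij_betw \<phi>' (carrier G) (carrier H)"
    proof (rule bij_betw_byWitness[where f' = "\<lambda>k. ?\<psi> (h \<otimes>\<^bsub>H\<^esub> k \<otimes>\<^bsub>H\<^esub> inv\<^bsub>H\<^esub> h)"])
      show "\<forall>g\<in>carrier G. ?\<psi> (h \<otimes>\<^bsub>H\<^esub> \<phi>' g \<otimes>\<^bsub>H\<^esub> inv\<^bsub>H\<^esub> h) = g"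
        using undo psi_phi by simp
      show "\<forall>k\<in>carrier H. \<phi>' (?\<psi> (h \<otimes>\<^bsub>H\<^esub> k \<otimes>\<^bsub>H\<^esub> inv\<^bsub>H\<^esub> h)) = k"
        using h cancel by (simp add: \<phi>'_def phi_psi H.m_assoc)
    qed (use phi'_closed h bwd.\<phi>_closed in auto)
  qed
  have "\<phi>' g \<in> H.K \<longleftrightarrow> g \<in> G.K" if g: "g \<in> carrier G" for g
  proof
    assume "g \<in> G.K"
    then have "act' (\<phi>' g) [] = []"
      using g h y H.act_inv(1)[of h "[]"] by (simp add: \<phi>'_def H.act_mult)
    then show "\<phi>' g \<in> H.K" using phi'_closed[OF g] by (simp add: H.K_def)
  next
    let ?z = "act (?\<psi> h) x"
    have z: "?z \<in> G.V" using h x(1) bwd.\<phi>_closed by simp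
    have fixed: "act k ?z = ?z" if k: "k \<in> carrier G" "\<phi>' k \<in> H.K" for k
    proof -
      have "\<phi> k \<otimes>\<^bsub>H\<^esub> h = h \<otimes>\<^bsub>H\<^esub> \<phi>' k"
        using k h cancel by (simp add: \<phi>'_def H.m_assoc)
      then have "?\<psi> (\<phi> k \<otimes>\<^bsub>H\<^esub> h) = ?\<psi> (h \<otimes>\<^bsub>H\<^esub> \<phi>' k)" by simp
      then have eq: "k \<otimes>\<^bsub>G\<^esub> ?\<psi> h = ?\<psi> h \<otimes>\<^bsub>G\<^esub> ?\<psi> (\<phi>' k)"
        using k h phi'_closed[OF k(1)] by (simp add: group_hom.hom_mult[OF bwd.group_hom] psi_phi)
      have "act k ?z = act (k \<otimes>\<^bsub>G\<^esub> ?\<psi> h) x" using k h x(1) by (simp add: G.act_mult bwd.\<phi>_closed)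
      also have "\<dots> = act (?\<psi> h) (act (?\<psi> (\<phi>' k)) x)"
        unfolding eq using h x(1) phi'_closed[OF k(1)] by (simp add: G.act_mult bwd.\<phi>_closed)
      finally show ?thesis using x(2)[OF k(2)] by simp
    qed
    have "\<phi>' (G.\<alpha> 1) \<in> H.K"
      using h y(1) y(2)[OF G.\<alpha>_in_K] H.act_inv(1)[of h "[]"] phi'_closed[of "G.\<alpha> 1"]
      by (simp add: H.K_def \<phi>'_def H.act_mult)
    then have "G.sh 1 ?z = ?z" using fixed[of "G.\<alpha> 1"] z by (simp add: G.act_\<alpha>)
    then have "?z = []" using G.shift_1_fixes_only_root[OF z] by simp
    moreover assume "\<phi>' g \<in> H.K"
    ultimately show "g \<in> G.K" using fixed[OF g] g by (simp add: G.K_def)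
  qed
  then interpret bs_iso m n G T act emb p q H T' act' emb' \<phi>'
    by unfold_locales (use iso' in auto)
  show ?thesis using same_abs_m same_n same_sign by blast
qed

section \<open>The relative profinite completion as a permutation group\<close>

lemma openin_perm_topology_agree:
  assumes "finite F" "F \<subseteq> X" "f \<in> Bij X"
  shows "openin (perm_topology X) {h \<in> Bij X. \<forall>x\<in>F. h x = f x}"
  using assms(1,2)
proof (induction F)
  case empty
  then show ?case using openin_topspace[of "perm_topology X"] by (simp add: topspace_perm_topology)
next
  case (insert x F)
  have fx: "f x \<in> X" using insert.prems assms(3) Bij_imp_funcset by fastforce
  let ?P = "product_topology (\<lambda>_. discrete_topology X) X"
  have "continuous_map ?P (discrete_topology X) (\<lambda>h. h x)"
    using insert.prems by (intro continuous_map_product_projection) auto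
  then have "openin ?P {h \<in> topspace ?P. h x \<in> {f x}}"
    by (rule openin_continuous_map_preimage) (simp add: fx)
  then have "openin (perm_topology X) ({h \<in> topspace ?P. h x \<in> {f x}} \<inter> Bij X)"
    unfolding perm_topology_def by (auto simp: openin_subtopology)
  also have "{h \<in> topspace ?P. h x \<in> {f x}} \<inter> Bij X = {h \<in> Bij X. h x = f x}"
    by (auto simp: Bij_def PiE_def dest: bij_betwE)
  finally have "openin (perm_topology X) ({h \<in> Bij X. h x = f x} \<inter> {h \<in> Bij X. \<forall>x\<in>F. h x = f x})"
    using insert by (intro openin_Int) auto
  also have "{h \<in> Bij X. h x = f x} \<inter> {h \<in> Bij X. \<forall>x\<in>F. h x = f x} = {h \<in> Bij X. \<forall>x\<in>insert x F. h x = f x}"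
    by auto
  finally show ?case .
qed

lemma perm_topology_nbhd:
  assumes "openin (perm_topology X) U" "f \<in> U"
  obtains F where "finite F" "F \<subseteq> X" "\<And>h. h \<in> Bij X \<Longrightarrow> (\<forall>x\<in>F. h x = f x) \<Longrightarrow> h \<in> U"
proof -
  obtain S where S: "openin (product_topology (\<lambda>_. discrete_topology X) X) S" "U = S \<inter> Bij X"
    using assms(1) unfolding perm_topology_def openin_subtopology by blast
  then obtain W where W: "finite {x \<in> X. W x \<noteq> X}" "f \<in> PiE X W" "PiE X W \<subseteq> S"
    using assms(2) unfolding openin_product_topology_alt by auto
  show ?thesis
  proof
    fix h assume h: "h \<in> Bij X" "\<forall>x\<in>{x \<in> X. W x \<noteq> X}. h x = f x"
    have "h x \<in> W x" if "x \<in> X" for x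
    proof (cases "W x = X")
      case True
      then show ?thesis using h(1) that Bij_imp_funcset by fastforce
    next
      case False
      then show ?thesis using h(2) that W(2) by (auto simp: PiE_iff)
    qed
    then have "h \<in> PiE X W" using h(1) by (auto simp: PiE_iff Bij_def)
    then show "h \<in> U" using W(3) S(2) h(1) by blast
  qed (use W(1) in auto)
qed

text \<open>
  The sets of permutations with prescribed values on finitely many cosets form a basis of the topology, and
  the closure is tested on a basis.
\<close>

lemma rel_profinite_carrier_iff:
  assumes "group G" "subgroup H G"
  shows "f \<in> rel_profinite_carrier G H \<longleftrightarrow> f \<in> Bij (lcosets\<^bsub>G\<^esub> H) \<and>
    (\<forall>F. finite F \<longrightarrow> F \<subseteq> lcosets\<^bsub>G\<^esub> H \<longrightarrow> (\<exists>g\<in>carrier G. \<forall>C\<in>F. f C = g <#\<^bsub>G\<^esub> C))"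
    (is "?L \<longleftrightarrow> ?R")
proof
  let ?X = "lcosets\<^bsub>G\<^esub> H"
  assume L: ?L
  then have f: "f \<in> Bij ?X"
    unfolding rel_profinite_carrier_def in_closure_of topspace_perm_topology by blast
  have "\<exists>g\<in>carrier G. \<forall>C\<in>F. f C = g <#\<^bsub>G\<^esub> C" if F: "finite F" "F \<subseteq> ?X" for F
  proof -
    let ?U = "{h \<in> Bij ?X. \<forall>x\<in>F. h x = f x}"
    have "f \<in> ?U \<and> openin (perm_topology ?X) ?U" using f openin_perm_topology_agree[OF F f] by simp
    then have "\<exists>y. y \<in> coset_action G H ` carrier G \<and> y \<in> ?U"
      by (rule mp[OF spec[OF conjunct2[OF L[unfolded rel_profinite_carrier_def in_closure_of]], of ?U]])
    then obtain g where g: "g \<in> carrier G" "\<forall>C\<in>F. coset_action G H g C = f C" by blast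
    have "f C = g <#\<^bsub>G\<^esub> C" if "C \<in> F" for C
      using bspec[OF g(2) that] subsetD[OF F(2) that] by (simp add: coset_action_def)
    then show ?thesis using g(1) by blast
  qed
  then show ?R using f by blast
next
  let ?X = "lcosets\<^bsub>G\<^esub> H"
  assume R: ?R
  have "\<exists>y. y \<in> coset_action G H ` carrier G \<and> y \<in> U" if U: "f \<in> U \<and> openin (perm_topology ?X) U" for U
  proof -
    obtain F where F: "finite F" "F \<subseteq> ?X" "\<And>h. h \<in> Bij ?X \<Longrightarrow> (\<forall>x\<in>F. h x = f x) \<Longrightarrow> h \<in> U"
      by (rule perm_topology_nbhd[OF conjunct2[OF U] conjunct1[OF U]]) blast
    obtain g where g: "g \<in> carrier G" "\<forall>C\<in>F. f C = g <#\<^bsub>G\<^esub> C" using R F by blast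
    have "coset_action G H g \<in> U"
      using g F(2) by (intro F(3) coset_action_in_Bij assms) (auto simp: coset_action_def)
    then show ?thesis using g(1) by blast
  qed
  moreover have "f \<in> topspace (perm_topology ?X)" using R by (simp add: topspace_perm_topology)
  ultimately show ?L unfolding rel_profinite_carrier_def in_closure_of by (intro conjI allI impI)
qed

lemma subgroup_rel_profinite_carrier:
  assumes "group G" "subgroup H G"
  shows "subgroup (rel_profinite_carrier G H) (BijGroup (lcosets\<^bsub>G\<^esub> H))"
proof -
  interpret group G by fact
  let ?X = "lcosets\<^bsub>G\<^esub> H" and ?C = "rel_profinite_carrier G H"
  note iff = rel_profinite_carrier_iff[OF assms]
  have sub: "C \<subseteq> carrier G" if "C \<in> ?X" for C
    using subgroup.lcosets_carrier[OF assms(2,1) that] .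
  have "coset_action G H \<one>\<^bsub>G\<^esub> \<in> ?C"
    unfolding iff using coset_action_in_Bij[OF assms] by (auto simp: coset_action_def intro!: bexI[of _ "\<one>\<^bsub>G\<^esub>"])
  then have ne: "?C \<noteq> {}" by blast
  show ?thesis
  proof (rule group.subgroupI[OF group_BijGroup])
    show "?C \<subseteq> carrier (BijGroup ?X)" using iff by (auto simp: BijGroup_def)
    show "?C \<noteq> {}" by (rule ne)
  next
    fix f assume f: "f \<in> ?C"
    then have fB: "f \<in> Bij ?X" using iff by blast
    have "\<exists>g\<in>carrier G. \<forall>C\<in>F. restrict (inv_into ?X f) ?X C = g <#\<^bsub>G\<^esub> C" if F: "finite F" "F \<subseteq> ?X" for F
    proof -
      have "finite (inv_into ?X f ` F)" "inv_into ?X f ` F \<subseteq> ?X"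
        using F Bij_inv_into_mem[OF fB] by auto
      then obtain g where g: "g \<in> carrier G" "\<forall>C\<in>inv_into ?X f ` F. f C = g <#\<^bsub>G\<^esub> C"
        using f unfolding iff by blast
      have "inv_into ?X f C = inv\<^bsub>G\<^esub> g <#\<^bsub>G\<^esub> C" if C: "C \<in> F" for C
      proof -
        have "C = g <#\<^bsub>G\<^esub> inv_into ?X f C"
          using g(2) C F(2) fB f_inv_into_f[of C f ?X] by (auto simp: Bij_def bij_betw_def)
        moreover have "inv_into ?X f C \<subseteq> carrier G" using sub Bij_inv_into_mem[OF fB] C F(2) by blast
        ultimately show ?thesis
          using g(1) lcos_m_assoc[of "inv_into ?X f C" "inv\<^bsub>G\<^esub> g" g] lcos_mult_one by simp
      qed
      then show ?thesis using g(1) F(2) by (intro bexI[of _ "inv\<^bsub>G\<^esub> g"]) auto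
    qed
    then show "inv\<^bsub>BijGroup ?X\<^esub> f \<in> ?C"
      unfolding inv_BijGroup[OF fB] iff using restrict_inv_into_Bij[OF fB] by blast
  next
    fix f h assume f: "f \<in> ?C" and h: "h \<in> ?C"
    then have B: "f \<in> Bij ?X" "h \<in> Bij ?X" using iff by blast+
    have "\<exists>g\<in>carrier G. \<forall>C\<in>F. compose ?X f h C = g <#\<^bsub>G\<^esub> C" if F: "finite F" "F \<subseteq> ?X" for F
    proof -
      obtain g where g: "g \<in> carrier G" "\<forall>C\<in>F. h C = g <#\<^bsub>G\<^esub> C" using h F unfolding iff by blast
      have "finite (h ` F)" "h ` F \<subseteq> ?X" using F Bij_imp_funcset[OF B(2)] by auto
      then obtain g' where g': "g' \<in> carrier G" "\<forall>C\<in>h ` F. f C = g' <#\<^bsub>G\<^esub> C" using f unfolding iff by blast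
      have "compose ?X f h C = (g' \<otimes>\<^bsub>G\<^esub> g) <#\<^bsub>G\<^esub> C" if "C \<in> F" for C
      proof -
        have C: "C \<in> ?X" using that F(2) by blast
        have "compose ?X f h C = g' <#\<^bsub>G\<^esub> (g <#\<^bsub>G\<^esub> C)" using C that g g' by (simp add: compose_def)
        then show ?thesis using lcos_m_assoc[OF sub[OF C] g'(1) g(1)] by simp
      qed
      then show ?thesis using g(1) g'(1) by blast
    qed
    moreover have "f \<otimes>\<^bsub>BijGroup ?X\<^esub> h = compose ?X f h" using B by (simp add: BijGroup_def)
    ultimately show "f \<otimes>\<^bsub>BijGroup ?X\<^esub> h \<in> ?C" using iff compose_Bij[OF B] by auto
  qed
qed

lemma group_rel_profinite_completion:
  assumes "group G" "subgroup H G"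
  shows "group (fst (rel_profinite_completion G H))"
  using subgroup.subgroup_is_group[OF subgroup_rel_profinite_carrier[OF assms] group_BijGroup]
  by (simp add: rel_profinite_completion_def)

context bs_tree
begin

text \<open>
  The coset belonging to a vertex, described without choosing a representative: the elements that move the
  root to this vertex.
\<close>

definition coset_of :: "(bool \<times> int) list \<Rightarrow> BS_gen word set set"
  where "coset_of x = {g \<in> carrier B. bs_act g [] = x}"

abbreviation "A \<equiv> generate B {a}"
abbreviation "X \<equiv> lcosets\<^bsub>B\<^esub> A"

lemma subgroup_A: "subgroup A B"
  by (rule BS.generate_is_subgroup) simp

lemma A_eq: "A = coset_of []"
proof
  show "A \<subseteq> coset_of []"
    by (auto simp: BS.generate_pow coset_of_def bs_act_a_power)
  show "coset_of [] \<subseteq> A"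
  proof
    fix g assume "g \<in> coset_of []"
    then obtain k :: int where "g = a [^]\<^bsub>B\<^esub> k" using stabilizer_root by (auto simp: coset_of_def)
    then show "g \<in> A" by (auto simp: BS.generate_pow)
  qed
qed

lemma translate_coset_of:
  assumes g: "g \<in> carrier B" and x: "x \<in> V"
  shows "g <#\<^bsub>B\<^esub> coset_of x = coset_of (bs_act g x)"
proof
  show "g <#\<^bsub>B\<^esub> coset_of x \<subseteq> coset_of (bs_act g x)"
    using g by (auto simp: l_coset_def coset_of_def bs_act_mult)
  show "coset_of (bs_act g x) \<subseteq> g <#\<^bsub>B\<^esub> coset_of x"
  proof
    fix k assume k: "k \<in> coset_of (bs_act g x)"
    let ?h = "inv\<^bsub>B\<^esub> g \<otimes>\<^bsub>B\<^esub> k"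
    have "?h \<in> coset_of x" using k g x by (simp add: coset_of_def bs_act_mult bs_act_inv)
    moreover have "k = g \<otimes>\<^bsub>B\<^esub> ?h" using k g by (simp add: coset_of_def BS.m_assoc[symmetric])
    ultimately show "k \<in> g <#\<^bsub>B\<^esub> coset_of x" unfolding l_coset_def by blast
  qed
qed

lemma bij_coset_of: "bij_betw coset_of V X"
proof (rule bij_betw_imageI)
  have rep: "rep x \<in> coset_of x" if "x \<in> V" for x using that by (simp add: coset_of_def bs_act_rep)
  show "inj_on coset_of V"
  proof (rule inj_onI)
    fix x y assume "x \<in> V" "y \<in> V" "coset_of x = coset_of y"
    then have "rep x \<in> coset_of y" using rep by blast
    then show "x = y" using bs_act_rep[OF \<open>x \<in> V\<close>] by (simp add: coset_of_def)
  qed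
  have "coset_of x \<in> X" if "x \<in> V" for x
    using translate_coset_of[of "rep x" "[]"] bs_act_rep[OF that] unfolding A_eq LCOSETS_def by auto
  moreover have "C \<in> coset_of ` V" if "C \<in> X" for C
    using that translate_coset_of[of _ "[]"] bs_act_in_vertices[OF Nil_in_vertices]
    unfolding A_eq LCOSETS_def by auto
  ultimately show "coset_of ` V = X" by blast
qed

text \<open>
  The action of a permutation of cosets on vertices, transported along \<open>coset_of\<close>.
\<close>

definition coset_act :: "(BS_gen word set set \<Rightarrow> BS_gen word set set) \<Rightarrow> (bool \<times> int) list \<Rightarrow> (bool \<times> int) list"
  where "coset_act f x = inv_into V coset_of (f (coset_of x))"

abbreviation "C \<equiv> rel_profinite_carrier B A"

lemma C_iff: "f \<in> C \<longleftrightarrow> f \<in> Bij X \<and>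
    (\<forall>F. finite F \<longrightarrow> F \<subseteq> X \<longrightarrow> (\<exists>g\<in>carrier B. \<forall>D\<in>F. f D = g <#\<^bsub>B\<^esub> D))"
  by (rule rel_profinite_carrier_iff[OF BS.group_axioms subgroup_A])

lemma C_Bij: "f \<in> C \<Longrightarrow> f \<in> Bij X"
  using C_iff by blast

lemma coset_of_in_X: "x \<in> V \<Longrightarrow> coset_of x \<in> X"
  using bij_coset_of bij_betwE by blast

lemma coset_act_vertex:
  assumes "f \<in> C" "x \<in> V"
  shows "coset_act f x \<in> V" and "coset_of (coset_act f x) = f (coset_of x)"
proof -
  have "f (coset_of x) \<in> X"
    using Bij_imp_funcset[OF C_Bij[OF assms(1)]] coset_of_in_X[OF assms(2)] by blast
  then have "f (coset_of x) \<in> coset_of ` V" using bij_coset_of by (simp add: bij_betw_def)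
  then show "coset_act f x \<in> V" "coset_of (coset_act f x) = f (coset_of x)"
    by (simp_all add: coset_act_def inv_into_into f_inv_into_f)
qed

lemma coset_act_eq_iff:
  assumes "f \<in> C" "x \<in> V" "y \<in> V"
  shows "coset_act f x = y \<longleftrightarrow> f (coset_of x) = coset_of y"
  using coset_act_vertex[OF assms(1,2)] assms(3) bij_coset_of by (auto simp: bij_betw_def inj_on_eq_iff[of coset_of V])

lemma coset_action_in_C: "b \<in> carrier B \<Longrightarrow> coset_action B A b \<in> C"
  unfolding C_iff using coset_action_in_Bij[OF BS.group_axioms subgroup_A]
  by (auto simp: coset_action_def intro!: bexI[of _ b])

lemma fst_BS_completion: "fst (BS_completion m n) = (BijGroup X)\<lparr>carrier := C\<rparr>"
  and snd_BS_completion: "snd (BS_completion m n) = subtopology (perm_topology X) C"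
  by (simp_all add: BS_completion_def rel_profinite_completion_def)

lemma BS_completion_is_bs_completion: "bs_completion m n (fst (BS_completion m n)) (snd (BS_completion m n)) coset_act (coset_action B A)"
proof -
  let ?G = "fst (BS_completion m n)"
  have carrier: "carrier ?G = C" by (simp add: fst_BS_completion)
  have mult: "f \<otimes>\<^bsub>?G\<^esub> h = compose X f h" if "f \<in> C" "h \<in> C" for f h
    using that C_Bij by (simp add: fst_BS_completion BijGroup_def)
  have grp: "group ?G"
    unfolding BS_completion_def by (rule group_rel_profinite_completion[OF BS.group_axioms subgroup_A])
  have tops: "topspace (snd (BS_completion m n)) = C"
    using topspace_rel_profinite_completion[of B A] carrier by (simp add: BS_completion_def)
  have mult_closed: "compose X f h \<in> C" if "f \<in> C" "h \<in> C" for f h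
    using monoid.m_closed[OF group.is_monoid[OF grp], of f h] that mult carrier by simp
  show ?thesis
  proof (intro bs_completion.intro bs_completion_axioms.intro grp bs_tree_axioms; (unfold carrier)?)
    fix b x assume b: "b \<in> carrier B" and x: "x \<in> V"
    have "coset_action B A b (coset_of x) = coset_of (bs_act b x)"
      using b x by (simp add: coset_action_def coset_of_in_X translate_coset_of)
    then show "coset_act (coset_action B A b) x = bs_act b x"
      using coset_act_eq_iff[OF coset_action_in_C[OF b] x bs_act_in_vertices[OF x]] by simp
  next
    fix f h x assume fh: "f \<in> C" "h \<in> C" and x: "x \<in> V"
    show "coset_act (f \<otimes>\<^bsub>?G\<^esub> h) x = coset_act f (coset_act h x)"
      unfolding mult[OF fh] coset_act_eq_iff[OF mult_closed[OF fh] x coset_act_vertex(1)[OF fh(1) coset_act_vertex(1)[OF fh(2) x]]]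
      using coset_act_vertex(2)[OF fh(2) x] coset_act_vertex(2)[OF fh(1) coset_act_vertex(1)[OF fh(2) x]] coset_of_in_X[OF x]
      by (simp add: compose_def)
  next
    fix f h assume fh: "f \<in> C" "h \<in> C" and eq: "\<And>x. x \<in> V \<Longrightarrow> coset_act f x = coset_act h x"
    have "f D = h D" if D: "D \<in> X" for D
    proof -
      obtain x where x: "x \<in> V" "D = coset_of x" using D bij_coset_of by (auto simp: bij_betw_def)
      then show ?thesis using coset_act_vertex(2)[OF fh(1) x(1)] coset_act_vertex(2)[OF fh(2) x(1)] eq[OF x(1)] by simp
    qed
    then show "f = h" using C_Bij[OF fh(1)] C_Bij[OF fh(2)] by (intro extensionalityI) (auto simp: Bij_def)
  next
    fix f F assume f: "f \<in> C" and F: "finite F" "F \<subseteq> V"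
    then have "finite (coset_of ` F)" "coset_of ` F \<subseteq> X" using coset_of_in_X by auto
    then obtain g where g: "g \<in> carrier B" "\<forall>D\<in>coset_of ` F. f D = g <#\<^bsub>B\<^esub> D" using f unfolding C_iff by blast
    then have "\<forall>x\<in>F. coset_act f x = bs_act g x"
      using F(2) f by (auto simp: coset_act_eq_iff bs_act_in_vertices translate_coset_of subset_iff)
    then show "\<exists>b\<in>carrier B. \<forall>x\<in>F. coset_act f x = bs_act b x" using g(1) by blast
  next
    fix x y assume xy: "x \<in> V" "y \<in> V"
    show "openin (snd (BS_completion m n)) {f \<in> C. coset_act f x = y}"
    proof (cases "\<exists>f\<in>C. coset_act f x = y")
      case True
      then obtain f where f: "f \<in> C" "coset_act f x = y" by blast
      have "openin (perm_topology X) {h \<in> Bij X. \<forall>D\<in>{coset_of x}. h D = f D}"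
        using coset_of_in_X[OF xy(1)] by (intro openin_perm_topology_agree C_Bij f) auto
      moreover have agree: "coset_act h x = y \<longleftrightarrow> (\<forall>D\<in>{coset_of x}. h D = f D)" if "h \<in> C" for h
        using coset_act_eq_iff[OF that xy] coset_act_eq_iff[OF f(1) xy] f(2) by simp
      moreover have "{h \<in> C. coset_act h x = y} = {h \<in> Bij X. \<forall>D\<in>{coset_of x}. h D = f D} \<inter> C"
        using agree C_Bij by blast
      ultimately show ?thesis unfolding snd_BS_completion openin_subtopology by blast
    next
      case False
      then have "{f \<in> C. coset_act f x = y} = {}" by blast
      then show ?thesis by (simp only: openin_empty)
    qed
  next
    fix U f assume U: "openin (snd (BS_completion m n)) U" and f: "f \<in> U"
    then obtain S where S: "openin (perm_topology X) S" "U = S \<inter> C"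
      unfolding snd_BS_completion openin_subtopology by blast
    obtain F where F: "finite F" "F \<subseteq> X" "\<And>h. h \<in> Bij X \<Longrightarrow> (\<forall>D\<in>F. h D = f D) \<Longrightarrow> h \<in> S"
      using perm_topology_nbhd[OF S(1), of f] S(2) f by blast
    let ?F = "inv_into V coset_of ` F"
    have inv: "inv_into V coset_of D \<in> V" "coset_of (inv_into V coset_of D) = D" if "D \<in> F" for D
    proof -
      have "D \<in> coset_of ` V" using that F(2) bij_coset_of by (auto simp: bij_betw_def)
      then show "inv_into V coset_of D \<in> V" "coset_of (inv_into V coset_of D) = D"
        by (simp_all add: inv_into_into f_inv_into_f)
    qed
    have "h \<in> U" if h: "h \<in> C" "\<forall>x\<in>?F. coset_act h x = coset_act f x" for h
    proof -
      have fC: "f \<in> C" using f S(2) by blast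
      have "h D = f D" if D: "D \<in> F" for D
        using coset_act_vertex(2)[OF h(1) inv(1)[OF D]] coset_act_vertex(2)[OF fC inv(1)[OF D]] h(2) D inv(2)[OF D] by simp
      then show ?thesis using F(3)[OF C_Bij[OF h(1)]] S(2) h(1) by blast
    qed
    then show "\<exists>F. finite F \<and> F \<subseteq> V \<and> (\<forall>h\<in>C. (\<forall>x\<in>F. coset_act h x = coset_act f x) \<longrightarrow> h \<in> U)"
      using F(1) inv(1) by (intro exI[of _ ?F]) auto
  qed (use coset_action_in_C coset_act_vertex tops in auto)
qed

end

section \<open>Products of topological groups and their factors\<close>

text \<open>
  Isomorphisms of topological groups are handled as pairs of mutually inverse continuous homomorphisms;
  unlike \<open>inv_into\<close>, such pairs can be restricted to factors and assembled from factors.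
\<close>

lemma topgroup_isoI:
  assumes f: "f \<in> hom (fst A) (fst B)" and g: "g \<in> hom (fst B) (fst A)"
    and gf: "\<And>x. x \<in> carrier (fst A) \<Longrightarrow> g (f x) = x"
    and fg: "\<And>y. y \<in> carrier (fst B) \<Longrightarrow> f (g y) = y"
    and cf: "continuous_map (snd A) (snd B) f" and cg: "continuous_map (snd B) (snd A) g"
    and top: "topspace (snd B) = carrier (fst B)"
  shows "A \<cong>\<^sub>t B"
proof -
  have cl: "x \<in> carrier (fst A) \<Longrightarrow> f x \<in> carrier (fst B)" "y \<in> carrier (fst B) \<Longrightarrow> g y \<in> carrier (fst A)" for x y
    using f g by (auto simp: hom_def)
  then have bij: "bij_betw f (carrier (fst A)) (carrier (fst B))"
    using gf fg by (intro bij_betw_byWitness[where f' = g]) auto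
  have "inv_into (carrier (fst A)) f y = g y" if "y \<in> carrier (fst B)" for y
    using inv_into_f_f[of f "carrier (fst A)" "g y"] bij that cl fg by (simp add: bij_betw_def)
  then have "continuous_map (snd B) (snd A) (inv_into (carrier (fst A)) f)"
    using cg by (intro continuous_map_eq[OF cg]) (simp add: top)
  then show ?thesis using f bij cf unfolding topgroup_iso_def iso_def by blast
qed

lemma topgroup_isoE:
  assumes "A \<cong>\<^sub>t B" and "group (fst A)"
  obtains f g where "f \<in> hom (fst A) (fst B)" "g \<in> hom (fst B) (fst A)"
    "\<And>x. x \<in> carrier (fst A) \<Longrightarrow> g (f x) = x" "\<And>y. y \<in> carrier (fst B) \<Longrightarrow> f (g y) = y"
    "continuous_map (snd A) (snd B) f" "continuous_map (snd B) (snd A) g"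
proof -
  obtain f where f: "f \<in> iso (fst A) (fst B)" "continuous_map (snd A) (snd B) f"
    "continuous_map (snd B) (snd A) (inv_into (carrier (fst A)) f)"
    using assms(1) unfolding topgroup_iso_def by blast
  let ?g = "inv_into (carrier (fst A)) f"
  have g: "?g \<in> iso (fst B) (fst A)" using group.iso_set_sym[OF assms(2) f(1)] .
  have bij: "bij_betw f (carrier (fst A)) (carrier (fst B))" using f(1) by (simp add: iso_def)
  show ?thesis
  proof (rule that[of f ?g])
    show "f \<in> hom (fst A) (fst B)" "?g \<in> hom (fst B) (fst A)" using f g by (simp_all add: iso_def)
    show "\<And>x. x \<in> carrier (fst A) \<Longrightarrow> ?g (f x) = x" using bij by (simp add: bij_betw_inv_into_left)
    show "\<And>y. y \<in> carrier (fst B) \<Longrightarrow> f (?g y) = y" using bij by (simp add: bij_betw_inv_into_right)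
  qed (use f in auto)
qed

lemma topgroup_prod_fst: "fst (topgroup_prod I F) = product_group I (\<lambda>i. fst (F i))"
  and topgroup_prod_snd: "snd (topgroup_prod I F) = product_topology (\<lambda>i. snd (F i)) I"
  by (simp_all add: topgroup_prod_def)

lemma topgroup_prod_reindex:
  assumes \<tau>: "bij_betw \<tau> I J"
    and iso: "\<And>i. i \<in> I \<Longrightarrow> F i \<cong>\<^sub>t F' (\<tau> i)"
    and grp: "\<And>i. i \<in> I \<Longrightarrow> group (fst (F i))"
    and top': "\<And>j. j \<in> J \<Longrightarrow> topspace (snd (F' j)) = carrier (fst (F' j))"
  shows "topgroup_prod I F \<cong>\<^sub>t topgroup_prod J F'"
proof -
  have "\<forall>i\<in>I. \<exists>f g. f \<in> hom (fst (F i)) (fst (F' (\<tau> i))) \<and> g \<in> hom (fst (F' (\<tau> i))) (fst (F i)) \<and>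
    (\<forall>x\<in>carrier (fst (F i)). g (f x) = x) \<and> (\<forall>y\<in>carrier (fst (F' (\<tau> i))). f (g y) = y) \<and>
    continuous_map (snd (F i)) (snd (F' (\<tau> i))) f \<and> continuous_map (snd (F' (\<tau> i))) (snd (F i)) g"
  proof
    fix i assume i: "i \<in> I"
    show "\<exists>f g. f \<in> hom (fst (F i)) (fst (F' (\<tau> i))) \<and> g \<in> hom (fst (F' (\<tau> i))) (fst (F i)) \<and>
      (\<forall>x\<in>carrier (fst (F i)). g (f x) = x) \<and> (\<forall>y\<in>carrier (fst (F' (\<tau> i))). f (g y) = y) \<and>
      continuous_map (snd (F i)) (snd (F' (\<tau> i))) f \<and> continuous_map (snd (F' (\<tau> i))) (snd (F i)) g"
      by (rule topgroup_isoE[OF iso[OF i] grp[OF i]]) blast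
  qed
  then obtain f g where f: "\<And>i. i \<in> I \<Longrightarrow> f i \<in> hom (fst (F i)) (fst (F' (\<tau> i)))"
    and g: "\<And>i. i \<in> I \<Longrightarrow> g i \<in> hom (fst (F' (\<tau> i))) (fst (F i))"
    and gf: "\<And>i x. i \<in> I \<Longrightarrow> x \<in> carrier (fst (F i)) \<Longrightarrow> g i (f i x) = x"
    and fg: "\<And>i y. i \<in> I \<Longrightarrow> y \<in> carrier (fst (F' (\<tau> i))) \<Longrightarrow> f i (g i y) = y"
    and cf: "\<And>i. i \<in> I \<Longrightarrow> continuous_map (snd (F i)) (snd (F' (\<tau> i))) (f i)"
    and cg: "\<And>i. i \<in> I \<Longrightarrow> continuous_map (snd (F' (\<tau> i))) (snd (F i)) (g i)"
    unfolding bchoice_iff by blast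
  define \<sigma> where "\<sigma> = inv_into I \<tau>"
  have \<sigma>: "\<sigma> j \<in> I" "\<tau> (\<sigma> j) = j" if "j \<in> J" for j
    using \<tau> that by (auto simp: \<sigma>_def bij_betw_def intro: inv_into_into f_inv_into_f)
  have \<sigma>\<tau>: "\<sigma> (\<tau> i) = i" if "i \<in> I" for i
    using \<tau> that by (simp add: \<sigma>_def bij_betw_inv_into_left)
  have \<tau>J: "\<tau> i \<in> J" if "i \<in> I" for i using \<tau> that by (auto simp: bij_betw_def)
  have f': "f (\<sigma> j) \<in> hom (fst (F (\<sigma> j))) (fst (F' j))" if "j \<in> J" for j
    using f[OF \<sigma>(1)[OF that]] \<sigma>(2)[OF that] by simp
  have cf': "continuous_map (snd (F (\<sigma> j))) (snd (F' j)) (f (\<sigma> j))" if "j \<in> J" for j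
    using cf[OF \<sigma>(1)[OF that]] \<sigma>(2)[OF that] by simp
  have fcl: "f (\<sigma> j) x \<in> carrier (fst (F' j))" if "j \<in> J" "x \<in> carrier (fst (F (\<sigma> j)))" for j x
    using f'[OF that(1)] that(2) by (auto simp: hom_def)
  have gcl: "g i y \<in> carrier (fst (F i))" if "i \<in> I" "y \<in> carrier (fst (F' (\<tau> i)))" for i y
    using g[OF that(1)] that(2) by (auto simp: hom_def)
  let ?f = "\<lambda>x. \<lambda>j\<in>J. f (\<sigma> j) (x (\<sigma> j))" and ?g = "\<lambda>y. \<lambda>i\<in>I. g i (y (\<tau> i))"
  show ?thesis
  proof (rule topgroup_isoI[where f = ?f and g = ?g]; unfold topgroup_prod_fst topgroup_prod_snd)
    show "?f \<in> hom (product_group I (\<lambda>i. fst (F i))) (product_group J (\<lambda>j. fst (F' j)))"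
    proof (rule homI)
      fix x y assume "x \<in> carrier (product_group I (\<lambda>i. fst (F i)))" "y \<in> carrier (product_group I (\<lambda>i. fst (F i)))"
      then have "f (\<sigma> j) (x (\<sigma> j) \<otimes>\<^bsub>fst (F (\<sigma> j))\<^esub> y (\<sigma> j)) = f (\<sigma> j) (x (\<sigma> j)) \<otimes>\<^bsub>fst (F' j)\<^esub> f (\<sigma> j) (y (\<sigma> j))"
        if "j \<in> J" for j
        using hom_mult[OF f'[OF that]] \<sigma>(1)[OF that] by (simp add: PiE_iff)
      then show "?f (x \<otimes>\<^bsub>product_group I (\<lambda>i. fst (F i))\<^esub> y) = ?f x \<otimes>\<^bsub>product_group J (\<lambda>j. fst (F' j))\<^esub> ?f y"
        using \<sigma>(1) by (auto intro!: restrict_ext)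
    qed (use fcl \<sigma> in \<open>auto simp: PiE_iff\<close>)
    show "?g \<in> hom (product_group J (\<lambda>j. fst (F' j))) (product_group I (\<lambda>i. fst (F i)))"
    proof (rule homI)
      fix x y assume "x \<in> carrier (product_group J (\<lambda>j. fst (F' j)))" "y \<in> carrier (product_group J (\<lambda>j. fst (F' j)))"
      then have "g i (x (\<tau> i) \<otimes>\<^bsub>fst (F' (\<tau> i))\<^esub> y (\<tau> i)) = g i (x (\<tau> i)) \<otimes>\<^bsub>fst (F i)\<^esub> g i (y (\<tau> i))"
        if "i \<in> I" for i
        using hom_mult[OF g[OF that]] \<tau>J[OF that] by (simp add: PiE_iff)
      then show "?g (x \<otimes>\<^bsub>product_group J (\<lambda>j. fst (F' j))\<^esub> y) = ?g x \<otimes>\<^bsub>product_group I (\<lambda>i. fst (F i))\<^esub> ?g y"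
        using \<tau>J by (auto intro!: restrict_ext)
    qed (use gcl \<tau>J in \<open>auto simp: PiE_iff\<close>)
    show "?g (?f x) = x" if "x \<in> carrier (product_group I (\<lambda>i. fst (F i)))" for x
      using that gf \<tau>J \<sigma>\<tau> by (intro extensionalityI[of _ I]) (auto simp: PiE_iff)
    show "?f (?g y) = y" if "y \<in> carrier (product_group J (\<lambda>j. fst (F' j)))" for y
      using that fg[OF \<sigma>(1)] \<sigma> by (intro extensionalityI[of _ J]) (auto simp: PiE_iff)
    show "continuous_map (product_topology (\<lambda>i. snd (F i)) I) (product_topology (\<lambda>j. snd (F' j)) J) ?f"
      unfolding continuous_map_componentwise
    proof (intro conjI ballI)
      fix j assume j: "j \<in> J"
      have "continuous_map (product_topology (\<lambda>i. snd (F i)) I) (snd (F' j)) (f (\<sigma> j) \<circ> (\<lambda>x. x (\<sigma> j)))"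
        using cf'[OF j] \<sigma>(1)[OF j] by (intro continuous_map_compose[OF continuous_map_product_projection])
      then show "continuous_map (product_topology (\<lambda>i. snd (F i)) I) (snd (F' j)) (\<lambda>x. ?f x j)"
        using j by (simp add: o_def)
    qed auto
    show "continuous_map (product_topology (\<lambda>j. snd (F' j)) J) (product_topology (\<lambda>i. snd (F i)) I) ?g"
      unfolding continuous_map_componentwise
    proof (intro conjI ballI)
      fix i assume i: "i \<in> I"
      have "continuous_map (product_topology (\<lambda>j. snd (F' j)) J) (snd (F i)) (g i \<circ> (\<lambda>x. x (\<tau> i)))"
        using cg[OF i] \<tau>J[OF i] by (intro continuous_map_compose[OF continuous_map_product_projection])
      then show "continuous_map (product_topology (\<lambda>j. snd (F' j)) J) (snd (F i)) (\<lambda>x. ?g x i)"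
        using i by (simp add: o_def)
    qed auto
    show "topspace (product_topology (\<lambda>j. snd (F' j)) J) = carrier (product_group J (\<lambda>j. fst (F' j)))"
      using top' by (auto simp: PiE_iff)
  qed
qed

lemma indecomposableD:
  assumes "indecomposable G" "subgroup P G" "subgroup Q G"
    and "\<And>p q. p \<in> P \<Longrightarrow> q \<in> Q \<Longrightarrow> p \<otimes>\<^bsub>G\<^esub> q = q \<otimes>\<^bsub>G\<^esub> p"
    and "\<And>g. g \<in> carrier G \<Longrightarrow> \<exists>p\<in>P. \<exists>q\<in>Q. g = p \<otimes>\<^bsub>G\<^esub> q"
  shows "P = {\<one>\<^bsub>G\<^esub>} \<or> Q = {\<one>\<^bsub>G\<^esub>}"
  using assms unfolding indecomposable_def by blast

definition inject :: "'i set \<Rightarrow> ('i \<Rightarrow> ('a, 'b) monoid_scheme) \<Rightarrow> 'i \<Rightarrow> 'a \<Rightarrow> 'i \<Rightarrow> 'a"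
  where "inject I G i x = (\<lambda>k\<in>I. if k = i then x else \<one>\<^bsub>G k\<^esub>)"

text \<open>
  The locale is symmetric in the two products (\<open>flip\<close>); each lemma below is stated for one direction and
  used in both.
\<close>

locale product_iso =
  fixes I :: "'i set" and J :: "'j set" and G :: "'i \<Rightarrow> 'a monoid" and H :: "'j \<Rightarrow> 'b monoid"
    and \<phi> and \<psi>
  assumes finite: "finite I" "finite J"
    and groups: "\<And>i. i \<in> I \<Longrightarrow> group (G i)" "\<And>j. j \<in> J \<Longrightarrow> group (H j)"
    and indec: "\<And>i. i \<in> I \<Longrightarrow> indecomposable (G i)" "\<And>j. j \<in> J \<Longrightarrow> indecomposable (H j)"
    and hom: "\<phi> \<in> hom (product_group I G) (product_group J H)" "\<psi> \<in> hom (product_group J H) (product_group I G)"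
    and inverse: "\<And>x. x \<in> carrier (product_group I G) \<Longrightarrow> \<psi> (\<phi> x) = x"
      "\<And>y. y \<in> carrier (product_group J H) \<Longrightarrow> \<phi> (\<psi> y) = y"
begin

lemma flip: "product_iso J I H G \<psi> \<phi>"
  by (rule product_iso.intro) (simp_all add: finite groups indec hom inverse del: carrier_product_group)

abbreviation "PG \<equiv> product_group I G"
abbreviation "PH \<equiv> product_group J H"

lemma group_PG: "group PG" and group_PH: "group PH"
  using groups by auto

lemma \<phi>_closed: "x \<in> carrier PG \<Longrightarrow> \<phi> x \<in> carrier PH" and \<psi>_closed: "y \<in> carrier PH \<Longrightarrow> \<psi> y \<in> carrier PG"
  using hom unfolding hom_def by blast+

lemma nontrivial:
  assumes "j \<in> J" obtains h where "h \<in> carrier (H j)" "h \<noteq> \<one>\<^bsub>H j\<^esub>"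
proof -
  have "\<one>\<^bsub>H j\<^esub> \<in> carrier (H j)" using groups(2)[OF assms] by (simp add: group.is_monoid)
  then show ?thesis using indec(2)[OF assms] that unfolding indecomposable_def by blast
qed

lemma inject_closed: "j \<in> J \<Longrightarrow> h \<in> carrier (H j) \<Longrightarrow> inject J H j h \<in> carrier PH"
  using groups(2) by (auto simp: inject_def PiE_iff group.is_monoid)

lemma inject_closed_G: "i \<in> I \<Longrightarrow> g \<in> carrier (G i) \<Longrightarrow> inject I G i g \<in> carrier PG"
  using groups(1) by (auto simp: inject_def PiE_iff group.is_monoid)

lemma inject_hom: "j \<in> J \<Longrightarrow> inject J H j \<in> hom (H j) PH"
proof (rule homI)
  fix x y assume "j \<in> J" "x \<in> carrier (H j)" "y \<in> carrier (H j)"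
  then show "inject J H j (x \<otimes>\<^bsub>H j\<^esub> y) = inject J H j x \<otimes>\<^bsub>PH\<^esub> inject J H j y"
    using groups(2) by (auto simp: inject_def group.is_monoid intro!: restrict_ext)
qed (rule inject_closed)

lemma split_off_factor:
  assumes j: "j \<in> J" and y: "y \<in> carrier PH"
  obtains z where "z \<in> carrier PH" "z j = \<one>\<^bsub>H j\<^esub>" "\<And>k. k \<noteq> j \<Longrightarrow> z k = y k"
    "y = inject J H j (y j) \<otimes>\<^bsub>PH\<^esub> z"
proof (rule that)
  let ?z = "y(j := \<one>\<^bsub>H j\<^esub>)"
  have yc: "\<And>k. k \<in> J \<Longrightarrow> y k \<in> carrier (H k)" and ext: "y \<in> extensional J"
    using y by (auto simp: PiE_iff)
  show "?z \<in> carrier PH"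
    using yc ext groups(2) j by (auto simp: PiE_iff group.is_monoid extensional_def)
  show "y = inject J H j (y j) \<otimes>\<^bsub>PH\<^esub> ?z"
    using yc ext groups(2) by (intro extensionalityI[of _ J]) (auto simp: inject_def group.is_monoid)
qed auto

text \<open>
  This is where finiteness of the index set enters: an element of the product is a finite product of its
  components.
\<close>

lemma inject_generate:
  assumes N: "subgroup N PH" and gen: "\<And>j h. j \<in> J \<Longrightarrow> h \<in> carrier (H j) \<Longrightarrow> inject J H j h \<in> N"
  shows "N = carrier PH"
proof
  show "N \<subseteq> carrier PH" using N by (rule subgroup.subset)
  have "y \<in> N" if "S \<subseteq> J" "y \<in> carrier PH" "\<And>j. j \<in> J - S \<Longrightarrow> y j = \<one>\<^bsub>H j\<^esub>" for S y
    using finite_subset[OF that(1) finite(2)] that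
  proof (induction S arbitrary: y rule: finite_induct)
    case empty
    then have "y = \<one>\<^bsub>PH\<^esub>" by (intro extensionalityI[of _ J]) (auto simp: PiE_iff)
    then show ?case by (simp only: subgroup.one_closed[OF N])
  next
    case (insert j S)
    then have j: "j \<in> J" by blast
    obtain z where z: "z \<in> carrier PH" "z j = \<one>\<^bsub>H j\<^esub>" "\<And>k. k \<noteq> j \<Longrightarrow> z k = y k"
      "y = inject J H j (y j) \<otimes>\<^bsub>PH\<^esub> z"
      by (rule split_off_factor[OF j insert.prems(2)]) blast
    have "z k = \<one>\<^bsub>H k\<^esub>" if "k \<in> J - S" for k
      using insert.prems(3)[of k] z(2,3) that by (cases "k = j") auto
    then have "z \<in> N" using insert.IH[of z] insert.prems(1) z(1) by simp
    moreover have "inject J H j (y j) \<in> N"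
      using insert.prems(2) j by (intro gen[OF j]) (simp add: PiE_iff)
    ultimately show ?case by (subst z(4)) (rule subgroup.m_closed[OF N])
  qed
  from this[of J] show "carrier PH \<subseteq> N" by auto
qed

definition component :: "'i \<Rightarrow> ('j \<Rightarrow> 'b) \<Rightarrow> 'a"
  where "component i y = \<psi> y i"

lemma component_hom:
  assumes i: "i \<in> I" shows "component i \<in> hom PH (G i)"
proof (rule homI)
  show "component i y \<in> carrier (G i)" if "y \<in> carrier PH" for y
    using \<psi>_closed[OF that] i by (simp add: component_def PiE_iff)
  show "component i (x \<otimes>\<^bsub>PH\<^esub> y) = component i x \<otimes>\<^bsub>G i\<^esub> component i y"
    if "x \<in> carrier PH" "y \<in> carrier PH" for x y
    using hom_mult[OF hom(2) that] i by (simp add: component_def)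
qed

lemma component_surj:
  assumes "i \<in> I" "g \<in> carrier (G i)"
  shows "component i (\<phi> (inject I G i g)) = g"
  using inverse(1)[OF inject_closed_G[OF assms]] assms by (simp add: component_def inject_def)

definition linked :: "'i \<Rightarrow> 'j \<Rightarrow> bool"
  where "linked i j \<longleftrightarrow> (\<exists>h\<in>carrier (H j). \<psi> (inject J H j h) i \<noteq> \<one>\<^bsub>G i\<^esub>)"

text \<open>
  Otherwise all factors \<open>H j\<close>, and hence the whole product, would vanish in \<open>G i\<close>.
\<close>

lemma linked_ex:
  assumes i: "i \<in> I" shows "\<exists>j\<in>J. linked i j"
proof (rule ccontr)
  assume none: "\<not> ?thesis"
  interpret c: group_hom PH "G i" "component i"
    using component_hom[OF i] group_PH groups(1)[OF i] by (simp add: group_hom_def group_hom_axioms_def)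
  have "kernel PH (G i) (component i) = carrier PH"
    by (rule inject_generate[OF c.subgroup_kernel])
      (use none inject_closed in \<open>auto simp: kernel_def component_def linked_def\<close>)
  then have "component i y = \<one>\<^bsub>G i\<^esub>" if "y \<in> carrier PH" for y using that by (auto simp: kernel_def)
  then have "g = \<one>\<^bsub>G i\<^esub>" if "g \<in> carrier (G i)" for g
    using component_surj[OF i that] \<phi>_closed[OF inject_closed_G[OF i that]] by simp
  then show False using product_iso.nontrivial[OF flip i] by metis
qed

text \<open>
  The image of \<open>H j\<close> in \<open>G i\<close> commutes with the image of the product of all the other factors, and together
  they make up \<open>G i\<close>.  As \<open>G i\<close> is indecomposable and the first image is nontrivial, the second is trivial;
  it contains the image of \<open>H k\<close>.
\<close>

lemma linked_unique:
  assumes i: "i \<in> I" and j: "j \<in> J" "linked i j" and k: "k \<in> J" "linked i k"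
  shows "j = k"
proof (rule ccontr)
  assume ne: "j \<noteq> k"
  interpret c: group_hom PH "G i" "component i"
    using component_hom[OF i] group_PH groups(1)[OF i] by (simp add: group_hom_def group_hom_axioms_def)
  let ?S = "inject J H j ` carrier (H j)" and ?R = "{y \<in> carrier PH. y j = \<one>\<^bsub>H j\<^esub>}"
  let ?P = "component i ` ?S" and ?Q = "component i ` ?R"
  interpret Hj: group "H j" using groups(2) j by blast
  have S: "subgroup ?S PH"
    using group_hom.img_is_subgroup[of "H j" PH "inject J H j"] inject_hom[OF j(1)] Hj.group_axioms group_PH
    by (simp add: group_hom_def group_hom_axioms_def)
  have R: "subgroup ?R PH"
  proof -
    have "(\<lambda>y. y j) \<in> hom PH (H j)" using j(1) by (auto simp: hom_def PiE_iff)
    then have "group_hom PH (H j) (\<lambda>y. y j)"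
      using group_PH Hj.group_axioms by (simp add: group_hom_def group_hom_axioms_def)
    from group_hom.subgroup_kernel[OF this] show ?thesis by (simp add: kernel_def)
  qed
  have "subgroup ?P (G i)" "subgroup ?Q (G i)"
    using c.subgroup_img_is_subgroup S R by blast+
  moreover have "p \<otimes>\<^bsub>G i\<^esub> q = q \<otimes>\<^bsub>G i\<^esub> p" if pq: "p \<in> ?P" "q \<in> ?Q" for p q
  proof -
    obtain h y where h: "h \<in> carrier (H j)" "p = component i (inject J H j h)"
      and y: "y \<in> carrier PH" "y j = \<one>\<^bsub>H j\<^esub>" "q = component i y"
      using pq by blast
    have "inject J H j h \<otimes>\<^bsub>PH\<^esub> y = y \<otimes>\<^bsub>PH\<^esub> inject J H j h"
      using h(1) y groups(2) by (auto simp: inject_def PiE_iff group.is_monoid intro!: restrict_ext)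
    then show ?thesis using h y inject_closed[OF j(1) h(1)] by (metis c.hom_mult)
  qed
  moreover have "\<exists>p\<in>?P. \<exists>q\<in>?Q. g = p \<otimes>\<^bsub>G i\<^esub> q" if g: "g \<in> carrier (G i)" for g
  proof -
    define y where "y = \<phi> (inject I G i g)"
    have y: "y \<in> carrier PH" using \<phi>_closed[OF inject_closed_G[OF i g]] by (simp add: y_def)
    then have yj: "y j \<in> carrier (H j)" using j(1) by (simp add: PiE_iff)
    obtain z where z: "z \<in> carrier PH" "z j = \<one>\<^bsub>H j\<^esub>" "y = inject J H j (y j) \<otimes>\<^bsub>PH\<^esub> z"
      by (rule split_off_factor[OF j(1) y]) blast
    have "component i y = component i (inject J H j (y j)) \<otimes>\<^bsub>G i\<^esub> component i z"
      by (subst z(3), rule c.hom_mult[OF inject_closed[OF j(1) yj] z(1)])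
    then have "g = component i (inject J H j (y j)) \<otimes>\<^bsub>G i\<^esub> component i z"
      using component_surj[OF i g] by (simp add: y_def)
    then show ?thesis using z(1,2) yj by blast
  qed
  ultimately have "?P = {\<one>\<^bsub>G i\<^esub>} \<or> ?Q = {\<one>\<^bsub>G i\<^esub>}"
    by (rule indecomposableD[OF indec(1)[OF i]])
  then show False
  proof
    assume "?P = {\<one>\<^bsub>G i\<^esub>}"
    then have "component i (inject J H j h) = \<one>\<^bsub>G i\<^esub>" if "h \<in> carrier (H j)" for h using that by blast
    then show False using j(2) by (auto simp: linked_def component_def)
  next
    assume Q: "?Q = {\<one>\<^bsub>G i\<^esub>}"
    have "component i (inject J H k h) = \<one>\<^bsub>G i\<^esub>" if "h \<in> carrier (H k)" for h
    proof -
      have "inject J H k h \<in> ?R" using inject_closed[OF k(1) that] j(1) ne by (simp add: inject_def)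
      then show ?thesis using Q by blast
    qed
    then show False using k(2) by (auto simp: linked_def component_def)
  qed
qed

definition partner :: "'i \<Rightarrow> 'j" where "partner i = (THE j. j \<in> J \<and> linked i j)"

lemma partner:
  assumes "i \<in> I"
  shows "partner i \<in> J" and "linked i (partner i)" and "j \<in> J \<Longrightarrow> linked i j \<longleftrightarrow> j = partner i"
proof -
  have "\<exists>!j. j \<in> J \<and> linked i j" using linked_ex[OF assms] linked_unique[OF assms] by blast
  then have "partner i \<in> J \<and> linked i (partner i)" unfolding partner_def by (rule theI')
  then show "partner i \<in> J" "linked i (partner i)" "j \<in> J \<Longrightarrow> linked i j \<longleftrightarrow> j = partner i"
    using linked_unique[OF assms] by blast+
qed

lemma \<psi>_inject_nontrivial:
  assumes j: "j \<in> J" and h: "h \<in> carrier (H j)" "h \<noteq> \<one>\<^bsub>H j\<^esub>"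
  shows "\<exists>i\<in>I. \<psi> (inject J H j h) i \<noteq> \<one>\<^bsub>G i\<^esub>"
proof (rule ccontr)
  assume none: "\<not> ?thesis"
  note c = inject_closed[OF j h(1)]
  have "\<psi> (inject J H j h) = \<one>\<^bsub>PG\<^esub>"
    using none \<psi>_closed[OF c] by (intro extensionalityI[of _ I]) (auto simp: PiE_iff)
  then have "inject J H j h = \<phi> \<one>\<^bsub>PG\<^esub>" using inverse(2)[OF c] by simp
  also have "\<dots> = \<one>\<^bsub>PH\<^esub>" using hom_one[OF hom(1) group_PG group_PH] .
  finally have "inject J H j h j = \<one>\<^bsub>PH\<^esub> j" by simp
  then show False using j h by (simp add: inject_def)
qed

lemma partner_surj: "partner ` I = J"
proof
  show "partner ` I \<subseteq> J" using partner by blast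
  show "J \<subseteq> partner ` I"
  proof
    fix j assume j: "j \<in> J"
    obtain h where h: "h \<in> carrier (H j)" "h \<noteq> \<one>\<^bsub>H j\<^esub>" using nontrivial[OF j] .
    then obtain i where i: "i \<in> I" "\<psi> (inject J H j h) i \<noteq> \<one>\<^bsub>G i\<^esub>" using \<psi>_inject_nontrivial[OF j] by blast
    then have "linked i j" using h by (auto simp: linked_def)
    then show "j \<in> partner ` I" using partner(3)[OF i(1) j] i(1) by blast
  qed
qed

lemma card_le: "card J \<le> card I"
  using card_image_le[OF finite(1), of partner] by (simp add: partner_surj)

text \<open>
  Each factor on one side is linked to exactly one on the other, and every factor is hit because the
  isomorphism is injective.  By symmetry the index sets have the same size.
\<close>

lemma partner_bij: "bij_betw partner I J"
proof -
  have "card I = card J" using card_le product_iso.card_le[OF flip] by simp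
  then have "inj_on partner I" using partner_surj finite(1) by (intro eq_card_imp_inj_on) auto
  then show ?thesis using partner_surj by (simp add: bij_betw_def)
qed

text \<open>
  The image of the factor \<open>H (partner i)\<close> is supported at \<open>i\<close> alone, as every other index has a different
  partner.
\<close>

lemma \<psi>_inject:
  assumes i: "i \<in> I" and h: "h \<in> carrier (H (partner i))"
  shows "\<psi> (inject J H (partner i) h) = inject I G i (\<psi> (inject J H (partner i) h) i)"
proof (rule extensionalityI[of _ I])
  let ?y = "\<psi> (inject J H (partner i) h)"
  have c: "?y \<in> carrier PG" using \<psi>_closed[OF inject_closed[OF partner(1)[OF i] h]] .
  then show "?y \<in> extensional I" by (simp add: PiE_iff)
  fix k assume k: "k \<in> I"
  show "?y k = inject I G i (?y i) k"
  proof (cases "k = i")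
    case False
    then have "partner i \<noteq> partner k" using partner_bij i k by (auto simp: bij_betw_def inj_on_def)
    then have "\<not> linked k (partner i)" using partner(3)[OF k partner(1)[OF i]] by blast
    then show ?thesis using h k False by (auto simp: linked_def inject_def)
  qed (use k in \<open>simp add: inject_def\<close>)
qed (simp add: inject_def)

lemma partner_flip:
  assumes i: "i \<in> I"
  shows "product_iso.partner I H G \<phi> (partner i) = i"
proof -
  interpret flip: product_iso J I H G \<psi> \<phi> by (rule flip)
  let ?j = "partner i"
  have j: "?j \<in> J" by (rule partner(1)[OF i])
  obtain h where h: "h \<in> carrier (H ?j)" "h \<noteq> \<one>\<^bsub>H ?j\<^esub>" using nontrivial[OF j] .
  let ?g = "\<psi> (inject J H ?j h) i"
  have "?g \<in> carrier (G i)" using \<psi>_closed[OF inject_closed[OF j h(1)]] i by (simp add: PiE_iff)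
  moreover have "\<phi> (inject I G i ?g) ?j \<noteq> \<one>\<^bsub>H ?j\<^esub>"
    unfolding \<psi>_inject[OF i h(1), symmetric] inverse(2)[OF inject_closed[OF j h(1)]]
    using j h by (simp add: inject_def)
  ultimately have "flip.linked ?j i" unfolding flip.linked_def by blast
  then show ?thesis using flip.partner(3)[OF j i] by simp
qed

lemma factor_inverse:
  assumes i: "i \<in> I"
  shows "h \<in> carrier (H (partner i)) \<Longrightarrow> \<phi> (inject I G i (\<psi> (inject J H (partner i) h) i)) (partner i) = h"
    and "g \<in> carrier (G i) \<Longrightarrow> \<psi> (inject J H (partner i) (\<phi> (inject I G i g) (partner i))) i = g"
proof -
  interpret flip: product_iso J I H G \<psi> \<phi> by (rule flip)
  have j: "partner i \<in> J" by (rule partner(1)[OF i])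
  show "\<phi> (inject I G i (\<psi> (inject J H (partner i) h) i)) (partner i) = h" if "h \<in> carrier (H (partner i))"
    unfolding \<psi>_inject[OF i that, symmetric] inverse(2)[OF inject_closed[OF j that]] using j by (simp add: inject_def)
  show "\<psi> (inject J H (partner i) (\<phi> (inject I G i g) (partner i))) i = g" if g: "g \<in> carrier (G i)"
    using flip.\<psi>_inject[OF j, of g] inverse(1)[OF inject_closed_G[OF i g]] i g
    by (simp add: partner_flip[OF i] inject_def[of I])
qed

end

lemma topgroup_prod_unique_factors:
  fixes F :: "'i \<Rightarrow> 'a topgroup" and F' :: "'j \<Rightarrow> 'b topgroup"
  assumes fin: "finite I" "finite J"
    and grp: "\<And>i. i \<in> I \<Longrightarrow> group (fst (F i))" "\<And>j. j \<in> J \<Longrightarrow> group (fst (F' j))"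
    and indec: "\<And>i. i \<in> I \<Longrightarrow> indecomposable (fst (F i))" "\<And>j. j \<in> J \<Longrightarrow> indecomposable (fst (F' j))"
    and top: "\<And>i. i \<in> I \<Longrightarrow> topspace (snd (F i)) = carrier (fst (F i))"
      "\<And>j. j \<in> J \<Longrightarrow> topspace (snd (F' j)) = carrier (fst (F' j))"
    and iso: "topgroup_prod I F \<cong>\<^sub>t topgroup_prod J F'"
  obtains \<tau> where "bij_betw \<tau> I J" and "\<And>i. i \<in> I \<Longrightarrow> F i \<cong>\<^sub>t F' (\<tau> i)"
proof -
  let ?G = "\<lambda>i. fst (F i)" and ?H = "\<lambda>j. fst (F' j)"
  let ?TG = "product_topology (\<lambda>i. snd (F i)) I" and ?TH = "product_topology (\<lambda>j. snd (F' j)) J"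
  have "group (fst (topgroup_prod I F))" using grp by (simp add: topgroup_prod_fst)
  then obtain \<phi> \<psi> where h: "\<phi> \<in> hom (product_group I ?G) (product_group J ?H)" "\<psi> \<in> hom (product_group J ?H) (product_group I ?G)"
    and inv: "\<And>x. x \<in> carrier (product_group I ?G) \<Longrightarrow> \<psi> (\<phi> x) = x"
      "\<And>y. y \<in> carrier (product_group J ?H) \<Longrightarrow> \<phi> (\<psi> y) = y"
    and cont: "continuous_map ?TG ?TH \<phi>" "continuous_map ?TH ?TG \<psi>"
    using topgroup_isoE[OF iso] unfolding topgroup_prod_fst topgroup_prod_snd by blast
  interpret product_iso I J ?G ?H \<phi> \<psi>
    by (rule product_iso.intro) (simp_all add: fin grp indec h inv del: carrier_product_group)
  have cont_inject: "continuous_map (snd (F i)) ?TG (inject I ?G i)" if i: "i \<in> I" for i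
    unfolding continuous_map_componentwise
  proof (intro conjI ballI)
    fix k assume k: "k \<in> I"
    have "\<one>\<^bsub>?G k\<^esub> \<in> topspace (snd (F k))" using grp(1)[OF k] top(1)[OF k] by (simp add: group.is_monoid)
    then show "continuous_map (snd (F i)) (snd (F k)) (\<lambda>x. inject I ?G i x k)"
      using k by (cases "k = i") (auto simp: inject_def)
  qed (auto simp: inject_def)
  have cont_inject': "continuous_map (snd (F' j)) ?TH (inject J ?H j)" if j: "j \<in> J" for j
    unfolding continuous_map_componentwise
  proof (intro conjI ballI)
    fix k assume k: "k \<in> J"
    have "\<one>\<^bsub>?H k\<^esub> \<in> topspace (snd (F' k))" using grp(2)[OF k] top(2)[OF k] by (simp add: group.is_monoid)
    then show "continuous_map (snd (F' j)) (snd (F' k)) (\<lambda>x. inject J ?H j x k)"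
      using k by (cases "k = j") (auto simp: inject_def)
  qed (auto simp: inject_def)
  have "F i \<cong>\<^sub>t F' (partner i)" if i: "i \<in> I" for i
  proof (rule topgroup_isoI[where f = "\<lambda>g. \<phi> (inject I ?G i g) (partner i)" and g = "\<lambda>h. \<psi> (inject J ?H (partner i) h) i"])
    have j: "partner i \<in> J" by (rule partner(1)[OF i])
    show "(\<lambda>h. \<psi> (inject J ?H (partner i) h) i) \<in> hom (?H (partner i)) (?G i)"
      using hom_compose[OF inject_hom[OF j] component_hom[OF i]] by (simp add: component_def[abs_def] o_def)
    show "(\<lambda>g. \<phi> (inject I ?G i g) (partner i)) \<in> hom (?G i) (?H (partner i))"
      using hom_compose[OF product_iso.inject_hom[OF flip i] product_iso.component_hom[OF flip j]]
      by (simp add: product_iso.component_def[OF flip, abs_def] o_def)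
    show "continuous_map (snd (F i)) (snd (F' (partner i))) (\<lambda>g. \<phi> (inject I ?G i g) (partner i))"
      using continuous_map_compose[OF continuous_map_compose[OF cont_inject[OF i] cont(1)]
          continuous_map_product_projection[OF j]] by (simp add: o_def)
    show "continuous_map (snd (F' (partner i))) (snd (F i)) (\<lambda>h. \<psi> (inject J ?H (partner i) h) i)"
      using continuous_map_compose[OF continuous_map_compose[OF cont_inject'[OF j] cont(2)]
          continuous_map_product_projection[OF i]] by (simp add: o_def)
    show "topspace (snd (F' (partner i))) = carrier (fst (F' (partner i)))" using top(2)[OF j] .
  qed (use factor_inverse[OF i] in auto)
  then show ?thesis using that partner_bij by blast
qed

section \<open>Products of completions of Baumslag-Solitar groups\<close>

lemma
  assumes "2 \<le> \<bar>m\<bar>" "\<bar>m\<bar> \<le> n"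
  shows group_BS_completion: "group (fst (BS_completion m n))"
    and indecomposable_BS_completion: "indecomposable (fst (BS_completion m n))"
    and topspace_BS_completion: "topspace (snd (BS_completion m n)) = carrier (fst (BS_completion m n))"
proof -
  interpret bs_tree m n by unfold_locales (use assms in auto)
  interpret bs_completion m n "fst (BS_completion m n)" "snd (BS_completion m n)" coset_act "coset_action B A"
    by (rule BS_completion_is_bs_completion)
  show "group (fst (BS_completion m n))" by (rule group_axioms)
  show "indecomposable (fst (BS_completion m n))" by (rule indecomposable)
  show "topspace (snd (BS_completion m n)) = carrier (fst (BS_completion m n))" by (rule topspace_T)
qed

lemma BS_completion_iso_parameters:
  assumes mn: "2 \<le> \<bar>m\<bar>" "\<bar>m\<bar> \<le> n" and pq: "2 \<le> \<bar>p\<bar>" "\<bar>p\<bar> \<le> q"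
    and iso: "BS_completion m n \<cong>\<^sub>t BS_completion p q"
  shows "\<bar>m\<bar> = \<bar>p\<bar> \<and> n = q \<and> (\<bar>m\<bar> < n \<longrightarrow> m = p)"
proof -
  have G: "bs_tree m n" and H: "bs_tree p q" using mn pq by (auto intro: bs_tree.intro)
  obtain \<phi> where "\<phi> \<in> iso (fst (BS_completion m n)) (fst (BS_completion p q))"
    "continuous_map (snd (BS_completion m n)) (snd (BS_completion p q)) \<phi>"
    "continuous_map (snd (BS_completion p q)) (snd (BS_completion m n))
      (inv_into (carrier (fst (BS_completion m n))) \<phi>)"
    using iso unfolding topgroup_iso_def by blast
  then show ?thesis
    by (rule parameters_determined[OF bs_tree.BS_completion_is_bs_completion[OF G] bs_tree.BS_completion_is_bs_completion[OF H]])
qed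

theorem theorem2:
  fixes k l :: nat and m n p q :: "nat \<Rightarrow> int"
  assumes "k \<noteq> 0" and "l \<noteq> 0"
    and "\<And>i. i \<in> {1..k} \<Longrightarrow> 2 \<le> \<bar>m i\<bar> \<and> \<bar>m i\<bar> \<le> n i"
    and "\<And>j. j \<in> {1..l} \<Longrightarrow> 2 \<le> \<bar>p j\<bar> \<and> \<bar>p j\<bar> \<le> q j"
  shows
    "(topgroup_prod {1..k} (\<lambda>i. BS_completion (m i) (n i)) \<cong>\<^sub>t topgroup_prod {1..l} (\<lambda>j. BS_completion (p j) (q j))
      \<longleftrightarrow> k = l \<and>
          (\<exists>\<sigma>. \<sigma> permutes {1..k} \<and>
               (\<forall>i\<in>{1..k}. BS_completion (m i) (n i) \<cong>\<^sub>t BS_completion (p (\<sigma> i)) (q (\<sigma> i)))))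
     \<and>
     (\<forall>\<sigma>. k = l \<and> \<sigma> permutes {1..k} \<and>
           (\<forall>i\<in>{1..k}. BS_completion (m i) (n i) \<cong>\<^sub>t BS_completion (p (\<sigma> i)) (q (\<sigma> i)))
        \<longrightarrow> (\<forall>i\<in>{1..k}.
               (\<bar>m i\<bar> = n i \<longrightarrow>
                  \<bar>m i\<bar> = n i \<and> n i = \<bar>p (\<sigma> i)\<bar> \<and> \<bar>p (\<sigma> i)\<bar> = q (\<sigma> i)) \<and>
               (\<bar>m i\<bar> \<noteq> n i \<longrightarrow> m i = p (\<sigma> i) \<and> n i = q (\<sigma> i))))"
proof -
  let ?F = "\<lambda>i. BS_completion (m i) (n i)" and ?F' = "\<lambda>j. BS_completion (p j) (q j)"
  note facts = group_BS_completion indecomposable_BS_completion topspace_BS_completion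
  have F: "group (fst (?F i))" "indecomposable (fst (?F i))" "topspace (snd (?F i)) = carrier (fst (?F i))"
    if "i \<in> {1..k}" for i
    using assms(3)[OF that] by (simp_all add: facts)
  have F': "group (fst (?F' j))" "indecomposable (fst (?F' j))" "topspace (snd (?F' j)) = carrier (fst (?F' j))"
    if "j \<in> {1..l}" for j
    using assms(4)[OF that] by (simp_all add: facts)
  have params: "\<bar>m i\<bar> = \<bar>p j\<bar> \<and> n i = q j \<and> (\<bar>m i\<bar> < n i \<longrightarrow> m i = p j)"
    if "i \<in> {1..k}" "j \<in> {1..l}" "?F i \<cong>\<^sub>t ?F' j" for i j
    using assms(3)[OF that(1)] assms(4)[OF that(2)] that(3) by (intro BS_completion_iso_parameters) auto
  have forward: "k = l \<and> (\<exists>\<sigma>. \<sigma> permutes {1..k} \<and> (\<forall>i\<in>{1..k}. ?F i \<cong>\<^sub>t ?F' (\<sigma> i)))"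
    if iso: "topgroup_prod {1..k} ?F \<cong>\<^sub>t topgroup_prod {1..l} ?F'"
  proof -
    obtain \<tau> where \<tau>: "bij_betw \<tau> {1..k} {1..l}" "\<And>i. i \<in> {1..k} \<Longrightarrow> ?F i \<cong>\<^sub>t ?F' (\<tau> i)"
      by (rule topgroup_prod_unique_factors[OF _ _ F(1) F'(1) F(2) F'(2) F(3) F'(3) iso]) auto
    have kl: "k = l" using bij_betw_same_card[OF \<tau>(1)] by simp
    define \<sigma> where "\<sigma> i = (if i \<in> {1..k} then \<tau> i else i)" for i
    have "bij_betw \<sigma> {1..k} {1..l}"
      using \<tau>(1) bij_betw_cong[of "{1..k}" \<sigma> \<tau> "{1..l}"] by (simp add: \<sigma>_def)
    then have "bij_betw \<sigma> {1..k} {1..k}" unfolding kl .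
    then have "\<sigma> permutes {1..k}" by (rule bij_imp_permutes) (auto simp: \<sigma>_def)
    moreover have "\<forall>i\<in>{1..k}. ?F i \<cong>\<^sub>t ?F' (\<sigma> i)" using \<tau>(2) by (simp add: \<sigma>_def)
    ultimately show ?thesis using kl by blast
  qed
  have backward: "topgroup_prod {1..k} ?F \<cong>\<^sub>t topgroup_prod {1..l} ?F'"
    if "k = l" "\<sigma> permutes {1..k}" "\<forall>i\<in>{1..k}. ?F i \<cong>\<^sub>t ?F' (\<sigma> i)" for \<sigma>
  proof (rule topgroup_prod_reindex[of \<sigma>])
    show "bij_betw \<sigma> {1..k} {1..l}" using permutes_imp_bij[OF that(2)] that(1) by simp
  qed (use that(3) F(1) F'(3) in auto)
  have "(\<bar>m i\<bar> = n i \<longrightarrow> \<bar>m i\<bar> = n i \<and> n i = \<bar>p (\<sigma> i)\<bar> \<and> \<bar>p (\<sigma> i)\<bar> = q (\<sigma> i)) \<and>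
      (\<bar>m i\<bar> \<noteq> n i \<longrightarrow> m i = p (\<sigma> i) \<and> n i = q (\<sigma> i))"
    if "k = l" "\<sigma> permutes {1..k}" "\<forall>i\<in>{1..k}. ?F i \<cong>\<^sub>t ?F' (\<sigma> i)" and i: "i \<in> {1..k}" for \<sigma> i
  proof -
    have "\<sigma> i \<in> {1..l}" using permutes_in_image[OF that(2), of i] i that(1) by blast
    then have "\<bar>m i\<bar> = \<bar>p (\<sigma> i)\<bar> \<and> n i = q (\<sigma> i) \<and> (\<bar>m i\<bar> < n i \<longrightarrow> m i = p (\<sigma> i))"
      using params[OF i] that(3) i by blast
    then show ?thesis using assms(3)[OF i] by linarith
  qed
  then show ?thesis using forward backward by (intro conjI iffI allI impI ballI) blast+
qed

end
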